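(* The lightlike normal curvature $\kappa_N$ is an extrinsic invariant for real analytic generic mixed type surfaces. That is: let $f:\Sigma\to\mathbf{L}^3$ be a real analytic generic mixed type surface with first fundamental form $ds^2$, and let $p\in\Sigma$ be a lightlike point of the first kind. Then there exist a neighborhood $U$ of $p$ and a real analytic mixed type surface $\tilde f:U\to\mathbf{L}^3$ whose first fundamental form coincides with $ds^2$ on $U$, but whose lightlike normal curvature does not coincide with the lightlike normal curvature of $f$ along the set of lightlike points in $U$.
   Context: $\mathbf{L}^3$ is $\mathbb R^3$ with the bilinear form $\langle x,y\rangle=x_1y_1+x_2y_2-x_3y_3$. A non-zero vector $x$ is spacelike, timelike or lightlike if $\langle x,x\rangle$ is $>0$, $<0$ or $=0$; $|x|:=\sqrt{|\langle x,x\rangle|}$. A surface is an embedding $f:\Sigma\to\mathbf{L}^3$ of a connected 2-manifold; its first fundamental form is $ds^2=f^*\langle\cdot,\cdot\rangle$. A point is spacelike, timelike or lightlike if $ds^2$ there is positive definite, indefinite (non-degenerate) or degenerate; $LD$ is the set of lightlike points. $f$ is a mixed type surface if spacelike, timelike and lightlike points all exist. In local coordinates $ds^2=E\,du^2+2F\,du\,dv+G\,dv^2$ and $\lambda:=EG-F^2$. A lightlike point $p$ is non-degenerate if $d\lambda(p)\ne0$; then near $p$ the set $LD$ is the image of a regular curve $c(t)$ with $c(0)=p$, called a characteristic curve. Such $p$ is of the first kind (second kind) if $\hat c'(0)$ is spacelike (lightlike), where $\hat c=f\circ c$. A null vector at $p\in LD$ is a non-zero $w\in T_p\Sigma$ with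 $ds^2(w,\cdot)=0$. A null vector field $\eta$ near $p\in LD$ is a vector field near $p$ whose restriction to $LD$ consists of null vectors. A regular curve $c$ with $c(0)=p$ is non-null at $p$ if $c'(0)$ is not a null vector. Let $p=c(0)$ be of the first kind, $c$ a characteristic curve, $\eta$ a null vector field, $\boldsymbol e(t)=\hat c'(t)/|\hat c'(t)|$, $L(t)=df(\eta_{c(t)})$, $N(t)$ the unique lightlike vector field along $\hat c$ with $\langle N,N\rangle=\langle N,\boldsymbol e\rangle=0$, $\langle N,L\rangle=1$, and $\beta(t)=(\eta\langle df(\eta),df(\eta)\rangle)(c(t))$ (derivative of $\langle df(\eta),df(\eta)\rangle$ in direction $\eta$; it is non-zero). The lightlike singular curvature and the lightlike normal curvature are $$\kappa_L(p)=\frac{\langle\hat c''(0),L(0)\rangle}{\beta(0)^{1/3}|\hat c'(0)|^2},\qquad \kappa_N(p)=\frac{\beta(0)^{1/3}\langle\hat c''(0),N(0)\rangle}{|\hat c'(0)|^2},$$ independent of the choices. An invariant is extrinsic if there is a mixed type surface $\tilde f$ with the same first fundamental form as $f$ on which the invariant does not coincide with that of $f$. Geodesic curvature: for a curve $c$ non-null at a lightlike point $p=c(0)$ of the second kind, $c(t)\notin LD$ and $ds^2(c',c')>0$ for small $t\neq0$, and $\kappa_g(t)=ds^2(\nabla_{c'}c',n_g)/ds^2(c',c')$, where $\nabla$ is the Levi-Civita connection of $ds^2$ off $LD$ and $n_g$ is the unit normal along $c$ ($ds^2(n_g,n_g)=\pm1$). A non-degenerate lightlike point $p$ is generic if: (I)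 when $p$ is of the first kind, $\kappa_L(p)\neq0$; (II) when $p$ is of the second kind, there is a curve $c$ non-null at $p=c(0)$ whose geodesic curvature function $\kappa_g(t)$ $(t\ne0)$ is unbounded at $t=0$. A mixed type surface is generic if all its lightlike points are (non-degenerate and) generic. *)

theory Defs
  imports "HOL-Analysis.Analysis"
begin

section \<open>Real analytic and smooth maps on open sets\<close>

definition real_analytic_on :: "(real^2) set \<Rightarrow> (real^2 \<Rightarrow> 'b::real_normed_vector) \<Rightarrow> bool" where
  "real_analytic_on D h \<longleftrightarrow>
     (\<forall>a\<in>D. \<exists>(r::real) > 0. \<exists>coef :: nat \<times> nat \<Rightarrow> 'b. \<forall>x. dist x a < r \<longrightarrow>
        ((\<lambda>(i, j). ((x$1 - a$1) ^ i * (x$2 - a$2) ^ j) *\<^sub>R coef (i, j)) has_sum h x) UNIV)"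

primrec Ck_on :: "nat \<Rightarrow> 'a::real_normed_vector set \<Rightarrow> ('a \<Rightarrow> 'b::real_normed_vector) \<Rightarrow> bool" where
  "Ck_on 0 S h \<longleftrightarrow> continuous_on S h"
| "Ck_on (Suc k) S h \<longleftrightarrow>
     (\<forall>x\<in>S. h differentiable (at x)) \<and>
     (\<forall>v. Ck_on k S (\<lambda>x. frechet_derivative h (at x) v))"

definition smooth_on :: "'a::real_normed_vector set \<Rightarrow> ('a \<Rightarrow> 'b::real_normed_vector) \<Rightarrow> bool" where
  "smooth_on S h \<longleftrightarrow> (\<forall>k. Ck_on k S h)"

section \<open>Lorentz-Minkowski 3-space\<close>

definition lprod :: "real^3 \<Rightarrow> real^3 \<Rightarrow> real" where
  "lprod x y = x$1 * y$1 + x$2 * y$2 - x$3 * y$3"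

definition lnorm :: "real^3 \<Rightarrow> real" where
  "lnorm x = sqrt \<bar>lprod x x\<bar>"

definition spacelike :: "real^3 \<Rightarrow> bool" where
  "spacelike x \<longleftrightarrow> x \<noteq> 0 \<and> lprod x x > 0"

definition lightlike :: "real^3 \<Rightarrow> bool" where
  "lightlike x \<longleftrightarrow> x \<noteq> 0 \<and> lprod x x = 0"

section \<open>Real analytic surfaces\<close>

text \<open>
  A chart is given by the inverse of a coordinate map: a pair \<open>(D, \<psi>)\<close> of an open set
  \<open>D\<close> of the coordinate plane and a homeomorphism \<open>\<psi>\<close> of \<open>D\<close> onto an open subset of the
  surface. In this chart a map \<open>f\<close> on the surface is represented by \<open>f \<circ> \<psi>\<close> on \<open>D\<close>.
  All local notions below are first defined for such a representative
  \<open>h :: real^2 \<Rightarrow> real^3\<close> on \<open>D\<close>.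
\<close>

type_synonym 'a chart = "(real^2) set \<times> (real^2 \<Rightarrow> 'a)"

definition analytic_2_manifold :: "'a topology \<Rightarrow> 'a chart set \<Rightarrow> bool" where
  "analytic_2_manifold X A \<longleftrightarrow>
     Hausdorff_space X \<and> second_countable X \<and>
     topspace X = (\<Union>(D, \<psi>)\<in>A. \<psi> ` D) \<and>
     (\<forall>(D, \<psi>)\<in>A. open D \<and> openin X (\<psi> ` D) \<and>
        homeomorphic_map (top_of_set D) (subtopology X (\<psi> ` D)) \<psi>) \<and>
     (\<forall>(D1, \<psi>1)\<in>A. \<forall>(D2, \<psi>2)\<in>A.
        real_analytic_on (D1 \<inter> \<psi>1 -` (\<psi>2 ` D2)) (inv_into D2 \<psi>2 \<circ> \<psi>1))"

definition restrict_atlas :: "'a set \<Rightarrow> 'a chart set \<Rightarrow> 'a chart set" where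
  "restrict_atlas U A = (\<lambda>(D, \<psi>). (D \<inter> \<psi> -` U, \<psi>)) ` A"

definition real_analytic_surface ::
    "'a topology \<Rightarrow> 'a chart set \<Rightarrow> ('a \<Rightarrow> real^3) \<Rightarrow> bool" where
  "real_analytic_surface X A f \<longleftrightarrow>
     analytic_2_manifold X A \<and> connected_space X \<and>
     embedding_map X euclidean f \<and>
     (\<forall>(D, \<psi>)\<in>A. real_analytic_on D (f \<circ> \<psi>) \<and>
        (\<forall>x\<in>D. inj (frechet_derivative (f \<circ> \<psi>) (at x))))"

section \<open>First fundamental form and causal type of points\<close>

definition ds2 :: "(real^2 \<Rightarrow> real^3) \<Rightarrow> real^2 \<Rightarrow> real^2 \<Rightarrow> real^2 \<Rightarrow> real" where
  "ds2 h x v w = lprod (frechet_derivative h (at x) v) (frechet_derivative h (at x) w)"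

definition same_first_fundamental_form ::
    "'a chart set \<Rightarrow> ('a \<Rightarrow> real^3) \<Rightarrow> ('a \<Rightarrow> real^3) \<Rightarrow> bool" where
  "same_first_fundamental_form A f g \<longleftrightarrow>
     (\<forall>(D, \<psi>)\<in>A. \<forall>x\<in>D. \<forall>v w. ds2 (f \<circ> \<psi>) x v w = ds2 (g \<circ> \<psi>) x v w)"

definition positive_definite_form :: "(real^2 \<Rightarrow> real^2 \<Rightarrow> real) \<Rightarrow> bool" where
  "positive_definite_form B \<longleftrightarrow> (\<forall>v. v \<noteq> 0 \<longrightarrow> B v v > 0)"

definition degenerate_form :: "(real^2 \<Rightarrow> real^2 \<Rightarrow> real) \<Rightarrow> bool" where
  "degenerate_form B \<longleftrightarrow> (\<exists>w. w \<noteq> 0 \<and> (\<forall>v. B w v = 0))"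

definition indefinite_form :: "(real^2 \<Rightarrow> real^2 \<Rightarrow> real) \<Rightarrow> bool" where
  "indefinite_form B \<longleftrightarrow> \<not> degenerate_form B \<and> (\<exists>v. B v v > 0) \<and> (\<exists>v. B v v < 0)"

text \<open>\<open>at_chart A p Q\<close>: the local property \<open>Q\<close> holds at \<open>p\<close> in some chart around \<open>p\<close>.\<close>

definition at_chart ::
    "'a chart set \<Rightarrow> 'a \<Rightarrow> ((real^2) set \<Rightarrow> (real^2 \<Rightarrow> 'a) \<Rightarrow> real^2 \<Rightarrow> bool) \<Rightarrow> bool" where
  "at_chart A p Q \<longleftrightarrow> (\<exists>(D, \<psi>)\<in>A. \<exists>x\<in>D. \<psi> x = p \<and> Q D \<psi> x)"

definition spacelike_point :: "'a chart set \<Rightarrow> ('a \<Rightarrow> real^3) \<Rightarrow> 'a \<Rightarrow> bool" where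
  "spacelike_point A f p \<longleftrightarrow>
     at_chart A p (\<lambda>D \<psi> x. positive_definite_form (ds2 (f \<circ> \<psi>) x))"

definition timelike_point :: "'a chart set \<Rightarrow> ('a \<Rightarrow> real^3) \<Rightarrow> 'a \<Rightarrow> bool" where
  "timelike_point A f p \<longleftrightarrow>
     at_chart A p (\<lambda>D \<psi> x. indefinite_form (ds2 (f \<circ> \<psi>) x))"

definition lightlike_point :: "'a chart set \<Rightarrow> ('a \<Rightarrow> real^3) \<Rightarrow> 'a \<Rightarrow> bool" where
  "lightlike_point A f p \<longleftrightarrow>
     at_chart A p (\<lambda>D \<psi> x. degenerate_form (ds2 (f \<circ> \<psi>) x))"

definition mixed_type :: "'a chart set \<Rightarrow> ('a \<Rightarrow> real^3) \<Rightarrow> bool" where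
  "mixed_type A f \<longleftrightarrow>
     (\<exists>p. spacelike_point A f p) \<and> (\<exists>p. timelike_point A f p) \<and> (\<exists>p. lightlike_point A f p)"

section \<open>Lightlike points of the first and second kind\<close>

definition metric :: "(real^2 \<Rightarrow> real^3) \<Rightarrow> real^2 \<Rightarrow> real^2^2" where
  "metric h x = (\<chi> i j. ds2 h x (axis i 1) (axis j 1))"

text \<open>\<open>E G - F\<^sup>2\<close> with \<open>E\<close>, \<open>F\<close>, \<open>G\<close> the entries of the metric.\<close>

definition lam :: "(real^2 \<Rightarrow> real^3) \<Rightarrow> real^2 \<Rightarrow> real" where
  "lam h x = metric h x $ 1 $ 1 * metric h x $ 2 $ 2 - (metric h x $ 1 $ 2)\<^sup>2"

definition LD :: "(real^2 \<Rightarrow> real^3) \<Rightarrow> (real^2) set \<Rightarrow> (real^2) set" where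
  "LD h D = {x\<in>D. degenerate_form (ds2 h x)}"

definition nondegenerate_lightlike_point :: "'a chart set \<Rightarrow> ('a \<Rightarrow> real^3) \<Rightarrow> 'a \<Rightarrow> bool" where
  "nondegenerate_lightlike_point A f p \<longleftrightarrow>
     at_chart A p (\<lambda>D \<psi> x. x \<in> LD (f \<circ> \<psi>) D \<and>
       frechet_derivative (lam (f \<circ> \<psi>)) (at x) \<noteq> (\<lambda>v. 0))"

abbreviation velocity :: "(real \<Rightarrow> 'b::real_normed_vector) \<Rightarrow> real \<Rightarrow> 'b" where
  "velocity c t \<equiv> vector_derivative c (at t)"

definition regular_curve ::
    "(real^2) set \<Rightarrow> real^2 \<Rightarrow> real \<Rightarrow> (real \<Rightarrow> real^2) \<Rightarrow> bool" where
  "regular_curve D x \<delta> c \<longleftrightarrow>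
     \<delta> > 0 \<and> c 0 = x \<and> smooth_on {-\<delta><..<\<delta>} c \<and> c ` {-\<delta><..<\<delta>} \<subseteq> D \<and>
     (\<forall>t\<in>{-\<delta><..<\<delta>}. velocity c t \<noteq> 0)"

definition characteristic_curve ::
    "(real^2 \<Rightarrow> real^3) \<Rightarrow> (real^2) set \<Rightarrow> real^2 \<Rightarrow> real \<Rightarrow> (real \<Rightarrow> real^2) \<Rightarrow> bool" where
  "characteristic_curve h D x \<delta> c \<longleftrightarrow>
     regular_curve D x \<delta> c \<and> (\<exists>V. open V \<and> x \<in> V \<and> c ` {-\<delta><..<\<delta>} = LD h D \<inter> V)"

definition first_kind :: "'a chart set \<Rightarrow> ('a \<Rightarrow> real^3) \<Rightarrow> 'a \<Rightarrow> bool" where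
  "first_kind A f p \<longleftrightarrow>
     nondegenerate_lightlike_point A f p \<and>
     at_chart A p (\<lambda>D \<psi> x. \<exists>\<delta> c. characteristic_curve (f \<circ> \<psi>) D x \<delta> c \<and>
       spacelike (velocity (f \<circ> \<psi> \<circ> c) 0))"

definition second_kind :: "'a chart set \<Rightarrow> ('a \<Rightarrow> real^3) \<Rightarrow> 'a \<Rightarrow> bool" where
  "second_kind A f p \<longleftrightarrow>
     nondegenerate_lightlike_point A f p \<and>
     at_chart A p (\<lambda>D \<psi> x. \<exists>\<delta> c. characteristic_curve (f \<circ> \<psi>) D x \<delta> c \<and>
       lightlike (velocity (f \<circ> \<psi> \<circ> c) 0))"

section \<open>Lightlike singular curvature and lightlike normal curvature\<close>

definition null_vector :: "(real^2 \<Rightarrow> real^3) \<Rightarrow> real^2 \<Rightarrow> real^2 \<Rightarrow> bool" where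
  "null_vector h x w \<longleftrightarrow> w \<noteq> 0 \<and> (\<forall>v. ds2 h x w v = 0)"

definition null_vector_field ::
    "(real^2 \<Rightarrow> real^3) \<Rightarrow> (real^2) set \<Rightarrow> real^2 \<Rightarrow> (real^2 \<Rightarrow> real^2) \<Rightarrow> bool" where
  "null_vector_field h D x \<eta> \<longleftrightarrow>
     (\<exists>V. open V \<and> x \<in> V \<and> V \<subseteq> D \<and> smooth_on V \<eta> \<and>
        (\<forall>y \<in> LD h D \<inter> V. null_vector h y (\<eta> y)))"

definition unit_tangent ::
    "(real^2 \<Rightarrow> real^3) \<Rightarrow> (real \<Rightarrow> real^2) \<Rightarrow> real \<Rightarrow> real^3" where
  "unit_tangent h c t = velocity (h \<circ> c) t /\<^sub>R lnorm (velocity (h \<circ> c) t)"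

definition null_direction ::
    "(real^2 \<Rightarrow> real^3) \<Rightarrow> (real \<Rightarrow> real^2) \<Rightarrow> (real^2 \<Rightarrow> real^2) \<Rightarrow> real \<Rightarrow> real^3" where
  "null_direction h c \<eta> t = frechet_derivative h (at (c t)) (\<eta> (c t))"

definition transversal_null ::
    "(real^2 \<Rightarrow> real^3) \<Rightarrow> (real \<Rightarrow> real^2) \<Rightarrow> (real^2 \<Rightarrow> real^2) \<Rightarrow> real \<Rightarrow> real^3" where
  "transversal_null h c \<eta> t =
     (THE n. lightlike n \<and> lprod n n = 0 \<and> lprod n (unit_tangent h c t) = 0 \<and>
        lprod n (null_direction h c \<eta> t) = 1)"

definition beta ::
    "(real^2 \<Rightarrow> real^3) \<Rightarrow> (real \<Rightarrow> real^2) \<Rightarrow> (real^2 \<Rightarrow> real^2) \<Rightarrow> real \<Rightarrow> real" where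
  "beta h c \<eta> t =
     frechet_derivative (\<lambda>y. ds2 h y (\<eta> y) (\<eta> y)) (at (c t)) (\<eta> (c t))"

text \<open>\<open>beta\<close> may be negative; \<open>root 3\<close> is the odd real cube root.\<close>

definition kappa_L_formula ::
    "(real^2 \<Rightarrow> real^3) \<Rightarrow> (real \<Rightarrow> real^2) \<Rightarrow> (real^2 \<Rightarrow> real^2) \<Rightarrow> real" where
  "kappa_L_formula h c \<eta> =
     lprod (velocity (velocity (h \<circ> c)) 0) (null_direction h c \<eta> 0) /
       (root 3 (beta h c \<eta> 0) * (lnorm (velocity (h \<circ> c) 0))\<^sup>2)"

definition kappa_N_formula ::
    "(real^2 \<Rightarrow> real^3) \<Rightarrow> (real \<Rightarrow> real^2) \<Rightarrow> (real^2 \<Rightarrow> real^2) \<Rightarrow> real" where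
  "kappa_N_formula h c \<eta> =
     root 3 (beta h c \<eta> 0) * lprod (velocity (velocity (h \<circ> c)) 0) (transversal_null h c \<eta> 0) /
       (lnorm (velocity (h \<circ> c) 0))\<^sup>2"

text \<open>
  The common value of the formulas over all charts, characteristic curves and null vector
  fields. Meaningful only at lightlike points of the first kind.
\<close>

definition kappa_L :: "'a chart set \<Rightarrow> ('a \<Rightarrow> real^3) \<Rightarrow> 'a \<Rightarrow> real" where
  "kappa_L A f p = (THE k. at_chart A p (\<lambda>D \<psi> x. \<exists>\<delta> c \<eta>.
     characteristic_curve (f \<circ> \<psi>) D x \<delta> c \<and> null_vector_field (f \<circ> \<psi>) D x \<eta> \<and>
     k = kappa_L_formula (f \<circ> \<psi>) c \<eta>))"

definition kappa_N :: "'a chart set \<Rightarrow> ('a \<Rightarrow> real^3) \<Rightarrow> 'a \<Rightarrow> real" where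
  "kappa_N A f p = (THE k. at_chart A p (\<lambda>D \<psi> x. \<exists>\<delta> c \<eta>.
     characteristic_curve (f \<circ> \<psi>) D x \<delta> c \<and> null_vector_field (f \<circ> \<psi>) D x \<eta> \<and>
     k = kappa_N_formula (f \<circ> \<psi>) c \<eta>))"

section \<open>Geodesic curvature and genericity\<close>

text \<open>Christoffel symbols of the Levi-Civita connection; meaningful off \<open>LD\<close>.\<close>

definition partial :: "2 \<Rightarrow> (real^2 \<Rightarrow> real) \<Rightarrow> real^2 \<Rightarrow> real" where
  "partial i \<phi> x = frechet_derivative \<phi> (at x) (axis i 1)"

definition christoffel :: "(real^2 \<Rightarrow> real^3) \<Rightarrow> real^2 \<Rightarrow> 2 \<Rightarrow> 2 \<Rightarrow> 2 \<Rightarrow> real" where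
  "christoffel h x k i j =
     (\<Sum>l\<in>UNIV. matrix_inv (metric h x) $ k $ l *
        (partial i (\<lambda>y. metric h y $ j $ l) x + partial j (\<lambda>y. metric h y $ i $ l) x
         - partial l (\<lambda>y. metric h y $ i $ j) x)) / 2"

definition covariant_acceleration ::
    "(real^2 \<Rightarrow> real^3) \<Rightarrow> (real \<Rightarrow> real^2) \<Rightarrow> real \<Rightarrow> real^2" where
  "covariant_acceleration h c t =
     (\<chi> k. velocity (velocity c) t $ k +
        (\<Sum>i\<in>UNIV. \<Sum>j\<in>UNIV. christoffel h (c t) k i j * velocity c t $ i * velocity c t $ j))"

definition geodesic_curvature ::
    "(real^2 \<Rightarrow> real^3) \<Rightarrow> (real \<Rightarrow> real^2) \<Rightarrow> (real \<Rightarrow> real^2) \<Rightarrow> real \<Rightarrow> real" where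
  "geodesic_curvature h c n t =
     ds2 h (c t) (covariant_acceleration h c t) (n t) /
       ds2 h (c t) (velocity c t) (velocity c t)"

definition unit_normal ::
    "(real^2 \<Rightarrow> real^3) \<Rightarrow> (real \<Rightarrow> real^2) \<Rightarrow> real set \<Rightarrow> (real \<Rightarrow> real^2) \<Rightarrow> bool" where
  "unit_normal h c T n \<longleftrightarrow>
     smooth_on T n \<and>
     (\<forall>t\<in>T. ds2 h (c t) (n t) (velocity c t) = 0 \<and> ds2 h (c t) (n t) (n t) \<in> {1, -1})"

text \<open>
  The domain of the curve is taken so small that it meets \<open>LD\<close> only at \<open>t = 0\<close> and is
  spacelike elsewhere.
\<close>

definition has_unbounded_geodesic_curvature ::
    "(real^2 \<Rightarrow> real^3) \<Rightarrow> (real^2) set \<Rightarrow> real^2 \<Rightarrow> bool" where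
  "has_unbounded_geodesic_curvature h D x \<longleftrightarrow>
     (\<exists>\<delta> c n. regular_curve D x \<delta> c \<and> \<not> null_vector h x (velocity c 0) \<and>
        (\<forall>t\<in>{-\<delta><..<\<delta>} - {0}. c t \<notin> LD h D \<and> ds2 h (c t) (velocity c t) (velocity c t) > 0) \<and>
        unit_normal h c ({-\<delta><..<\<delta>} - {0}) n \<and>
        \<not> (\<exists>B. \<exists>\<epsilon>>0. \<forall>t. 0 < \<bar>t\<bar> \<and> \<bar>t\<bar> < \<epsilon> \<longrightarrow> \<bar>geodesic_curvature h c n t\<bar> \<le> B))"

definition generic_point :: "'a chart set \<Rightarrow> ('a \<Rightarrow> real^3) \<Rightarrow> 'a \<Rightarrow> bool" where
  "generic_point A f p \<longleftrightarrow>
     (first_kind A f p \<longrightarrow> kappa_L A f p \<noteq> 0) \<and>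
     (second_kind A f p \<longrightarrow>
        at_chart A p (\<lambda>D \<psi> x. has_unbounded_geodesic_curvature (f \<circ> \<psi>) D x))"

definition generic_surface :: "'a chart set \<Rightarrow> ('a \<Rightarrow> real^3) \<Rightarrow> bool" where
  "generic_surface A f \<longleftrightarrow>
     (\<forall>p. lightlike_point A f p \<longrightarrow> nondegenerate_lightlike_point A f p \<and> generic_point A f p)"

end

theory Submission
  imports Defs
begin

text \<open>
  At a lightlike point \<open>p\<close> of the first kind take linear coordinates \<open>(u, v)\<close> of a chart with \<open>u\<close> in the
  direction of the characteristic curve and \<open>v\<close> in the null direction. Write \<open>l = f\<^sub>v(p)\<close>, a lightlike
  vector, and \<open>e = \<langle>f\<^sub>u, f\<^sub>u\<rangle>(p) > 0\<close>. Genericity says that \<open>\<langle>f\<^sub>u\<^sub>u(p), l\<rangle> \<noteq> 0\<close>, so that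
  \<open>f\<^sub>u(p), l, f\<^sub>u\<^sub>u(p)\<close> is a basis of the ambient space. The isometric surface \<open>g\<close> is found by solving
  a Cauchy problem with initial curve \<open>v = 0\<close>.

  The coefficients of the first fundamental form of \<open>g\<close> are those of \<open>f\<close> as soon as \<open>\<langle>g\<^sub>v\<^sub>v, g\<^sub>u\<rangle>\<close>,
  \<open>\<langle>g\<^sub>v\<^sub>v, g\<^sub>v\<rangle>\<close> and \<open>\<langle>g\<^sub>v\<^sub>v, g\<^sub>u\<^sub>u\<rangle> - \<langle>g\<^sub>u\<^sub>v, g\<^sub>u\<^sub>v\<rangle>\<close> agree with the same expressions in \<open>f\<close>, and the four
  products \<open>\<langle>g\<^sub>u, g\<^sub>u\<rangle>\<close>, \<open>\<langle>g\<^sub>u, g\<^sub>v\<rangle>\<close>, \<open>\<langle>g\<^sub>v, g\<^sub>v\<rangle>\<close>, \<open>\<langle>g\<^sub>v, g\<^sub>u\<^sub>u\<rangle>\<close> agree on \<open>v = 0\<close>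
  (\<open>isometric_if_normal_equations\<close>). Because of the basis above, the three equations determine \<open>g\<^sub>v\<^sub>v\<close> from the
  other derivatives. On \<open>v = 0\<close> the curve \<open>g\<^sub>u\<close> may be any curve with the scalar squares of \<open>f\<^sub>u\<close>, and \<open>g\<^sub>v\<close> is
  then determined by its products with \<open>g\<^sub>u\<close>, \<open>g\<^sub>u\<^sub>u\<close> and itself. For \<open>g\<^sub>u\<close> one takes the image of \<open>f\<^sub>u\<close> under the
  null rotations of parameter \<open>u\<close> that fix \<open>l\<close> (\<open>null_rotation\<close>). They leave the first derivatives at
  \<open>p\<close> unchanged, but now \<open>g\<^sub>u\<^sub>u(p) = f\<^sub>u\<^sub>u(p) - e l\<close> (\<open>isometric_deformation_local\<close>). With the null normal
  \<open>N\<close>, for which \<open>\<langle>l, N\<rangle> = 1\<close>, this lowers \<open>\<langle>c'', N\<rangle> / e\<close> by one and hence \<open>\<kappa>\<^sub>N(p)\<close> by \<open>\<beta>\<^sup>1\<^sup>/\<^sup>3\<close>. The number \<open>\<beta>\<close>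
  depends on the metric only, and it is non-zero since the determinant of the metric has a zero
  of first order in the null direction (\<open>cubic_nonzero\<close>).

  The Cauchy problem is solved by a contraction in a Banach algebra of power series with the norm
  \<open>\<Sum>i j. \<bar>a\<^sub>i\<^sub>j\<bar> / (i + j choose i)\<close>. The norm is submultiplicative, and the operator \<open>\<partial>\<^sub>u \<integral> dv\<close>, which loses a
  derivative in one variable and gains one in the other, has norm at most one (\<open>wsum_du_iv\<close>). Passing from
  \<open>(u, v)\<close> to \<open>(s u, s\<^sup>2 v)\<close> multiplies this operator by \<open>s\<close>, so for small \<open>s\<close> the equation for \<open>g\<^sub>v\<^sub>v\<close> is a
  contraction (\<open>solve_in_frame\<close>, \<open>isometric_deformation_series\<close>).

  The curvatures are the common values of formulas in all charts, characteristic curves and null vector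
  fields. They depend only on the 2-jets of these data, and the 2-jets for two choices differ
  by a reparametrisation and a rescaling that cancel (\<open>jet_kappa_invariant\<close>, \<open>kappa_in_chart\<close>). Finally \<open>g\<close> is
  a homeomorphism of a small ball of the chart onto its image, so it defines a surface over the
  corresponding open part of the manifold (\<open>surface_replace\<close>).
\<close>

section \<open>Formal power series in two variables\<close>

text \<open>
  A series in \<open>u\<close> and \<open>v\<close> is a series in \<open>v\<close> whose coefficients are series in \<open>u\<close>: the indices \<open>i\<close>, \<open>j\<close>
  are the exponents of \<open>u\<close> and \<open>v\<close>.
\<close>

definition cf :: "real fps fps \<Rightarrow> nat \<Rightarrow> nat \<Rightarrow> real" where
  "cf a i j = fps_nth (fps_nth a j) i"

definition mk_ser :: "(nat \<Rightarrow> nat \<Rightarrow> real) \<Rightarrow> real fps fps" where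
  "mk_ser c = Abs_fps (\<lambda>j. Abs_fps (\<lambda>i. c i j))"

definition cst :: "real \<Rightarrow> real fps fps" where
  "cst c = fps_const (fps_const c)"

lemma ser_eqI: "(\<And>i j. cf a i j = cf b i j) \<Longrightarrow> a = b"
  by (intro fps_ext) (simp add: cf_def)

lemma cf_mk_ser [simp]: "cf (mk_ser c) i j = c i j"
  by (simp add: cf_def mk_ser_def)

lemma cf_simps [simp]:
  "cf 0 i j = 0" "cf (a + b) i j = cf a i j + cf b i j" "cf (a - b) i j = cf a i j - cf b i j"
  "cf (- a) i j = - cf a i j"
  by (simp_all add: cf_def)

lemma cf_one: "cf 1 i j = (if i = 0 \<and> j = 0 then 1 else 0)"
  by (auto simp: cf_def)

lemma cf_cst: "cf (cst c) i j = (if i = 0 \<and> j = 0 then c else 0)"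
  by (auto simp: cf_def cst_def)

lemma cf_cst_mult [simp]: "cf (cst c * a) i j = c * cf a i j"
  by (simp add: cf_def cst_def)

lemma cst_simps [simp]:
  "cst 0 = 0" "cst 1 = 1" "cst (a + b) = cst a + cst b" "cst (a - b) = cst a - cst b"
  "cst (a * b) = cst a * cst b" "cst (- a) = - cst a"
  by (simp_all add: cst_def flip: fps_const_add fps_const_sub fps_const_neg fps_const_mult)

lemma cf_mult:
  "cf (a * b) i j = (\<Sum>q\<in>{..i} \<times> {..j}. cf a (fst q) (snd q) * cf b (i - fst q) (j - snd q))"
proof -
  have "cf (a * b) i j = (\<Sum>k\<le>j. \<Sum>l\<le>i. cf a l k * cf b (i - l) (j - k))"
    by (simp add: cf_def fps_mult_nth fps_sum_nth atLeast0AtMost)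
  also have "\<dots> = (\<Sum>l\<le>i. \<Sum>k\<le>j. cf a l k * cf b (i - l) (j - k))"
    by (rule sum.swap)
  also have "\<dots> = (\<Sum>q\<in>{..i} \<times> {..j}. cf a (fst q) (snd q) * cf b (i - fst q) (j - snd q))"
    by (simp add: sum.cartesian_product split_def)
  finally show ?thesis .
qed

section \<open>Unconditional sums of Cauchy products\<close>

text \<open>
  Regrouping by the sum of the two multi-indices, that is, summation along the fibres of addition.
\<close>

lemma convolution_has_sum:
  fixes G :: "(nat \<times> nat) \<times> (nat \<times> nat) \<Rightarrow> real"
  assumes "(G has_sum S) UNIV"
  shows "((\<lambda>p. \<Sum>q\<in>{..fst p} \<times> {..snd p}. G (q, (fst p - fst q, snd p - snd q))) has_sum S) UNIV"
proof -
  let ?\<phi> = "\<lambda>z::(nat \<times> nat) \<times> (nat \<times> nat). (snd z, (fst (fst z) - fst (snd z), snd (fst z) - snd (snd z)))"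
  let ?\<theta> = "\<lambda>z::(nat \<times> nat) \<times> (nat \<times> nat). ((fst (fst z) + fst (snd z), snd (fst z) + snd (snd z)), fst z)"
  have "bij_betw ?\<phi> (Sigma UNIV (\<lambda>p. {..fst p} \<times> {..snd p})) UNIV"
    by (rule bij_betwI[where g = ?\<theta>]) auto
  then have "((\<lambda>z. G (?\<phi> z)) has_sum S) (Sigma UNIV (\<lambda>p. {..fst p} \<times> {..snd p}))"
    using assms by (subst has_sum_reindex_bij_betw)
  then show ?thesis
    by (rule has_sum_Sigma') (auto intro!: has_sum_finiteI)
qed

lemma has_sum_times:
  fixes f g :: "nat \<times> nat \<Rightarrow> real"
  assumes f: "(f has_sum s) UNIV" and g: "(g has_sum t) UNIV"
  shows "((\<lambda>z. f (fst z) * g (snd z)) has_sum s * t) UNIV"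
proof -
  have af: "(\<lambda>x. norm (f x)) summable_on UNIV" and ag: "(\<lambda>x. norm (g x)) summable_on UNIV"
    using f g summable_on_iff_abs_summable_on_real has_sum_imp_summable by blast+
  have "(\<lambda>z. \<bar>f (fst z)\<bar> * \<bar>g (snd z)\<bar>) summable_on Sigma UNIV (\<lambda>_. UNIV)"
  proof (rule summable_on_SigmaI)
    show "((\<lambda>y. \<bar>f (fst (x, y))\<bar> * \<bar>g (snd (x, y))\<bar>) has_sum \<bar>f x\<bar> * infsum (\<lambda>x. \<bar>g x\<bar>) UNIV) UNIV" for x
      using ag by (auto intro!: has_sum_cmult_right)
    show "(\<lambda>x. \<bar>f x\<bar> * infsum (\<lambda>x. \<bar>g x\<bar>) UNIV) summable_on UNIV"
      using af by (auto intro!: summable_on_cmult_left)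
  qed auto
  then have "(\<lambda>z. f (fst z) * g (snd z)) summable_on Sigma UNIV (\<lambda>_. UNIV)"
    by (subst summable_on_iff_abs_summable_on_real) (simp add: abs_mult)
  then have "((\<lambda>z. f (fst z) * g (snd z)) has_sum s * t) (Sigma UNIV (\<lambda>_. UNIV))"
    by (intro has_sum_SigmaI[where g = "\<lambda>x. f x * t"])
       (auto intro!: has_sum_cmult_right has_sum_cmult_left f g)
  then show ?thesis by simp
qed

section \<open>A Banach algebra of power series on which a loss of derivative is bounded\<close>

text \<open>
  The weights make the norm submultiplicative like the plain sum of moduli, while a derivative in one
  variable can be traded for an integration in the other at no cost: the factors satisfy
  \<open>(i + 1) wt i (j + 1) = (j + 1) wt (i + 1) j\<close>.
\<close>

definition wt :: "nat \<Rightarrow> nat \<Rightarrow> real" where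
  "wt i j = 1 / real ((i + j) choose i)"

lemma wt_pos: "wt i j > 0"
  by (simp add: wt_def)

lemma wt_nonneg [simp]: "wt i j \<ge> 0"
  using wt_pos[of i j] by simp

lemma wt_le_1: "wt i j \<le> 1"
proof -
  have "(i + j) choose i \<ge> 1" by (simp add: Suc_leI)
  then show ?thesis by (simp add: wt_def divide_simps)
qed

lemma wt_0_0 [simp]: "wt 0 0 = 1"
  by (simp add: wt_def)

text \<open>
  One term of Vandermonde's convolution.
\<close>

lemma choose_mult_le: "((i + j) choose i) * ((k + l) choose k) \<le> ((i + k) + (j + l)) choose (i + k)"
proof -
  have "((i + j) choose i) * ((k + l) choose k)
      \<le> (\<Sum>r\<le>i + k. ((i + j) choose r) * ((k + l) choose (i + k - r)))"
    by (rule order_trans[OF _ member_le_sum[of i]]) auto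
  also have "\<dots> = ((i + j) + (k + l)) choose (i + k)"
    by (rule vandermonde)
  finally show ?thesis by (simp add: algebra_simps)
qed

lemma wt_mult: "wt (i + k) (j + l) \<le> wt i j * wt k l"
proof -
  have "real (((i + j) choose i) * ((k + l) choose k)) \<le> real (((i + k) + (j + l)) choose (i + k))"
    using choose_mult_le of_nat_le_iff by blast
  then show ?thesis
    unfolding wt_def by (simp add: frac_le)
qed

definition wterm :: "real fps fps \<Rightarrow> nat \<times> nat \<Rightarrow> real" where
  "wterm a p = \<bar>cf a (fst p) (snd p)\<bar> * wt (fst p) (snd p)"

definition wsum :: "real fps fps \<Rightarrow> bool" where
  "wsum a \<longleftrightarrow> wterm a summable_on UNIV"

definition wnorm :: "real fps fps \<Rightarrow> real" where
  "wnorm a = infsum (wterm a) UNIV"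

lemma wterm_nonneg [simp]: "wterm a p \<ge> 0"
  by (simp add: wterm_def)

lemma wnorm_nonneg: "wnorm a \<ge> 0"
  unfolding wnorm_def by (rule infsum_nonneg) simp

lemma wsumI:
  assumes "\<And>F. finite F \<Longrightarrow> sum (wterm a) F \<le> C"
  shows "wsum a" "wnorm a \<le> C"
proof -
  show s: "wsum a" unfolding wsum_def
    by (rule nonneg_bdd_above_summable_on) (auto intro!: bdd_aboveI2 assms)
  show "wnorm a \<le> C" unfolding wnorm_def
    by (rule infsum_le_finite_sums) (use s assms in \<open>auto simp: wsum_def\<close>)
qed

text \<open>
  Domination by an arbitrary summable family, as it arises from regrouping.
\<close>

lemma wsum_compare:
  assumes "(g has_sum C) UNIV" "\<And>p. wterm a p \<le> g p"
  shows "wsum a" "wnorm a \<le> C"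
proof -
  have "sum (wterm a) F \<le> C" if "finite F" for F
  proof -
    have "sum (wterm a) F \<le> sum g F" by (intro sum_mono assms)
    also have "\<dots> \<le> C"
      by (rule finite_sum_le_has_sum[OF assms(1) that])
         (auto intro: order_trans[OF wterm_nonneg assms(2)])
    finally show ?thesis .
  qed
  then show "wsum a" "wnorm a \<le> C" by (auto intro: wsumI)
qed

lemma wnorm_has_sum: "wsum a \<Longrightarrow> (wterm a has_sum wnorm a) UNIV"
  by (simp add: wsum_def wnorm_def)

lemma wterm_le_wnorm: "wsum a \<Longrightarrow> wterm a p \<le> wnorm a"
  using finite_sum_le_has_sum[OF wnorm_has_sum, of a "{p}"] by simp

lemma wsum_finite:
  assumes "finite K" "\<And>i j. (i, j) \<notin> K \<Longrightarrow> cf a i j = 0"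
  shows "wsum a" "wnorm a = (\<Sum>p\<in>K. wterm a p)"
proof -
  have "(wterm a has_sum (\<Sum>p\<in>K. wterm a p)) UNIV"
    by (rule has_sum_finite_neutralI) (use assms in \<open>auto simp: wterm_def\<close>)
  then show "wsum a" "wnorm a = (\<Sum>p\<in>K. wterm a p)"
    by (auto simp: wsum_def wnorm_def has_sum_iff)
qed

lemma wsum_0 [simp]: "wsum 0" "wnorm 0 = 0"
  using wsum_finite[of "{}" 0] by simp_all

lemma wsum_1: "wsum 1" "wnorm 1 = 1"
  using wsum_finite[of "{(0,0)}" 1] by (auto simp: cf_one wterm_def)

lemma wsum_add:
  assumes "wsum a" "wsum b"
  shows "wsum (a + b)" "wnorm (a + b) \<le> wnorm a + wnorm b"
  by (rule wsum_compare[OF has_sum_add[OF wnorm_has_sum[OF assms(1)] wnorm_has_sum[OF assms(2)]]],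
      simp add: wterm_def abs_triangle_ineq mult_right_mono flip: distrib_right)+

lemma wsum_cst_mult:
  assumes "wsum a"
  shows "wsum (cst c * a)" "wnorm (cst c * a) = \<bar>c\<bar> * wnorm a"
proof -
  have "(wterm (cst c * a) has_sum \<bar>c\<bar> * wnorm a) UNIV"
    using has_sum_cmult_right[OF wnorm_has_sum[OF assms], of "\<bar>c\<bar>"]
    by (simp add: wterm_def[abs_def] abs_mult mult.assoc)
  then show "wsum (cst c * a)" "wnorm (cst c * a) = \<bar>c\<bar> * wnorm a"
    by (auto simp: wsum_def wnorm_def has_sum_iff)
qed

lemma wsum_uminus:
  assumes "wsum a" shows "wsum (- a)" "wnorm (- a) = wnorm a"
  using wsum_cst_mult[OF assms, of "-1"] by simp_all

lemma wsum_diff: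
  assumes "wsum a" "wsum b" shows "wsum (a - b)"
  using wsum_add(1)[OF assms(1) wsum_uminus(1)[OF assms(2)]] by simp

lemma wsum_mult:
  assumes "wsum a" "wsum b"
  shows "wsum (a * b)" "wnorm (a * b) \<le> wnorm a * wnorm b"
proof -
  let ?g = "\<lambda>p. \<Sum>q\<in>{..fst p} \<times> {..snd p}. wterm a q * wterm b (fst p - fst q, snd p - snd q)"
  have h: "(?g has_sum wnorm a * wnorm b) UNIV"
    using convolution_has_sum[OF has_sum_times[OF wnorm_has_sum[OF assms(1)] wnorm_has_sum[OF assms(2)]]]
    by simp
  have "wterm (a * b) p \<le> ?g p" for p
  proof -
    obtain i j where p: "p = (i, j)" by fastforce
    have "wterm (a * b) p \<le> (\<Sum>q\<in>{..i} \<times> {..j}. \<bar>cf a (fst q) (snd q) * cf b (i - fst q) (j - snd q)\<bar>) * wt i j"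
      by (simp add: wterm_def p cf_mult mult_right_mono)
    also have "\<dots> \<le> ?g p"
      unfolding sum_distrib_right p fst_conv snd_conv
    proof (rule sum_mono)
      fix q assume "q \<in> {..i} \<times> {..j}"
      then have "wt i j \<le> wt (fst q) (snd q) * wt (i - fst q) (j - snd q)"
        using wt_mult[of "fst q" "i - fst q" "snd q" "j - snd q"] by auto
      then have "\<bar>cf a (fst q) (snd q) * cf b (i - fst q) (j - snd q)\<bar> * wt i j
         \<le> \<bar>cf a (fst q) (snd q) * cf b (i - fst q) (j - snd q)\<bar> * (wt (fst q) (snd q) * wt (i - fst q) (j - snd q))"
        by (intro mult_left_mono) auto
      then show "\<bar>cf a (fst q) (snd q) * cf b (i - fst q) (j - snd q)\<bar> * wt i j \<le> wterm a q * wterm b (i - fst q, j - snd q)"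
        by (simp add: wterm_def abs_mult mult.assoc mult.left_commute)
    qed
    finally show ?thesis .
  qed
  then show "wsum (a * b)" "wnorm (a * b) \<le> wnorm a * wnorm b"
    using wsum_compare[OF h] by auto
qed

text \<open>
  The algebra of all series of finite weighted norm, as a type, so that the contraction principle and
  absolutely convergent sums in Banach spaces apply to it.
\<close>

typedef wser = "{a. wsum a}"
  morphisms ser Abs_wser
  by (rule exI[of _ 0]) simp

setup_lifting type_definition_wser

lemma wsum_ser [simp]: "wsum (ser a)"
  using ser by simp

instantiation wser :: comm_ring_1
begin
lift_definition zero_wser :: wser is 0 by simp
lift_definition one_wser :: wser is 1 by (rule wsum_1)
lift_definition plus_wser :: "wser \<Rightarrow> wser \<Rightarrow> wser" is "(+)" by (rule wsum_add)
lift_definition minus_wser :: "wser \<Rightarrow> wser \<Rightarrow> wser" is "(-)" by (rule wsum_diff)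
lift_definition uminus_wser :: "wser \<Rightarrow> wser" is uminus by (rule wsum_uminus)
lift_definition times_wser :: "wser \<Rightarrow> wser \<Rightarrow> wser" is "(*)" by (rule wsum_mult)
instance by standard (transfer; simp add: algebra_simps)+
end

instantiation wser :: real_algebra_1
begin
lift_definition scaleR_wser :: "real \<Rightarrow> wser \<Rightarrow> wser" is "\<lambda>c a. cst c * a" by (rule wsum_cst_mult)
instance by standard (transfer; simp add: algebra_simps)+
end

instantiation wser :: real_normed_algebra_1
begin
lift_definition norm_wser :: "wser \<Rightarrow> real" is wnorm .
definition dist_wser :: "wser \<Rightarrow> wser \<Rightarrow> real" where "dist_wser a b = norm (a - b)"
definition sgn_wser :: "wser \<Rightarrow> wser" where "sgn_wser a = scaleR (inverse (norm a)) a"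
definition uniformity_wser :: "(wser \<times> wser) filter"
  where "uniformity_wser = (INF e\<in>{0 <..}. principal {(x, y). dist x y < e})"
definition open_wser :: "wser set \<Rightarrow> bool"
  where "open_wser S = (\<forall>x\<in>S. \<forall>\<^sub>F (x', y) in uniformity. x' = x \<longrightarrow> y \<in> S)"
instance
proof
  fix a b :: wser and r :: real
  show "dist a b = norm (a - b)" by (rule dist_wser_def)
  show "sgn a = a /\<^sub>R norm a" by (rule sgn_wser_def)
  show "uniformity = (INF e\<in>{0 <..}. principal {(x, y :: wser). dist x y < e})"
    by (rule uniformity_wser_def)
  show "open S \<longleftrightarrow> (\<forall>x\<in>S. \<forall>\<^sub>F (x', y) in uniformity. x' = x \<longrightarrow> y \<in> S)" for S :: "wser set"
    by (rule open_wser_def)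
  show "norm (r *\<^sub>R a) = \<bar>r\<bar> * norm a" by transfer (rule wsum_cst_mult)
  show "norm (a + b) \<le> norm a + norm b" by transfer (rule wsum_add)
  show "norm (a * b) \<le> norm a * norm b" by transfer (rule wsum_mult)
  show "norm (1 :: wser) = 1" by transfer (rule wsum_1)
  show "norm a = 0 \<longleftrightarrow> a = 0"
  proof transfer
    fix a assume a: "wsum a"
    show "wnorm a = 0 \<longleftrightarrow> a = 0"
    proof
      assume "wnorm a = 0"
      then have le: "wterm a (i, j) \<le> 0" for i j
        using wterm_le_wnorm[OF a, of "(i,j)"] by simp
      have "cf a i j = 0" for i j
        using le[of i j] wt_pos[of i j] by (simp add: wterm_def mult_le_0_iff not_le)
      then show "a = 0" by (intro ser_eqI) simp
    qed simp
  qed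
qed
end

definition wcf :: "nat \<Rightarrow> nat \<Rightarrow> wser \<Rightarrow> real" where
  "wcf i j b = cf (ser b) i j"

lemma norm_wser_has_sum: "((\<lambda>p. \<bar>wcf (fst p) (snd p) b\<bar> * wt (fst p) (snd p)) has_sum norm b) UNIV"
proof -
  have "(wterm (ser b) has_sum norm b) UNIV"
    unfolding norm_wser.rep_eq by (rule wnorm_has_sum) simp
  then show ?thesis by (simp add: wterm_def[abs_def] wcf_def)
qed

lemma wcf_bound: "\<bar>wcf i j b\<bar> * wt i j \<le> norm b"
  using finite_sum_le_has_sum[OF norm_wser_has_sum, of "{(i,j)}" b] by simp

lemma wcf_linear:
  "wcf i j (a + b) = wcf i j a + wcf i j b" "wcf i j (a - b) = wcf i j a - wcf i j b"
  "wcf i j (c *\<^sub>R a) = c * wcf i j a" "wcf i j 0 = 0" "wcf i j (- a) = - wcf i j a"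
  by (simp_all add: wcf_def plus_wser.rep_eq minus_wser.rep_eq scaleR_wser.rep_eq zero_wser.rep_eq uminus_wser.rep_eq)

lemma bounded_linear_wcf: "bounded_linear (wcf i j)"
proof (rule bounded_linear_intro[where K = "1 / wt i j"])
  show "norm (wcf i j x) \<le> norm x * (1 / wt i j)" for x
    using wcf_bound[of i j x] wt_pos[of i j] by (simp add: field_simps)
qed (simp_all add: wcf_linear)

text \<open>
  Coefficients are continuous, so a Cauchy sequence converges coefficientwise. The estimate of the
  distance to the limit passes to the limit on every finite set of indices.
\<close>

instance wser :: banach
proof
  fix X :: "nat \<Rightarrow> wser"
  assume X: "Cauchy X"
  have "convergent (\<lambda>n. wcf i j (X n))" for i j
    by (intro Cauchy_convergent bounded_linear.Cauchy[OF bounded_linear_wcf X])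
  then obtain c where c: "\<And>i j. (\<lambda>n. wcf i j (X n)) \<longlonglongrightarrow> c i j"
    unfolding convergent_def by metis
  have fin: "sum (wterm (mk_ser c - ser (X n))) F \<le> e"
    if "e > 0" "finite F" and N: "\<And>m. m \<ge> N \<Longrightarrow> norm (X m - X n) < e" for e n F N
  proof -
    have "(\<lambda>m. \<Sum>p\<in>F. \<bar>wcf (fst p) (snd p) (X m) - wcf (fst p) (snd p) (X n)\<bar> * wt (fst p) (snd p))
        \<longlonglongrightarrow> (\<Sum>p\<in>F. \<bar>c (fst p) (snd p) - wcf (fst p) (snd p) (X n)\<bar> * wt (fst p) (snd p))"
      by (intro tendsto_intros c)
    moreover have "(\<Sum>p\<in>F. \<bar>wcf (fst p) (snd p) (X m) - wcf (fst p) (snd p) (X n)\<bar> * wt (fst p) (snd p)) \<le> e"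
      if "m \<ge> N" for m
      using finite_sum_le_has_sum[OF norm_wser_has_sum, of F "X m - X n"] \<open>finite F\<close> N[OF that]
      by (simp add: wcf_linear)
    ultimately have "(\<Sum>p\<in>F. \<bar>c (fst p) (snd p) - wcf (fst p) (snd p) (X n)\<bar> * wt (fst p) (snd p)) \<le> e"
      by (intro LIMSEQ_le_const2) auto
    then show ?thesis by (simp add: wterm_def wcf_def)
  qed
  have cauchy: "\<exists>N. \<forall>m\<ge>N. \<forall>n\<ge>N. norm (X m - X n) < e" if "e > 0" for e
    using X that by (simp add: Cauchy_iff)
  \<comment> \<open>the limit has finite norm, since it differs from some \<open>X N\<close> by a series of norm at most 1\<close>
  obtain N where N: "\<And>m. m \<ge> N \<Longrightarrow> norm (X m - X N) < 1"
    using cauchy[of 1] by fastforce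
  have "wsum (mk_ser c - ser (X N))"
    by (rule wsumI(1)[of _ 1]) (rule fin, use N in auto)
  from wsum_add(1)[OF this, of "ser (X N)"] have wc: "wsum (mk_ser c)" by simp
  define L where "L = Abs_wser (mk_ser c)"
  have serL: "ser L = mk_ser c" using wc by (simp add: L_def Abs_wser_inverse)
  have "X \<longlonglongrightarrow> L"
  proof (rule LIMSEQ_I)
    fix r :: real assume "r > 0"
    then obtain N where N: "\<And>m n. m \<ge> N \<Longrightarrow> n \<ge> N \<Longrightarrow> norm (X m - X n) < r / 2"
      using cauchy[of "r/2"] by auto
    have "norm (X n - L) < r" if "n \<ge> N" for n
    proof -
      have "wnorm (mk_ser c - ser (X n)) \<le> r / 2"
        by (rule wsumI(2)) (rule fin[where N = N], use N \<open>r > 0\<close> that in auto)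
      then have "norm (L - X n) \<le> r / 2"
        by (simp add: norm_wser.rep_eq minus_wser.rep_eq serL)
      then show ?thesis using \<open>r > 0\<close> by (simp add: norm_minus_commute)
    qed
    then show "\<exists>no. \<forall>n\<ge>no. norm (X n - L) < r" by blast
  qed
  then show "convergent X" by (auto simp: convergent_def)
qed

section \<open>Evaluation of power series\<close>

abbreviation mnm :: "real^2 \<Rightarrow> nat \<times> nat \<Rightarrow> real" where
  "mnm x p \<equiv> x$1 ^ fst p * x$2 ^ snd p"

text \<open>
  One term of the binomial expansion of \<open>\<bar>s\<bar> + \<bar>t\<bar>\<close> to the power \<open>i + j\<close>.
\<close>

lemma abs_power_le_wt:
  fixes s t :: real
  assumes "\<bar>s\<bar> + \<bar>t\<bar> \<le> 1"
  shows "\<bar>s ^ i * t ^ j\<bar> \<le> wt i j"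
proof -
  have "of_nat ((i + j) choose i) * \<bar>s\<bar> ^ i * \<bar>t\<bar> ^ (i + j - i) \<le> (\<bar>s\<bar> + \<bar>t\<bar>) ^ (i + j)"
    unfolding binomial_ring[of "\<bar>s\<bar>" "\<bar>t\<bar>" "i + j"] by (rule member_le_sum) auto
  also have "\<dots> \<le> 1" using assms by (intro power_le_one) auto
  finally have "real ((i + j) choose i) * \<bar>s ^ i * t ^ j\<bar> \<le> 1"
    by (simp add: abs_mult power_abs mult.assoc)
  then show ?thesis
    unfolding wt_def by (subst le_divide_eq) (auto simp: mult.commute)
qed

text \<open>
  All monomials are bounded by the weights exactly on this set, so it is the natural domain of the
  functions that series of finite norm define.
\<close>

definition unit_diamond :: "(real^2) set" where
  "unit_diamond = {x. \<bar>x$1\<bar> + \<bar>x$2\<bar> \<le> 1}"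

lemma abs_mono_le_wt: "x \<in> unit_diamond \<Longrightarrow> \<bar>mnm x p\<bar> \<le> wt (fst p) (snd p)"
  by (intro abs_power_le_wt) (simp add: unit_diamond_def)

definition ev :: "wser \<Rightarrow> real^2 \<Rightarrow> real" where
  "ev b x = infsum (\<lambda>p. wcf (fst p) (snd p) b * mnm x p) UNIV"

lemma ev_abs_summable:
  assumes "x \<in> unit_diamond"
  shows "(\<lambda>p. norm (wcf (fst p) (snd p) b * mnm x p)) summable_on UNIV"
proof (rule Infinite_Sum.abs_summable_on_comparison_test')
  show "(\<lambda>p. \<bar>wcf (fst p) (snd p) b\<bar> * wt (fst p) (snd p)) summable_on UNIV"
    using norm_wser_has_sum has_sum_imp_summable by blast
  show "norm (wcf (fst p) (snd p) b * mnm x p) \<le> \<bar>wcf (fst p) (snd p) b\<bar> * wt (fst p) (snd p)" for p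
    using abs_mono_le_wt[OF assms, of p] by (auto simp: abs_mult intro!: mult_left_mono)
qed

lemma ev_has_sum:
  assumes "x \<in> unit_diamond"
  shows "((\<lambda>p. wcf (fst p) (snd p) b * mnm x p) has_sum ev b x) UNIV"
  using abs_summable_summable[OF ev_abs_summable[OF assms, of b]] by (simp add: ev_def)

lemma ev_eqI: "((\<lambda>p. wcf (fst p) (snd p) b * mnm x p) has_sum S) UNIV \<Longrightarrow> ev b x = S"
  unfolding ev_def by (rule infsumI)

lemma abs_ev_le:
  assumes "x \<in> unit_diamond"
  shows "\<bar>ev b x\<bar> \<le> norm b"
proof -
  have "\<bar>ev b x\<bar> \<le> infsum (\<lambda>p. norm (wcf (fst p) (snd p) b * mnm x p)) UNIV"
    unfolding ev_def real_norm_def[symmetric] by (rule norm_infsum_bound) (rule ev_abs_summable[OF assms])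
  also have "\<dots> \<le> norm b"
  proof (rule has_sum_mono[OF has_sum_infsum[OF ev_abs_summable[OF assms]] norm_wser_has_sum])
    show "norm (wcf (fst p) (snd p) b * mnm x p) \<le> \<bar>wcf (fst p) (snd p) b\<bar> * wt (fst p) (snd p)" for p
      using abs_mono_le_wt[OF assms, of p] by (auto simp: abs_mult intro!: mult_left_mono)
  qed
  finally show ?thesis .
qed

lemma bounded_linear_ev:
  assumes "x \<in> unit_diamond"
  shows "bounded_linear (\<lambda>b. ev b x)"
proof (rule bounded_linear_intro[where K = 1])
  fix a b :: wser and r :: real
  have "((\<lambda>p. wcf (fst p) (snd p) (a + b) * mnm x p) has_sum ev a x + ev b x) UNIV"
    using has_sum_add[OF ev_has_sum[OF assms, of a] ev_has_sum[OF assms, of b]]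
    by (simp add: wcf_linear algebra_simps)
  then show "ev (a + b) x = ev a x + ev b x" by (rule ev_eqI)
  have "((\<lambda>p. wcf (fst p) (snd p) (r *\<^sub>R a) * mnm x p) has_sum r * ev a x) UNIV"
    using has_sum_cmult_right[OF ev_has_sum[OF assms, of a], of r]
    by (simp add: wcf_linear algebra_simps)
  then show "ev (r *\<^sub>R a) x = r *\<^sub>R ev a x" unfolding real_scaleR_def by (rule ev_eqI)
  show "norm (ev a x) \<le> norm a * 1" using abs_ev_le[OF assms, of a] by simp
qed

lemma mono_mult: "fst q \<le> fst p \<Longrightarrow> snd q \<le> snd p \<Longrightarrow>
    mnm x q * mnm x (fst p - fst q, snd p - snd q) = mnm x p"
  using power_add[of "x$1" "fst q" "fst p - fst q"] power_add[of "x$2" "snd q" "snd p - snd q"]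
  by simp

text \<open>
  For real families the existence of an unordered sum is absolute convergence, so the product of two
  sums may be regrouped by degree.
\<close>

lemma has_sum_ser_mult:
  assumes "((\<lambda>p. cf a (fst p) (snd p) * mnm x p) has_sum s) UNIV"
    and "((\<lambda>p. cf b (fst p) (snd p) * mnm x p) has_sum t) UNIV"
  shows "((\<lambda>p. cf (a * b) (fst p) (snd p) * mnm x p) has_sum s * t) UNIV"
proof -
  have "((\<lambda>p. \<Sum>q\<in>{..fst p} \<times> {..snd p}. cf a (fst q) (snd q) * mnm x q *
          (cf b (fst p - fst q) (snd p - snd q) * mnm x (fst p - fst q, snd p - snd q))) has_sum s * t) UNIV"
    using convolution_has_sum[OF has_sum_times[OF assms]] by simp
  moreover have "(\<Sum>q\<in>{..fst p} \<times> {..snd p}. cf a (fst q) (snd q) * mnm x q *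
          (cf b (fst p - fst q) (snd p - snd q) * mnm x (fst p - fst q, snd p - snd q)))
      = cf (a * b) (fst p) (snd p) * mnm x p" for p
    unfolding cf_mult sum_distrib_right
  proof (rule sum.cong[OF refl])
    fix q assume "q \<in> {..fst p} \<times> {..snd p}"
    then have m: "mnm x p = mnm x q * mnm x (fst p - fst q, snd p - snd q)"
      using mono_mult[of q p x] by auto
    show "cf a (fst q) (snd q) * mnm x q *
        (cf b (fst p - fst q) (snd p - snd q) * mnm x (fst p - fst q, snd p - snd q))
      = cf a (fst q) (snd q) * cf b (fst p - fst q) (snd p - snd q) * mnm x p"
      unfolding m by (simp only: ac_simps)
  qed
  ultimately show ?thesis by simp
qed

lemma ev_mult:
  assumes "x \<in> unit_diamond"
  shows "ev (a * b) x = ev a x * ev b x"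
proof -
  have "((\<lambda>p. wcf (fst p) (snd p) (a * b) * mnm x p) has_sum ev a x * ev b x) UNIV"
    using has_sum_ser_mult[of "ser a" x "ev a x" "ser b" "ev b x"] ev_has_sum[OF assms]
    by (simp add: wcf_def times_wser.rep_eq)
  then show ?thesis by (rule ev_eqI)
qed

lemma wcf_one: "wcf i j 1 = (if i = 0 \<and> j = 0 then 1 else 0)"
  by (simp add: wcf_def one_wser.rep_eq cf_one)

lemma ev_one: "ev 1 x = 1"
proof -
  have "((\<lambda>p. wcf (fst p) (snd p) 1 * mnm x p) has_sum 1) UNIV"
    by (rule has_sum_finite_neutralI[of "{(0,0)}"]) (auto simp: wcf_one)
  then show ?thesis by (simp add: ev_def has_sum_iff)
qed

lemma ev_of_real: "x \<in> unit_diamond \<Longrightarrow> ev (of_real c) x = c"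
  by (simp add: of_real_def linear_cmul[OF bounded_linear.linear[OF bounded_linear_ev]] ev_one)

lemma ev_power: "x \<in> unit_diamond \<Longrightarrow> ev (a ^ n) x = ev a x ^ n"
  by (induction n) (simp_all add: ev_one ev_mult)

definition monom_ser :: "nat \<Rightarrow> nat \<Rightarrow> real fps fps" where
  "monom_ser k l = mk_ser (\<lambda>i j. if i = k \<and> j = l then 1 else 0)"

lemma wsum_monom_ser: "wsum (monom_ser k l)" "wnorm (monom_ser k l) \<le> 1"
  using wsum_finite[of "{(k,l)}" "monom_ser k l"] wt_le_1[of k l]
  by (auto simp: monom_ser_def wterm_def)

definition wmonom :: "nat \<Rightarrow> nat \<Rightarrow> wser" where
  "wmonom k l = Abs_wser (monom_ser k l)"

lemma ser_wmonom: "ser (wmonom k l) = monom_ser k l"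
  by (simp add: wmonom_def Abs_wser_inverse wsum_monom_ser)

lemma norm_wmonom: "norm (wmonom k l) \<le> 1"
  by (simp add: norm_wser.rep_eq ser_wmonom wsum_monom_ser)

lemma wcf_wmonom: "wcf i j (wmonom k l) = (if i = k \<and> j = l then 1 else 0)"
  by (simp add: wcf_def ser_wmonom monom_ser_def)

lemma ev_wmonom: "ev (wmonom k l) x = x$1 ^ k * x$2 ^ l"
proof -
  have "((\<lambda>p. wcf (fst p) (snd p) (wmonom k l) * mnm x p) has_sum (x$1 ^ k * x$2 ^ l)) UNIV"
    by (rule has_sum_finite_neutralI[of "{(k,l)}"]) (auto simp: wcf_wmonom)
  then show ?thesis by (simp add: ev_def has_sum_iff)
qed

section \<open>Substitution of power series\<close>

definition wsubst :: "wser \<Rightarrow> wser \<Rightarrow> wser \<Rightarrow> wser" where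
  "wsubst b y z = infsum (\<lambda>p. wcf (fst p) (snd p) b *\<^sub>R (y ^ fst p * z ^ snd p)) UNIV"

text \<open>
  Two elements of norm at most one half behave like a point of the diamond.
\<close>

lemma wsubst_has_sum:
  assumes "norm y \<le> 1 / 2" "norm z \<le> 1 / 2"
  shows "((\<lambda>p. wcf (fst p) (snd p) b *\<^sub>R (y ^ fst p * z ^ snd p)) has_sum wsubst b y z) UNIV"
proof -
  have "(\<lambda>p. norm (wcf (fst p) (snd p) b *\<^sub>R (y ^ fst p * z ^ snd p))) summable_on UNIV"
  proof (rule Infinite_Sum.abs_summable_on_comparison_test')
    show "(\<lambda>p. \<bar>wcf (fst p) (snd p) b\<bar> * wt (fst p) (snd p)) summable_on UNIV"
      using norm_wser_has_sum has_sum_imp_summable by blast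
    fix p :: "nat \<times> nat"
    have "norm (y ^ fst p * z ^ snd p) \<le> norm y ^ fst p * norm z ^ snd p"
      by (intro order_trans[OF norm_mult_ineq] mult_mono norm_power_ineq) auto
    also have "\<dots> \<le> (1/2) ^ fst p * (1/2) ^ snd p"
      using assms by (intro mult_mono power_mono) auto
    also have "\<dots> \<le> wt (fst p) (snd p)"
      using abs_power_le_wt[of "1/2" "1/2" "fst p" "snd p"] by simp
    finally show "norm (wcf (fst p) (snd p) b *\<^sub>R (y ^ fst p * z ^ snd p)) \<le> \<bar>wcf (fst p) (snd p) b\<bar> * wt (fst p) (snd p)"
      by (auto intro!: mult_left_mono)
  qed
  then show ?thesis
    by (simp add: wsubst_def abs_summable_summable)
qed

lemma ev_wsubst:
  assumes "norm y \<le> 1 / 2" "norm z \<le> 1 / 2" "x \<in> unit_diamond"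
  shows "ev (wsubst b y z) x = ev b (vector [ev y x, ev z x])"
proof -
  have "\<bar>ev y x\<bar> \<le> 1/2" "\<bar>ev z x\<bar> \<le> 1/2"
    using abs_ev_le[OF assms(3)] assms(1,2) order_trans by blast+
  then have d: "vector [ev y x, ev z x] \<in> unit_diamond"
    by (simp add: unit_diamond_def)
  have "((\<lambda>p. ev (wcf (fst p) (snd p) b *\<^sub>R (y ^ fst p * z ^ snd p)) x) has_sum ev (wsubst b y z) x) UNIV"
    by (rule has_sum_bounded_linear[OF bounded_linear_ev[OF assms(3)] wsubst_has_sum[OF assms(1,2)]])
  then have "((\<lambda>p. wcf (fst p) (snd p) b * mnm (vector [ev y x, ev z x]) p) has_sum ev (wsubst b y z) x) UNIV"
    using linear_cmul[OF bounded_linear.linear[OF bounded_linear_ev[OF assms(3)]]]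
    by (simp add: ev_mult[OF assms(3)] ev_power[OF assms(3)])
  then show ?thesis by (rule ev_eqI[symmetric])
qed

section \<open>Rescaling and convergence\<close>

definition scl :: "real \<Rightarrow> real \<Rightarrow> real fps fps \<Rightarrow> real fps fps" where
  "scl s t a = mk_ser (\<lambda>i j. s ^ i * t ^ j * cf a i j)"

lemma cf_scl [simp]: "cf (scl s t a) i j = s ^ i * t ^ j * cf a i j"
  by (simp add: scl_def)

lemma scl_scl: "scl s t (scl s' t' a) = scl (s * s') (t * t') a"
  by (rule ser_eqI) (simp add: power_mult_distrib)

lemma scl_1 [simp]: "scl 1 1 a = a"
  by (rule ser_eqI) simp

lemma scl_linear [simp]:
  "scl s t 0 = 0" "scl s t (a + b) = scl s t a + scl s t b"
  "scl s t (a - b) = scl s t a - scl s t b" "scl s t (- a) = - scl s t a"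
  "scl s t (cst c * a) = cst c * scl s t a"
  by (rule ser_eqI; simp add: ring_distribs mult.left_commute)+

lemma scl_cst [simp]: "scl s t (cst c) = cst c"
  by (rule ser_eqI) (simp add: cf_cst)

lemma scl_mult [simp]: "scl s t (a * b) = scl s t a * scl s t b"
proof (rule ser_eqI)
  fix i j
  show "cf (scl s t (a * b)) i j = cf (scl s t a * scl s t b) i j"
    unfolding cf_mult cf_scl sum_distrib_left
  proof (rule sum.cong[OF refl])
    fix q assume "q \<in> {..i} \<times> {..j}"
    then have "s ^ i = s ^ fst q * s ^ (i - fst q)" "t ^ j = t ^ snd q * t ^ (j - snd q)"
      by (auto simp flip: power_add)
    then show "s ^ i * t ^ j * (cf a (fst q) (snd q) * cf b (i - fst q) (j - snd q)) =
         s ^ fst q * t ^ snd q * cf a (fst q) (snd q) *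
         (s ^ (i - fst q) * t ^ (j - snd q) * cf b (i - fst q) (j - snd q))"
      by simp
  qed
qed

text \<open>
  Every term other than the constant one carries at least one factor of modulus at most \<open>r\<close>.
\<close>

lemma wsum_scl:
  assumes "wsum a" "\<bar>s\<bar> \<le> r" "\<bar>t\<bar> \<le> r" "r \<le> 1"
  shows "wsum (scl s t a)" "wnorm (scl s t a) \<le> wnorm a"
    "wnorm (scl s t a - cst (cf a 0 0)) \<le> r * wnorm a"
proof -
  have r: "r \<ge> 0" using assms by simp
  have le: "\<bar>s ^ i * t ^ j\<bar> \<le> r ^ (i + j)" for i j
    using assms r by (simp add: abs_mult power_abs power_add mult_mono power_mono)
  have le1: "\<bar>s ^ i * t ^ j\<bar> \<le> 1" for i j
    using le[of i j] power_le_one[OF r assms(4), of "i + j"] by simp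
  have "wterm (scl s t a) p \<le> wterm a p" for p
    using mult_right_mono[OF le1[of "fst p" "snd p"], of "wterm a p"]
    by (simp add: wterm_def abs_mult mult.assoc)
  then show "wsum (scl s t a)" "wnorm (scl s t a) \<le> wnorm a"
    using wsum_compare[OF wnorm_has_sum[OF assms(1)]] by auto
  have "wterm (scl s t a - cst (cf a 0 0)) p \<le> r * wterm a p" for p
  proof (cases "p = (0,0)")
    case True
    then show ?thesis using r by (simp add: wterm_def cf_cst)
  next
    case False
    then have "fst p + snd p \<ge> 1" by (cases p) auto
    then have "r ^ (fst p + snd p) \<le> r ^ 1" by (rule power_decreasing) (use r assms in auto)
    then have "\<bar>s ^ fst p * t ^ snd p\<bar> \<le> r" using le[of "fst p" "snd p"] by simp
    from mult_right_mono[OF this, of "wterm a p"] False show ?thesis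
      by (cases p) (auto simp: wterm_def abs_mult mult.assoc cf_cst)
  qed
  then show "wnorm (scl s t a - cst (cf a 0 0)) \<le> r * wnorm a"
    using wsum_compare[OF has_sum_cmult_right[OF wnorm_has_sum[OF assms(1)], of r]] by auto
qed

text \<open>
  Convergent power series, characterised by finiteness of the weighted norm after some rescaling.
\<close>

definition conv :: "real fps fps \<Rightarrow> bool" where
  "conv a \<longleftrightarrow> (\<exists>s>0. wsum (scl s s a))"

text \<open>
  The anisotropic rescalings with \<open>t \<le> s\<close> include \<open>t = s\<^sup>2\<close>, the one that makes the Cauchy problem a
  contraction.
\<close>

lemma conv_scale:
  assumes "conv a"
  obtains s0 C where "0 < s0" "s0 \<le> 1" "0 \<le> C"
    "\<And>s t. 0 < s \<Longrightarrow> s \<le> s0 \<Longrightarrow> 0 \<le> t \<Longrightarrow> t \<le> s \<Longrightarrow>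
       wsum (scl s t a) \<and> wnorm (scl s t a) \<le> C \<and> wnorm (scl s t a - cst (cf a 0 0)) \<le> C * s"
proof -
  obtain s1 where s1: "s1 > 0" "wsum (scl s1 s1 a)" using assms conv_def by auto
  define s0 where "s0 = min 1 s1"
  define b where "b = scl s0 s0 a"
  have s0: "0 < s0" "s0 \<le> 1" using s1 by (auto simp: s0_def)
  have "b = scl (s0 / s1) (s0 / s1) (scl s1 s1 a)" using s1 by (simp add: scl_scl b_def)
  then have b: "wsum b" using wsum_scl(1)[OF s1(2), of "s0/s1" 1 "s0/s1"] s1 by (auto simp: s0_def)
  show ?thesis
  proof (rule that[of s0 "wnorm b + wnorm b / s0"])
    show "0 < s0" "s0 \<le> 1" "0 \<le> wnorm b + wnorm b / s0" using s0 wnorm_nonneg[of b] by auto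
    fix s t :: real assume s: "0 < s" "s \<le> s0" "0 \<le> t" "t \<le> s"
    have e: "scl s t a = scl (s / s0) (t / s0) b" using s0 by (simp add: b_def scl_scl)
    have c: "cf b 0 0 = cf a 0 0" by (simp add: b_def)
    have 1: "\<bar>s / s0\<bar> \<le> s / s0" "\<bar>t / s0\<bar> \<le> s / s0" "s / s0 \<le> 1"
      using s s0 by (auto simp: divide_simps)
    note w = wsum_scl[OF b 1, folded e, unfolded c]
    have "wnorm b / s0 \<ge> 0" using s0 wnorm_nonneg[of b] by auto
    moreover have "wnorm b * s \<ge> 0" using s wnorm_nonneg[of b] by auto
    ultimately show "wsum (scl s t a) \<and> wnorm (scl s t a) \<le> wnorm b + wnorm b / s0 \<and>
        wnorm (scl s t a - cst (cf a 0 0)) \<le> (wnorm b + wnorm b / s0) * s"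
      using w by (auto simp: algebra_simps intro: order_trans)
  qed
qed

lemma conv_pair:
  assumes "conv a" "conv b"
  obtains s where "s > 0" "wsum (scl s s a)" "wsum (scl s s b)"
proof -
  obtain s1 where "0 < s1" "\<And>s. 0 < s \<Longrightarrow> s \<le> s1 \<Longrightarrow> wsum (scl s s a)"
    using conv_scale[OF assms(1)] by (metis less_eq_real_def)
  moreover obtain s2 where "0 < s2" "\<And>s. 0 < s \<Longrightarrow> s \<le> s2 \<Longrightarrow> wsum (scl s s b)"
    using conv_scale[OF assms(2)] by (metis less_eq_real_def)
  ultimately show ?thesis using that[of "min s1 s2"] by simp
qed

lemma conv_add: "conv a \<Longrightarrow> conv b \<Longrightarrow> conv (a + b)"
  and conv_diff: "conv a \<Longrightarrow> conv b \<Longrightarrow> conv (a - b)"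
  and conv_mult: "conv a \<Longrightarrow> conv b \<Longrightarrow> conv (a * b)"
  by (erule (1) conv_pair; force simp: conv_def intro: wsum_add wsum_diff wsum_mult)+

lemma conv_wsum: "wsum a \<Longrightarrow> conv a"
  unfolding conv_def by (intro exI[of _ 1]) simp

lemma conv_cst: "conv (cst c)"
  using wsum_cst_mult(1)[OF wsum_1(1), of c] by (intro conv_wsum) simp

lemma conv_unscl: "wsum (scl s t a) \<Longrightarrow> s > 0 \<Longrightarrow> t > 0 \<Longrightarrow> conv a"
proof -
  assume a: "wsum (scl s t a)" "s > 0" "t > 0"
  have "scl (min s t) (min s t) a = scl (min s t / s) (min s t / t) (scl s t a)"
    using a by (simp add: scl_scl)
  with wsum_scl(1)[OF a(1), of "min s t / s" 1 "min s t / t"] a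
  show "conv a" unfolding conv_def by (intro exI[of _ "min s t"]) (auto simp: divide_simps)
qed

section \<open>Formal derivations\<close>

definition du :: "real fps fps \<Rightarrow> real fps fps" where
  "du a = mk_ser (\<lambda>i j. real (i + 1) * cf a (i + 1) j)"

definition dv :: "real fps fps \<Rightarrow> real fps fps" where
  "dv a = mk_ser (\<lambda>i j. real (j + 1) * cf a i (j + 1))"

lemma cf_du [simp]: "cf (du a) i j = real (i + 1) * cf a (i + 1) j"
  by (simp add: du_def)

lemma cf_dv [simp]: "cf (dv a) i j = real (j + 1) * cf a i (j + 1)"
  by (simp add: dv_def)

lemma du_linear [simp]: "du 0 = 0" "du (a + b) = du a + du b" "du (a - b) = du a - du b"
    "du (cst c * a) = cst c * du a" "du (- a) = - du a"
  and dv_linear [simp]: "dv 0 = 0" "dv (a + b) = dv a + dv b" "dv (a - b) = dv a - dv b"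
    "dv (cst c * a) = cst c * dv a" "dv (- a) = - dv a"
  by (rule ser_eqI; simp add: ring_distribs mult.left_commute)+

lemma du_cst [simp]: "du (cst c) = 0" and dv_cst [simp]: "dv (cst c) = 0"
  by (rule ser_eqI; simp add: cf_cst)+

lemma du_dv: "du (dv a) = dv (du a)"
  by (rule ser_eqI) simp

text \<open>
  As series in \<open>v\<close> over the ring of series in \<open>u\<close>, the derivation in \<open>v\<close> is the usual one; the derivation in
  \<open>u\<close> acts on the coefficients. The product rules follow from the one-variable rule.
\<close>

lemma dv_eq_fps_deriv: "dv a = fps_deriv a"
  by (rule ser_eqI) (simp add: cf_def dv_def mk_ser_def fps_of_nat[symmetric] del: of_nat_Suc of_nat_add)

lemma du_nth: "fps_nth (du a) j = fps_deriv (fps_nth a j)"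
  by (rule fps_ext) (simp add: cf_def du_def mk_ser_def)

lemma dv_mult: "dv (a * b) = dv a * b + a * dv b"
  by (simp add: dv_eq_fps_deriv)

lemma du_mult: "du (a * b) = du a * b + a * du b"
proof (rule fps_ext)
  fix n
  show "fps_nth (du (a * b)) n = fps_nth (du a * b + a * du b) n"
    unfolding du_nth fps_mult_nth fps_add_nth
    by (simp add: fps_deriv_sum sum.distrib du_nth add.commute)
qed

lemma dv_zero_imp_zero:
  assumes "dv a = 0" "\<And>i. cf a i 0 = 0"
  shows "a = 0"
proof (rule ser_eqI)
  fix i j
  show "cf a i j = cf 0 i j"
  proof (cases j)
    case (Suc k)
    have "cf (dv a) i k = 0" using assms(1) by simp
    then show ?thesis using Suc by simp
  qed (simp add: assms)
qed

lemma wt_Suc: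
  shows wt_Suc_left: "real (i + 1) * wt i j = real (i + j + 1) * wt (i + 1) j"
    and wt_Suc_right: "real (j + 1) * wt i j = real (i + j + 1) * wt i (j + 1)"
proof -
  have cross: "y * (1 / A) = x * (1 / B)" if "x * A = B * y" "A > 0" "B > 0" for x y A B :: real
    using that by (simp add: field_simps)
  have "Suc (i + j) * ((i + j) choose i) = (Suc (i + j) choose Suc i) * Suc i"
    by (rule Suc_times_binomial_eq)
  then have "real (i + j + 1) * real ((i + j) choose i) = real ((i + 1 + j) choose (i + 1)) * real (i + 1)"
    by (metis Suc_eq_plus1 add_Suc of_nat_mult)
  then show "real (i + 1) * wt i j = real (i + j + 1) * wt (i + 1) j"
    unfolding wt_def by (rule cross) (simp_all del: binomial_Suc_Suc)
  have "(i + j + 1 - i) * ((i + j + 1) choose i) = (i + j + 1) * ((i + j + 1 - 1) choose i)"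
    by (rule binomial_absorb_comp)
  then have "real (j + 1) * real ((i + j + 1) choose i) = real (i + j + 1) * real ((i + j) choose i)"
    by (metis (no_types, lifting) add.assoc add_diff_cancel_left' add_diff_cancel_right' of_nat_mult)
  then show "real (j + 1) * wt i j = real (i + j + 1) * wt i (j + 1)"
    unfolding wt_def add.assoc[symmetric] by (intro cross) (simp_all add: mult.commute del: binomial_Suc_Suc)
qed

text \<open>
  The operators below shift indices and multiply by bounded factors; such operators are bounded for the
  weighted norm.
\<close>

lemma wsum_dominated:
  assumes "wsum b" "K \<ge> 0" "inj_on \<phi> S" "\<And>p. p \<in> S \<Longrightarrow> wterm c p \<le> K * wterm b (\<phi> p)"
    "\<And>p. p \<notin> S \<Longrightarrow> wterm c p = 0"
  shows "wsum c" "wnorm c \<le> K * wnorm b"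
proof -
  have "sum (wterm c) F \<le> K * wnorm b" if "finite F" for F
  proof -
    have "sum (wterm c) F = sum (wterm c) (F \<inter> S)"
      using that assms(5) by (intro sum.mono_neutral_right) auto
    also have "\<dots> \<le> K * (\<Sum>p\<in>F \<inter> S. wterm b (\<phi> p))"
      unfolding sum_distrib_left by (intro sum_mono assms) auto
    also have "(\<Sum>p\<in>F \<inter> S. wterm b (\<phi> p)) = sum (wterm b) (\<phi> ` (F \<inter> S))"
      using assms(3) by (subst sum.reindex) (auto intro: inj_on_subset)
    also have "\<dots> \<le> wnorm b"
      by (rule finite_sum_le_has_sum[OF wnorm_has_sum[OF assms(1)]]) (use that in auto)
    finally show ?thesis using assms(2) by (simp add: mult_left_mono)
  qed
  then show "wsum c" "wnorm c \<le> K * wnorm b" by (auto intro: wsumI)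
qed

text \<open>
  Differentiation produces a factor \<open>i + j + 1\<close> (\<open>wt_Suc\<close>), which the factor \<open>2 ^ (i + j)\<close> gained by halving the radius
  absorbs.
\<close>

lemma conv_du: "conv a \<Longrightarrow> conv (du a)" and conv_dv: "conv a \<Longrightarrow> conv (dv a)"
proof -
  assume "conv a"
  then obtain s where s: "s > 0" "wsum (scl s s a)" by (auto simp: conv_def)
  let ?b = "scl s s a"
  have up: "real (i + j + 1) \<le> 2 ^ (i + j)" for i j :: nat
  proof -
    have "i + j + 1 \<le> 2 ^ (i + j)" using Suc_leI[OF less_exp[of "i + j"]] by simp
    then show ?thesis by (metis of_nat_le_iff of_nat_numeral of_nat_power)
  qed
  have "wterm (scl (s/2) (s/2) (du a)) (i, j) \<le> 1 / s * wterm ?b (i + 1, j)" for i j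
  proof -
    have "wterm (scl (s/2) (s/2) (du a)) (i, j)
        = (s/2) ^ (i + j) * \<bar>cf a (i + 1) j\<bar> * (real (i + 1) * wt i j)"
      using s by (simp add: wterm_def abs_mult power_add)
    also have "\<dots> = s ^ (i + j) * \<bar>cf a (i + 1) j\<bar> * wt (i + 1) j * (real (i + j + 1) / 2 ^ (i + j))"
      unfolding wt_Suc_left by (simp add: power_divide)
    also have "\<dots> \<le> s ^ (i + j) * \<bar>cf a (i + 1) j\<bar> * wt (i + 1) j * 1"
      using s up[of i j] by (intro mult_left_mono) (auto simp: divide_simps)
    also have "\<dots> = 1 / s * wterm ?b (i + 1, j)"
      using s by (simp add: wterm_def abs_mult power_add)
    finally show ?thesis .
  qed
  then have "wsum (scl (s/2) (s/2) (du a))"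
    by (intro wsum_dominated(1)[OF s(2), of "1/s" "\<lambda>p. (fst p + 1, snd p)" UNIV])
       (use s in \<open>auto simp: inj_def\<close>)
  from conv_unscl[OF this] show "conv (du a)" using s by simp
  have "wterm (scl (s/2) (s/2) (dv a)) (i, j) \<le> 1 / s * wterm ?b (i, j + 1)" for i j
  proof -
    have "wterm (scl (s/2) (s/2) (dv a)) (i, j)
        = (s/2) ^ (i + j) * \<bar>cf a i (j + 1)\<bar> * (real (j + 1) * wt i j)"
      using s by (simp add: wterm_def abs_mult power_add)
    also have "\<dots> = s ^ (i + j) * \<bar>cf a i (j + 1)\<bar> * wt i (j + 1) * (real (i + j + 1) / 2 ^ (i + j))"
      unfolding wt_Suc_right by (simp add: power_divide)
    also have "\<dots> \<le> s ^ (i + j) * \<bar>cf a i (j + 1)\<bar> * wt i (j + 1) * 1"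
      using s up[of i j] by (intro mult_left_mono) (auto simp: divide_simps)
    also have "\<dots> = 1 / s * wterm ?b (i, j + 1)"
      using s by (simp add: wterm_def abs_mult power_add)
    finally show ?thesis .
  qed
  then have "wsum (scl (s/2) (s/2) (dv a))"
    by (intro wsum_dominated(1)[OF s(2), of "1/s" "\<lambda>p. (fst p, snd p + 1)" UNIV])
       (use s in \<open>auto simp: inj_def\<close>)
  from conv_unscl[OF this] show "conv (dv a)" using s by simp
qed

section \<open>Functions with a convergent expansion at the origin\<close>

definition fexp :: "(real^2 \<Rightarrow> real) \<Rightarrow> real fps fps \<Rightarrow> bool" where
  "fexp \<phi> a \<longleftrightarrow> (\<exists>s>0. \<forall>x. norm x < s \<longrightarrow>
     ((\<lambda>p. cf a (fst p) (snd p) * mnm x p) has_sum \<phi> x) UNIV)"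

lemma norm_le_l1_2: "norm (x::real^2) \<le> \<bar>x$1\<bar> + \<bar>x$2\<bar>"
  using norm_le_l1_cart[of x] by (simp add: sum_2)

lemma fexp_cong:
  assumes "fexp \<phi> a" "\<forall>\<^sub>F x in nhds 0. \<phi> x = \<psi> x"
  shows "fexp \<psi> a"
proof -
  obtain s where s: "s > 0" "\<And>x. norm x < s \<Longrightarrow> ((\<lambda>p. cf a (fst p) (snd p) * mnm x p) has_sum \<phi> x) UNIV"
    using assms(1) by (auto simp: fexp_def)
  obtain d where d: "d > 0" "\<And>x. norm x < d \<Longrightarrow> \<phi> x = \<psi> x"
    using assms(2) by (auto simp: eventually_nhds_metric)
  have "((\<lambda>p. cf a (fst p) (snd p) * mnm x p) has_sum \<psi> x) UNIV" if "norm x < min s d" for x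
    using s(2)[of x] d(2)[of x] that by simp
  then show ?thesis unfolding fexp_def using s(1) d(1) by (intro exI[of _ "min s d"]) simp
qed

lemma fexp_same_series:
  assumes "fexp \<phi> a" "fexp \<psi> a"
  shows "\<forall>\<^sub>F x in nhds 0. \<phi> x = \<psi> x"
proof -
  obtain s t where "s > 0" "\<And>x. norm x < s \<Longrightarrow> ((\<lambda>p. cf a (fst p) (snd p) * mnm x p) has_sum \<phi> x) UNIV"
    and "t > 0" "\<And>x. norm x < t \<Longrightarrow> ((\<lambda>p. cf a (fst p) (snd p) * mnm x p) has_sum \<psi> x) UNIV"
    using assms by (auto simp: fexp_def)
  then have "\<phi> x = \<psi> x" if "dist x 0 < min s t" for x
    using that by (auto intro!: has_sum_unique[where f = "\<lambda>p. cf a (fst p) (snd p) * mnm x p"])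
  with \<open>s > 0\<close> \<open>t > 0\<close> show ?thesis unfolding eventually_nhds_metric by (intro exI[of _ "min s t"]) simp
qed

lemma fexp_at_0: "fexp \<phi> a \<Longrightarrow> \<phi> 0 = cf a 0 0"
proof -
  assume "fexp \<phi> a"
  then obtain s where "s > 0" "\<And>x. norm x < s \<Longrightarrow> ((\<lambda>p. cf a (fst p) (snd p) * mnm x p) has_sum \<phi> x) UNIV"
    by (auto simp: fexp_def)
  from this(2)[of 0] this(1) have "((\<lambda>p. cf a (fst p) (snd p) * mnm 0 p) has_sum \<phi> 0) UNIV" by simp
  moreover have "((\<lambda>p. cf a (fst p) (snd p) * mnm 0 p) has_sum cf a 0 0) UNIV"
    by (rule has_sum_finite_neutralI[of "{(0,0)}"]) (auto simp: power_0_left)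
  ultimately show ?thesis using has_sum_unique by blast
qed

lemma fexp_pair:
  assumes "fexp \<phi> a" "fexp \<psi> b"
  obtains s where "s > 0"
    "\<And>x. norm x < s \<Longrightarrow> ((\<lambda>p. cf a (fst p) (snd p) * mnm x p) has_sum \<phi> x) UNIV"
    "\<And>x. norm x < s \<Longrightarrow> ((\<lambda>p. cf b (fst p) (snd p) * mnm x p) has_sum \<psi> x) UNIV"
proof -
  obtain s t where "s > 0" "\<And>x. norm x < s \<Longrightarrow> ((\<lambda>p. cf a (fst p) (snd p) * mnm x p) has_sum \<phi> x) UNIV"
    and "t > 0" "\<And>x. norm x < t \<Longrightarrow> ((\<lambda>p. cf b (fst p) (snd p) * mnm x p) has_sum \<psi> x) UNIV"
    using assms by (auto simp: fexp_def)
  then show ?thesis by (intro that[of "min s t"]) auto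
qed

lemma fexp_add: "fexp \<phi> a \<Longrightarrow> fexp \<psi> b \<Longrightarrow> fexp (\<lambda>x. \<phi> x + \<psi> x) (a + b)"
proof (erule (1) fexp_pair)
  fix s assume "s > 0" "\<And>x. norm x < s \<Longrightarrow> ((\<lambda>p. cf a (fst p) (snd p) * mnm x p) has_sum \<phi> x) UNIV"
    "\<And>x. norm x < s \<Longrightarrow> ((\<lambda>p. cf b (fst p) (snd p) * mnm x p) has_sum \<psi> x) UNIV"
  then show ?thesis unfolding fexp_def
    by (intro exI[of _ s]) (auto simp: distrib_right intro!: has_sum_add)
qed

lemma fexp_mult: "fexp \<phi> a \<Longrightarrow> fexp \<psi> b \<Longrightarrow> fexp (\<lambda>x. \<phi> x * \<psi> x) (a * b)"
  by (erule (1) fexp_pair) (auto simp: fexp_def intro!: has_sum_ser_mult)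

lemma fexp_cst: "fexp (\<lambda>x. c) (cst c)"
  unfolding fexp_def
proof (intro exI[of _ 1] conjI allI impI)
  show "((\<lambda>p. cf (cst c) (fst p) (snd p) * mnm x p) has_sum c) UNIV" for x
    by (rule has_sum_finite_neutralI[of "{(0,0)}"]) (auto simp: cf_cst)
qed simp

lemma fexp_diff: "fexp \<phi> a \<Longrightarrow> fexp \<psi> b \<Longrightarrow> fexp (\<lambda>x. \<phi> x - \<psi> x) (a - b)"
  using fexp_add[of \<phi> a "\<lambda>x. -1 * \<psi> x" "cst (-1) * b"] fexp_mult[OF fexp_cst[of "-1"], of \<psi> b] by simp

lemma fexp_monom: "fexp (\<lambda>x. x$1 ^ k * x$2 ^ l) (monom_ser k l)"
  unfolding fexp_def
proof (intro exI[of _ 1] conjI allI impI)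
  show "((\<lambda>p. cf (monom_ser k l) (fst p) (snd p) * mnm x p) has_sum x$1 ^ k * x$2 ^ l) UNIV" for x
    by (rule has_sum_finite_neutralI[of "{(k,l)}"]) (auto simp: monom_ser_def)
qed simp

text \<open>
  Convergence at a single point off the axes is already absolute convergence on a diamond, that is,
  membership in the Banach algebra after rescaling.
\<close>

lemma fexpD:
  assumes "fexp \<phi> a"
  shows "\<exists>s0>0. \<forall>s. 0 < s \<and> s \<le> s0 \<longrightarrow> (\<exists>b. ser b = scl s s a \<and> (\<forall>x\<in>unit_diamond. \<phi> (s *\<^sub>R x) = ev b x))"
proof -
  obtain r where r: "r > 0" "\<And>x. norm x < r \<Longrightarrow> ((\<lambda>p. cf a (fst p) (snd p) * mnm x p) has_sum \<phi> x) UNIV"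
    using assms by (auto simp: fexp_def)
  have "\<exists>b. ser b = scl s s a \<and> (\<forall>x\<in>unit_diamond. \<phi> (s *\<^sub>R x) = ev b x)" if s: "0 < s" "s \<le> r / 3" for s
  proof -
    let ?x = "vector [s, s] :: real^2"
    have "norm ?x < r" using norm_le_l1_2[of ?x] s by simp
    from r(2)[OF this] have "(\<lambda>p. cf a (fst p) (snd p) * mnm ?x p) summable_on UNIV"
      by (rule has_sum_imp_summable)
    then have "(\<lambda>p. norm (cf a (fst p) (snd p) * mnm ?x p)) summable_on UNIV"
      by (rule summable_on_iff_abs_summable_on_real[THEN iffD1])
    then have h: "((\<lambda>p. norm (cf a (fst p) (snd p) * mnm ?x p)) has_sum infsum (\<lambda>p. norm (cf a (fst p) (snd p) * mnm ?x p)) UNIV) UNIV"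
      by (rule has_sum_infsum)
    have "wterm (scl s s a) p \<le> norm (cf a (fst p) (snd p) * mnm ?x p)" for p
      using mult_left_mono[OF wt_le_1[of "fst p" "snd p"], of "\<bar>cf (scl s s a) (fst p) (snd p)\<bar>"]
      by (simp add: wterm_def abs_mult mult.commute)
    then have w: "wsum (scl s s a)" by (rule wsum_compare(1)[OF h])
    define b where "b = Abs_wser (scl s s a)"
    have b: "ser b = scl s s a" using w by (simp add: b_def Abs_wser_inverse)
    have "\<phi> (s *\<^sub>R x) = ev b x" if x: "x \<in> unit_diamond" for x
    proof -
      have "norm (s *\<^sub>R x) \<le> s * (\<bar>x$1\<bar> + \<bar>x$2\<bar>)"
        using norm_le_l1_2[of x] s by simp
      also have "\<dots> \<le> s * 1" using x s by (intro mult_left_mono) (auto simp: unit_diamond_def)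
      also have "\<dots> < r" using s r by simp
      finally have "((\<lambda>p. cf a (fst p) (snd p) * mnm (s *\<^sub>R x) p) has_sum \<phi> (s *\<^sub>R x)) UNIV"
        by (rule r(2))
      then have "((\<lambda>p. wcf (fst p) (snd p) b * mnm x p) has_sum \<phi> (s *\<^sub>R x)) UNIV"
        by (simp add: wcf_def b power_mult_distrib ac_simps)
      then show ?thesis by (rule ev_eqI[symmetric])
    qed
    with b show ?thesis by blast
  qed
  with r(1) show ?thesis by (intro exI[of _ "r / 3"]) auto
qed

lemma fexpE:
  assumes "fexp \<phi> a"
  obtains s b where "s > 0" "ser b = scl s s a" "\<And>x. x \<in> unit_diamond \<Longrightarrow> \<phi> (s *\<^sub>R x) = ev b x"
proof -
  obtain s0 where "s0 > 0" "\<And>s. 0 < s \<and> s \<le> s0 \<Longrightarrow> (\<exists>b. ser b = scl s s a \<and> (\<forall>x\<in>unit_diamond. \<phi> (s *\<^sub>R x) = ev b x))"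
    using fexpD[OF assms] by blast
  with that show thesis by fastforce
qed

lemma fexpI:
  assumes "s > 0" "ser b = scl s s a" "\<And>x. x \<in> unit_diamond \<Longrightarrow> \<phi> (s *\<^sub>R x) = ev b x"
  shows "fexp \<phi> a"
  unfolding fexp_def
proof (intro exI[of _ "s/2"] conjI allI impI)
  fix x :: "real^2" assume x: "norm x < s / 2"
  let ?y = "(1 / s) *\<^sub>R x"
  have "\<bar>x$1\<bar> + \<bar>x$2\<bar> \<le> s"
    using x component_le_norm_cart[of x 1] component_le_norm_cart[of x 2] by simp
  then have y: "?y \<in> unit_diamond" using assms(1) by (simp add: unit_diamond_def divide_simps)
  have e: "cf a i j = wcf i j b / s ^ i / s ^ j" for i j
    using assms(1,2) by (simp add: wcf_def)
  have "((\<lambda>p. wcf (fst p) (snd p) b * mnm ?y p) has_sum \<phi> (s *\<^sub>R ?y)) UNIV"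
    unfolding assms(3)[OF y] by (rule ev_has_sum[OF y])
  then show "((\<lambda>p. cf a (fst p) (snd p) * mnm x p) has_sum \<phi> x) UNIV"
    using assms(1) by (simp add: e power_divide)
qed (use assms in simp)

definition evf :: "real fps fps \<Rightarrow> real^2 \<Rightarrow> real" where
  "evf a x = infsum (\<lambda>p. cf a (fst p) (snd p) * mnm x p) UNIV"

lemma conv_imp_fexp: "conv a \<Longrightarrow> fexp (evf a) a"
proof -
  assume "conv a"
  then obtain s where s: "s > 0" "wsum (scl s s a)" by (auto simp: conv_def)
  show ?thesis
  proof (rule fexpI[OF s(1)])
    show "ser (Abs_wser (scl s s a)) = scl s s a" using s by (simp add: Abs_wser_inverse)
    fix x assume "x \<in> unit_diamond"
    show "evf a (s *\<^sub>R x) = ev (Abs_wser (scl s s a)) x"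
      unfolding evf_def ev_def wcf_def using s
      by (intro infsum_cong) (simp add: Abs_wser_inverse power_mult_distrib ac_simps)
  qed
qed

lemma fexp_imp_conv: "fexp \<phi> a \<Longrightarrow> conv a"
proof -
  assume "fexp \<phi> a"
  then obtain s b where "s > 0" "ser b = scl s s a" by (rule fexpE)
  then show "conv a" using wsum_ser[of b] by (auto simp: conv_def)
qed

lemma conv_scale_diag:
  assumes "conv a" "cf a 0 0 = 0"
  shows "\<exists>s0>0. \<exists>C\<ge>0. \<forall>t. 0 < t \<and> t \<le> s0 \<longrightarrow> wnorm (scl t t a) \<le> C * t"
proof (rule conv_scale[OF assms(1)])
  fix s0 C :: real
  assume "0 < s0" "s0 \<le> 1" "0 \<le> C" and *: "\<And>s t. 0 < s \<Longrightarrow> s \<le> s0 \<Longrightarrow> 0 \<le> t \<Longrightarrow> t \<le> s \<Longrightarrow>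
       wsum (scl s t a) \<and> wnorm (scl s t a) \<le> C \<and> wnorm (scl s t a - cst (cf a 0 0)) \<le> C * s"
  moreover have "wnorm (scl t t a) \<le> C * t" if "0 < t" "t \<le> s0" for t
    using *[of t t] that by (simp add: assms(2))
  ultimately show ?thesis by blast
qed

text \<open>
  After rescaling, the inner series have norm at most one half because their constant terms vanish, so the
  composition can be formed in the Banach algebra.
\<close>

lemma fexp_subst:
  assumes \<phi>: "fexp \<phi> a" and \<theta>1: "fexp \<theta>1 b1" and \<theta>2: "fexp \<theta>2 b2"
    and 0: "cf b1 0 0 = 0" "cf b2 0 0 = 0"
  shows "\<exists>c. fexp (\<lambda>x. \<phi> (vector [\<theta>1 x, \<theta>2 x])) c"
proof -
  obtain s A where s: "s > 0" and A: "\<And>x. x \<in> unit_diamond \<Longrightarrow> \<phi> (s *\<^sub>R x) = ev A x"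
    using fexpE[OF \<phi>] by blast
  obtain t1 where t1: "t1 > 0"
    "\<And>t. 0 < t \<and> t \<le> t1 \<Longrightarrow> \<exists>b. ser b = scl t t b1 \<and> (\<forall>x\<in>unit_diamond. \<theta>1 (t *\<^sub>R x) = ev b x)"
    using fexpD[OF \<theta>1] by blast
  obtain t2 where t2: "t2 > 0"
    "\<And>t. 0 < t \<and> t \<le> t2 \<Longrightarrow> \<exists>b. ser b = scl t t b2 \<and> (\<forall>x\<in>unit_diamond. \<theta>2 (t *\<^sub>R x) = ev b x)"
    using fexpD[OF \<theta>2] by blast
  obtain t3 C1 where t3: "0 < t3" "0 \<le> C1" "\<And>t. 0 < t \<and> t \<le> t3 \<Longrightarrow> wnorm (scl t t b1) \<le> C1 * t"
    using conv_scale_diag[OF fexp_imp_conv[OF \<theta>1] 0(1)] by blast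
  obtain t4 C2 where t4: "0 < t4" "0 \<le> C2" "\<And>t. 0 < t \<and> t \<le> t4 \<Longrightarrow> wnorm (scl t t b2) \<le> C2 * t"
    using conv_scale_diag[OF fexp_imp_conv[OF \<theta>2] 0(2)] by blast
  \<comment> \<open>small enough for both inner functions to take values of size at most \<open>s / 2\<close>\<close>
  define t where "t = Min {t1, t2, t3, t4, s / (2 * (C1 + C2 + 1))}"
  have t: "0 < t" "t \<le> t1" "t \<le> t2" "t \<le> t3" "t \<le> t4" "t \<le> s / (2 * (C1 + C2 + 1))"
    using t1(1) t2(1) t3(1,2) t4(1,2) s by (auto simp: t_def)
  then have tC: "2 * ((C1 + C2 + 1) * t) \<le> s" using t3(2) t4(2) by (simp add: field_simps)
  have "2 * (C1 * t) \<le> s" "2 * (C2 * t) \<le> s"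
    using tC t(1) mult_nonneg_nonneg[OF t3(2), of t] mult_nonneg_nonneg[OF t4(2), of t]
    by (auto simp: algebra_simps)
  note Ct = this
  obtain B1 where B1: "ser B1 = scl t t b1" "\<And>x. x\<in>unit_diamond \<Longrightarrow> \<theta>1 (t *\<^sub>R x) = ev B1 x"
    using t1(2)[of t] t by auto
  obtain B2 where B2: "ser B2 = scl t t b2" "\<And>x. x\<in>unit_diamond \<Longrightarrow> \<theta>2 (t *\<^sub>R x) = ev B2 x"
    using t2(2)[of t] t by auto
  let ?y = "(1 / s) *\<^sub>R B1" and ?z = "(1 / s) *\<^sub>R B2"
  have n: "norm ?y \<le> 1/2" "norm ?z \<le> 1/2"
    using t3(3)[of t] t4(3)[of t] t Ct s
    by (auto simp: norm_wser.rep_eq[of B1] norm_wser.rep_eq[of B2] B1(1) B2(1) divide_simps)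
  show ?thesis
  proof (rule exI, rule fexpI)
    show "t > 0" by (rule t(1))
    show "ser (wsubst A ?y ?z) = scl t t (scl (1/t) (1/t) (ser (wsubst A ?y ?z)))"
      using t(1) by (simp add: scl_scl)
    fix x assume x: "x \<in> unit_diamond"
    have e: "ev ((1 / s) *\<^sub>R b) x = ev b x / s" for b
      by (simp add: linear_cmul[OF bounded_linear.linear[OF bounded_linear_ev[OF x]]])
    let ?v = "vector [ev ?y x, ev ?z x] :: real^2"
    have "\<bar>ev ?y x\<bar> \<le> 1/2" "\<bar>ev ?z x\<bar> \<le> 1/2"
      using abs_ev_le[OF x] n order_trans by blast+
    then have d: "?v \<in> unit_diamond" by (simp add: unit_diamond_def)
    have "vector [\<theta>1 (t *\<^sub>R x), \<theta>2 (t *\<^sub>R x)] = s *\<^sub>R ?v"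
      using s by (simp add: vec_eq_iff forall_2 B1(2)[OF x] B2(2)[OF x] e)
    then show "\<phi> (vector [\<theta>1 (t *\<^sub>R x), \<theta>2 (t *\<^sub>R x)]) = ev (wsubst A ?y ?z) x"
      by (simp add: A[OF d] ev_wsubst[OF n x])
  qed
qed

section \<open>Change of the centre and derivatives\<close>

lemma wcf_00_mult: "wcf 0 0 (a * b) = wcf 0 0 a * wcf 0 0 b"
  and wcf_10_mult: "wcf 1 0 (a * b) = wcf 1 0 a * wcf 0 0 b + wcf 0 0 a * wcf 1 0 b"
  and wcf_01_mult: "wcf 0 1 (a * b) = wcf 0 1 a * wcf 0 0 b + wcf 0 0 a * wcf 0 1 b"
proof -
  have 1: "{..1::nat} \<times> {..0::nat} = {(0,0),(1,0)}" "{..0::nat} \<times> {..1::nat} = {(0,0),(0,1)}"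
    by (auto simp: le_Suc_eq)
  show "wcf 0 0 (a * b) = wcf 0 0 a * wcf 0 0 b"
    "wcf 1 0 (a * b) = wcf 1 0 a * wcf 0 0 b + wcf 0 0 a * wcf 1 0 b"
    "wcf 0 1 (a * b) = wcf 0 1 a * wcf 0 0 b + wcf 0 0 a * wcf 0 1 b"
    unfolding wcf_def times_wser.rep_eq cf_mult 1 by simp_all
qed

lemma wcf_power:
  "wcf 0 0 (z ^ n) = wcf 0 0 z ^ n"
  "wcf 1 0 (z ^ n) = real n * wcf 0 0 z ^ (n - 1) * wcf 1 0 z"
  "wcf 0 1 (z ^ n) = real n * wcf 0 0 z ^ (n - 1) * wcf 0 1 z"
proof -
  have A: "wcf 0 0 (z ^ n) = wcf 0 0 z ^ n" for n
    by (induction n) (simp_all add: wcf_one wcf_00_mult)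
  have s: "0 < n \<Longrightarrow> x * x ^ (n - Suc 0) = x ^ n" for x :: real and n :: nat
    by (cases n) simp_all
  show "wcf 0 0 (z ^ n) = wcf 0 0 z ^ n" by (rule A)
  show "wcf 1 0 (z ^ n) = real n * wcf 0 0 z ^ (n - 1) * wcf 1 0 z"
    "wcf 0 1 (z ^ n) = real n * wcf 0 0 z ^ (n - 1) * wcf 0 1 z"
    by (induction n) (auto simp add: wcf_one[of "Suc 0"] wcf_one[of 0 "Suc 0"] A s algebra_simps
        wcf_10_mult[unfolded One_nat_def] wcf_01_mult[unfolded One_nat_def])
qed

lemma du_has_sum:
  assumes "((\<lambda>p. cf a (fst p) (snd p) * real (fst p) * (y$1 ^ (fst p - 1) * y$2 ^ snd p)) has_sum S) UNIV"
  shows "((\<lambda>p. cf (du a) (fst p) (snd p) * mnm y p) has_sum S) UNIV"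
proof -
  let ?h = "\<lambda>p::nat \<times> nat. (Suc (fst p), snd p)"
  have "((\<lambda>p. cf a (fst p) (snd p) * real (fst p) * (y$1 ^ (fst p - 1) * y$2 ^ snd p)) has_sum S) (range ?h)"
  proof (rule has_sum_cong_neutral[THEN iffD1, OF _ _ _ assms])
    fix p :: "nat \<times> nat" assume "p \<in> UNIV - range ?h"
    then have "fst p = 0" by (cases p; cases "fst p") (auto simp: image_iff)
    then show "cf a (fst p) (snd p) * real (fst p) * (y$1 ^ (fst p - 1) * y$2 ^ snd p) = 0" by simp
  qed auto
  then have "((\<lambda>p. cf a (fst (?h p)) (snd (?h p)) * real (fst (?h p)) * (y$1 ^ (fst (?h p) - 1) * y$2 ^ snd (?h p))) has_sum S) UNIV"
    by (subst (asm) has_sum_reindex) (auto simp: inj_def o_def)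
  then show ?thesis by (simp add: ac_simps)
qed

lemma dv_has_sum:
  assumes "((\<lambda>p. cf a (fst p) (snd p) * real (snd p) * (y$1 ^ fst p * y$2 ^ (snd p - 1))) has_sum S) UNIV"
  shows "((\<lambda>p. cf (dv a) (fst p) (snd p) * mnm y p) has_sum S) UNIV"
proof -
  let ?h = "\<lambda>p::nat \<times> nat. (fst p, Suc (snd p))"
  have "((\<lambda>p. cf a (fst p) (snd p) * real (snd p) * (y$1 ^ fst p * y$2 ^ (snd p - 1))) has_sum S) (range ?h)"
  proof (rule has_sum_cong_neutral[THEN iffD1, OF _ _ _ assms])
    fix p :: "nat \<times> nat" assume "p \<in> UNIV - range ?h"
    then have "snd p = 0" by (cases p; cases "snd p") (auto simp: image_iff)
    then show "cf a (fst p) (snd p) * real (snd p) * (y$1 ^ fst p * y$2 ^ (snd p - 1)) = 0" by simp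
  qed auto
  then have "((\<lambda>p. cf a (fst (?h p)) (snd (?h p)) * real (snd (?h p)) * (y$1 ^ fst (?h p) * y$2 ^ (snd (?h p) - 1))) has_sum S) UNIV"
    by (subst (asm) has_sum_reindex) (auto simp: inj_def o_def)
  then show ?thesis by (simp add: ac_simps)
qed

text \<open>
  A change of centre is the substitution of \<open>y + x\<close>. Reading off the first order coefficients term by term
  shows that they are the values at \<open>y\<close> of the formally differentiated series.
\<close>

lemma fexp_shift:
  assumes "fexp \<phi> a"
  obtains r where "r > 0" "\<And>y. norm y < r \<Longrightarrow> \<exists>c. fexp (\<lambda>x. \<phi> (y + x)) c \<and>
     ((\<lambda>p. cf (du a) (fst p) (snd p) * mnm y p) has_sum cf c 1 0) UNIV \<and>
     ((\<lambda>p. cf (dv a) (fst p) (snd p) * mnm y p) has_sum cf c 0 1) UNIV"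
proof -
  obtain s b where s: "s > 0" and sb: "ser b = scl s s a"
    and b: "\<And>x. x \<in> unit_diamond \<Longrightarrow> \<phi> (s *\<^sub>R x) = ev b x"
    using fexpE[OF assms] by blast
  have "\<exists>c. fexp (\<lambda>x. \<phi> (y + x)) c \<and>
     ((\<lambda>p. cf (du a) (fst p) (snd p) * mnm y p) has_sum cf c 1 0) UNIV \<and>
     ((\<lambda>p. cf (dv a) (fst p) (snd p) * mnm y p) has_sum cf c 0 1) UNIV" if y: "norm y < s / 4" for y
  proof -
    \<comment> \<open>\<open>\<phi> (y + s/4 x)\<close> is the rescaled function at \<open>(y\<^sub>1/s + x\<^sub>1/4, y\<^sub>2/s + x\<^sub>2/4)\<close>; the coordinates
      of this point, as series in \<open>x\<close>, have norm at most one half\<close>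
    define z1 where "z1 = of_real (y$1 / s) + (1/4) *\<^sub>R wmonom 1 0"
    define z2 where "z2 = of_real (y$2 / s) + (1/4) *\<^sub>R wmonom 0 1"
    have ys: "\<bar>y$1 / s\<bar> \<le> 1/4" "\<bar>y$2 / s\<bar> \<le> 1/4"
      using y s component_le_norm_cart[of y 1] component_le_norm_cart[of y 2] by (auto simp: divide_simps)
    have "norm z1 \<le> \<bar>y$1 / s\<bar> + 1/4 * norm (wmonom 1 0)" "norm z2 \<le> \<bar>y$2 / s\<bar> + 1/4 * norm (wmonom 0 1)"
      unfolding z1_def z2_def by (rule order_trans[OF norm_triangle_ineq], simp del: of_real_divide)+
    then have n: "norm z1 \<le> 1/2" "norm z2 \<le> 1/2"
      using ys norm_wmonom[of 1 0] norm_wmonom[of 0 1] by linarith+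
    have w: "wcf 0 0 z1 = y$1 / s" "wcf 1 0 z1 = 1/4" "wcf 0 1 z1 = 0"
      "wcf 0 0 z2 = y$2 / s" "wcf 1 0 z2 = 0" "wcf 0 1 z2 = 1/4"
      by (simp_all add: z1_def z2_def wcf_linear of_real_def wcf_one wcf_wmonom)
    have wb: "wcf i j b = s ^ i * s ^ j * cf a i j" for i j
      by (simp add: wcf_def sb)
    define d where "d = wsubst b z1 z2"
    define c where "c = scl (4/s) (4/s) (ser d)"
    have "fexp (\<lambda>x. \<phi> (y + x)) c"
    proof (rule fexpI[of "s/4"])
      show "ser d = scl (s/4) (s/4) c" using s by (simp add: c_def scl_scl)
      fix x assume x: "x \<in> unit_diamond"
      have e: "ev z1 x = y$1 / s + x$1 / 4" "ev z2 x = y$2 / s + x$2 / 4"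
        using x by (simp_all add: z1_def z2_def linear_add[OF bounded_linear.linear[OF bounded_linear_ev[OF x]]]
          linear_cmul[OF bounded_linear.linear[OF bounded_linear_ev[OF x]]] ev_of_real ev_wmonom del: of_real_divide)
      have "\<bar>ev z1 x\<bar> \<le> 1/2" "\<bar>ev z2 x\<bar> \<le> 1/2"
        using abs_ev_le[OF x] n order_trans by blast+
      then have D: "vector [ev z1 x, ev z2 x] \<in> unit_diamond" by (simp add: unit_diamond_def)
      have "y + (s/4) *\<^sub>R x = s *\<^sub>R vector [ev z1 x, ev z2 x]"
        using s by (simp add: vec_eq_iff forall_2 e field_simps)
      then show "\<phi> (y + (s/4) *\<^sub>R x) = ev d x"
        by (simp add: b[OF D] d_def ev_wsubst[OF n x])
    qed (use s in simp)
    moreover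
    have "((\<lambda>p. (4/s) * wcf 1 0 (wcf (fst p) (snd p) b *\<^sub>R (z1 ^ fst p * z2 ^ snd p))) has_sum (4/s) * wcf 1 0 d) UNIV"
      unfolding d_def
      by (intro has_sum_cmult_right has_sum_bounded_linear[OF bounded_linear_wcf wsubst_has_sum[OF n]])
    then have "((\<lambda>p. cf a (fst p) (snd p) * real (fst p) * (y$1 ^ (fst p - 1) * y$2 ^ snd p)) has_sum (4/s) * wcf 1 0 d) UNIV"
    proof (rule has_sum_cong[THEN iffD1, rotated])
      fix p :: "nat \<times> nat"
      show "(4/s) * wcf 1 0 (wcf (fst p) (snd p) b *\<^sub>R (z1 ^ fst p * z2 ^ snd p))
        = cf a (fst p) (snd p) * real (fst p) * (y$1 ^ (fst p - 1) * y$2 ^ snd p)"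
        unfolding wcf_linear wcf_10_mult wcf_power w wb
        using s by (cases "fst p") (simp_all add: power_divide)
    qed
    then have "((\<lambda>p. cf (du a) (fst p) (snd p) * mnm y p) has_sum cf c 1 0) UNIV"
      by (intro du_has_sum) (simp add: c_def wcf_def)
    moreover
    have "((\<lambda>p. (4/s) * wcf 0 1 (wcf (fst p) (snd p) b *\<^sub>R (z1 ^ fst p * z2 ^ snd p))) has_sum (4/s) * wcf 0 1 d) UNIV"
      unfolding d_def
      by (intro has_sum_cmult_right has_sum_bounded_linear[OF bounded_linear_wcf wsubst_has_sum[OF n]])
    then have "((\<lambda>p. cf a (fst p) (snd p) * real (snd p) * (y$1 ^ fst p * y$2 ^ (snd p - 1))) has_sum (4/s) * wcf 0 1 d) UNIV"
    proof (rule has_sum_cong[THEN iffD1, rotated])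
      fix p :: "nat \<times> nat"
      show "(4/s) * wcf 0 1 (wcf (fst p) (snd p) b *\<^sub>R (z1 ^ fst p * z2 ^ snd p))
        = cf a (fst p) (snd p) * real (snd p) * (y$1 ^ fst p * y$2 ^ (snd p - 1))"
        unfolding wcf_linear wcf_01_mult wcf_power w wb
        using s by (cases "snd p") (simp_all add: power_divide)
    qed
    then have "((\<lambda>p. cf (dv a) (fst p) (snd p) * mnm y p) has_sum cf c 0 1) UNIV"
      by (intro dv_has_sum) (simp add: c_def wcf_def)
    ultimately show ?thesis by blast
  qed
  with s show ?thesis by (intro that[of "s/4"]) auto
qed

text \<open>
  All terms of degree at least two are together bounded by a multiple of the square of the norm.
\<close>

lemma fexp_has_derivative_0:
  assumes "fexp \<phi> c"
  shows "(\<phi> has_derivative (\<lambda>v. cf c 1 0 * v$1 + cf c 0 1 * v$2)) (at 0)"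
proof -
  obtain s where s: "s > 0" "\<And>x. norm x < s \<Longrightarrow> ((\<lambda>p. cf c (fst p) (snd p) * mnm x p) has_sum \<phi> x) UNIV"
    using assms by (auto simp: fexp_def)
  define K where "K = infsum (\<lambda>p. \<bar>cf c (fst p) (snd p)\<bar> * (s/4) ^ (fst p + snd p)) UNIV"
  let ?z = "vector [s/4, s/4] :: real^2"
  have "norm ?z < s" using norm_le_l1_2[of ?z] s by simp
  from has_sum_imp_summable[OF s(2)[OF this]]
  have sm: "(\<lambda>p. \<bar>cf c (fst p) (snd p)\<bar> * (s/4) ^ (fst p + snd p)) summable_on UNIV"
    using s by (subst (asm) summable_on_iff_abs_summable_on_real) (simp add: abs_mult power_add)
  have quad: "\<bar>\<phi> x - (cf c 0 0 + (cf c 1 0 * x$1 + cf c 0 1 * x$2))\<bar> \<le> K * (4 / s)\<^sup>2 * (norm x)\<^sup>2"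
    if x: "norm x < s / 4" for x
  proof -
    define q where "q = 4 / s * norm x"
    have q: "0 \<le> q" "q \<le> 1" using x s by (auto simp: q_def divide_simps)
    let ?K = "{(0,0),(1,0),(0,1)} :: (nat \<times> nat) set"
    let ?f = "\<lambda>p. cf c (fst p) (snd p) * mnm x p"
    have h: "(?f has_sum \<phi> x) UNIV" using s(2)[of x] x s by simp
    have "(?f has_sum (\<Sum>p\<in>?K. ?f p)) ?K" by (rule has_sum_finite) simp
    from has_sum_Diff[OF h this] have h2: "(?f has_sum (\<phi> x - (\<Sum>p\<in>?K. ?f p))) (UNIV - ?K)" by simp
    have sm2: "(\<lambda>p. \<bar>cf c (fst p) (snd p)\<bar> * (s/4) ^ (fst p + snd p) * q\<^sup>2) summable_on (UNIV - ?K)"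
      by (intro summable_on_cmult_left summable_on_subset_banach[OF sm]) simp
    have bound: "norm (?f p) \<le> \<bar>cf c (fst p) (snd p)\<bar> * (s/4) ^ (fst p + snd p) * q\<^sup>2" if "p \<in> UNIV - ?K" for p
    proof -
      have "i + j < 2 \<Longrightarrow> (i, j) \<in> ?K" for i j :: nat
        using less_2_cases[of i] less_2_cases[of j] by auto
      then have "fst p + snd p \<ge> 2" using that by (cases p) (auto simp: not_less[symmetric])
      then have qq: "q ^ (fst p + snd p) \<le> q\<^sup>2" using q by (intro power_decreasing) auto
      have "\<bar>mnm x p\<bar> \<le> norm x ^ fst p * norm x ^ snd p"
        unfolding abs_mult power_abs by (intro mult_mono power_mono component_le_norm_cart) auto
      also have "\<dots> = (s/4) ^ (fst p + snd p) * q ^ (fst p + snd p)"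
        using s by (simp add: q_def power_mult_distrib[symmetric] power_add[symmetric])
      also have "\<dots> \<le> (s/4) ^ (fst p + snd p) * q\<^sup>2"
        using qq s by (intro mult_left_mono) auto
      finally show ?thesis by (simp only: real_norm_def abs_mult[of "cf c (fst p) (snd p)"] mult.assoc) (rule mult_left_mono, auto)
    qed
    have "(\<lambda>p. norm (?f p)) summable_on (UNIV - ?K)"
      by (rule Infinite_Sum.abs_summable_on_comparison_test'[OF sm2 bound])
    from norm_has_sum_bound[OF has_sum_infsum[OF this] h2]
    have "\<bar>\<phi> x - (\<Sum>p\<in>?K. ?f p)\<bar> \<le> infsum (\<lambda>p. norm (?f p)) (UNIV - ?K)" by simp
    also have "\<dots> \<le> infsum (\<lambda>p. \<bar>cf c (fst p) (snd p)\<bar> * (s/4) ^ (fst p + snd p) * q\<^sup>2) (UNIV - ?K)"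
      by (rule infsum_mono[OF \<open>(\<lambda>p. norm (?f p)) summable_on (UNIV - ?K)\<close> sm2 bound])
    also have "\<dots> \<le> infsum (\<lambda>p. \<bar>cf c (fst p) (snd p)\<bar> * (s/4) ^ (fst p + snd p) * q\<^sup>2) UNIV"
      using s by (intro infsum_mono2 sm2 summable_on_cmult_left sm) auto
    also have "\<dots> = K * q\<^sup>2" by (simp add: K_def infsum_cmult_left')
    finally have "\<bar>\<phi> x - (\<Sum>p\<in>?K. ?f p)\<bar> \<le> K * (4 / s)\<^sup>2 * (norm x)\<^sup>2"
      unfolding q_def power_mult_distrib mult.assoc .
    then show ?thesis by simp
  qed
  have p0: "\<phi> 0 = cf c 0 0" by (rule fexp_at_0[OF assms])
  show ?thesis
  proof (rule has_derivativeI_sandwich[where e = "s/4" and H = "\<lambda>y. K * (4 / s)\<^sup>2 * norm y"])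
    show "0 < s/4" using s by simp
    show "bounded_linear (\<lambda>v::real^2. cf c 1 0 * v$1 + cf c 0 1 * v$2)"
      by (intro bounded_linear_add bounded_linear_const_mult bounded_linear_vec_nth)
    show "norm (\<phi> y - \<phi> 0 - (cf c 1 0 * (y - 0)$1 + cf c 0 1 * (y - 0)$2)) / norm (y - 0) \<le> K * (4 / s)\<^sup>2 * norm y"
      if "y \<noteq> 0" "dist y 0 < s/4" for y
      using quad[of y] that by (simp add: p0 divide_le_eq power2_eq_square algebra_simps)
    show "((\<lambda>y::real^2. K * (4 / s)\<^sup>2 * norm y) \<longlongrightarrow> 0) (at 0)"
      by (intro tendsto_mult_right_zero tendsto_norm_zero tendsto_ident_at)
  qed
qed

section \<open>Functions analytic at a point\<close>

text \<open>
  Real analyticity at a point: the translate of the function has a convergent expansion at the origin.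
\<close>

definition ana_at :: "(real^2 \<Rightarrow> real) \<Rightarrow> real^2 \<Rightarrow> bool" where
  "ana_at \<phi> a \<longleftrightarrow> (\<exists>c. fexp (\<lambda>x. \<phi> (a + x)) c)"

definition vana_at :: "(real^2 \<Rightarrow> real^'n) \<Rightarrow> real^2 \<Rightarrow> bool" where
  "vana_at h a \<longleftrightarrow> (\<forall>k. ana_at (\<lambda>x. h x $ k) a)"

abbreviation fd :: "('a::real_normed_vector \<Rightarrow> 'b::real_normed_vector) \<Rightarrow> 'a \<Rightarrow> 'a \<Rightarrow> 'b" where
  "fd h x \<equiv> frechet_derivative h (at x)"

lemma fd_eq: "(h has_derivative h') (at x) \<Longrightarrow> fd h x = h'"
  by (simp add: frechet_derivative_at[symmetric])

lemma fd_works: "h differentiable (at x) \<Longrightarrow> (h has_derivative fd h x) (at x)"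
  by (simp add: frechet_derivative_works)

lemma nhds_shift: "eventually P (nhds a) \<longleftrightarrow> eventually (\<lambda>x. P (a + x)) (nhds (0::'a::real_normed_vector))"
proof
  assume "eventually P (nhds a)"
  then obtain d where "d > 0" "\<And>x. dist x a < d \<Longrightarrow> P x" by (auto simp: eventually_nhds_metric)
  then show "eventually (\<lambda>x. P (a + x)) (nhds 0)"
    unfolding eventually_nhds_metric by (intro exI[of _ d]) (auto simp: dist_norm)
next
  assume "eventually (\<lambda>x. P (a + x)) (nhds 0)"
  then obtain d where d: "d > 0" "\<And>x. dist x 0 < d \<Longrightarrow> P (a + x)" by (auto simp: eventually_nhds_metric)
  have "P x" if "dist x a < d" for x using d(2)[of "x - a"] that by (simp add: dist_norm)
  with d(1) show "eventually P (nhds a)" unfolding eventually_nhds_metric by blast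
qed

lemma eventually_nhds_nhds: "eventually P (nhds (a::'a::metric_space)) \<Longrightarrow> eventually (\<lambda>y. eventually P (nhds y)) (nhds a)"
  by (simp add: eventually_eventually)

lemma has_derivative_shift:
  fixes \<phi> :: "'a::real_normed_vector \<Rightarrow> 'b::real_normed_vector"
  shows "((\<lambda>x. \<phi> (y + x)) has_derivative f') (at x) \<longleftrightarrow> (\<phi> has_derivative f') (at (y + x))"
proof
  assume *: "((\<lambda>x. \<phi> (y + x)) has_derivative f') (at x)"
  have "((\<lambda>z. z - y) has_derivative (\<lambda>z. z)) (at (y + x))"
    by (auto intro!: derivative_eq_intros)
  from has_derivative_compose[OF this, of "\<lambda>x. \<phi> (y + x)" f'] *
  show "(\<phi> has_derivative f') (at (y + x))" by simp
next
  assume *: "(\<phi> has_derivative f') (at (y + x))"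
  have "((\<lambda>z. y + z) has_derivative (\<lambda>z. z)) (at x)"
    by (auto intro!: derivative_eq_intros)
  from has_derivative_compose[OF this *] show "((\<lambda>x. \<phi> (y + x)) has_derivative f') (at x)" .
qed

lemma fd_shift: "fd (\<lambda>x. \<phi> (y + x)) x = fd \<phi> (y + x)"
  unfolding frechet_derivative_def has_derivative_shift ..

lemma has_derivative_cong_nhds:
  assumes "\<forall>\<^sub>F y in nhds x. f y = g y"
  shows "(f has_derivative F) (at x) \<longleftrightarrow> (g has_derivative F) (at x)"
proof -
  have *: "(g has_derivative F) (at x)" if "(f has_derivative F) (at x)" "\<forall>\<^sub>F y in nhds x. f y = g y" for f g
    by (rule has_derivative_transform_eventually[OF that(1)])
       (use that(2) eventually_nhds_x_imp_x[OF that(2)] in \<open>auto simp: eventually_nhds_conv_at\<close>)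
  show ?thesis using *[of f g] *[of g f] assms by (auto simp: eq_commute)
qed

lemma fd_cong: "\<forall>\<^sub>F y in nhds x. f y = g y \<Longrightarrow> fd f x = fd g x"
  by (simp add: frechet_derivative_def has_derivative_cong_nhds)

lemma differentiable_cong:
  "\<forall>\<^sub>F y in nhds x. f y = g y \<Longrightarrow> f differentiable (at x) \<Longrightarrow> g differentiable (at x)"
  unfolding differentiable_def using has_derivative_cong_nhds by blast

lemma fexp_near:
  assumes "fexp \<phi> a"
  shows "\<forall>\<^sub>F y in nhds 0. \<exists>c. fexp (\<lambda>x. \<phi> (y + x)) c \<and>
     (\<phi> has_derivative (\<lambda>v. cf c 1 0 * v$1 + cf c 0 1 * v$2)) (at y) \<and>
     ((\<lambda>p. cf (du a) (fst p) (snd p) * mnm y p) has_sum cf c 1 0) UNIV \<and>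
     ((\<lambda>p. cf (dv a) (fst p) (snd p) * mnm y p) has_sum cf c 0 1) UNIV"
proof (rule fexp_shift[OF assms])
  fix r :: real assume r: "r > 0" and *: "\<And>y. norm y < r \<Longrightarrow> \<exists>c. fexp (\<lambda>x. \<phi> (y + x)) c \<and>
     ((\<lambda>p. cf (du a) (fst p) (snd p) * mnm y p) has_sum cf c 1 0) UNIV \<and>
     ((\<lambda>p. cf (dv a) (fst p) (snd p) * mnm y p) has_sum cf c 0 1) UNIV"
  have d: "(\<phi> has_derivative (\<lambda>v. cf c 1 0 * v$1 + cf c 0 1 * v$2)) (at y)" if "fexp (\<lambda>x. \<phi> (y + x)) c" for y c
    using fexp_has_derivative_0[OF that] has_derivative_shift[of \<phi> y _ 0] by simp
  have "\<exists>c. fexp (\<lambda>x. \<phi> (y + x)) c \<and>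
     (\<phi> has_derivative (\<lambda>v. cf c 1 0 * v$1 + cf c 0 1 * v$2)) (at y) \<and>
     ((\<lambda>p. cf (du a) (fst p) (snd p) * mnm y p) has_sum cf c 1 0) UNIV \<and>
     ((\<lambda>p. cf (dv a) (fst p) (snd p) * mnm y p) has_sum cf c 0 1) UNIV" if "dist y 0 < r" for y
  proof -
    have "norm y < r" using that by simp
    from *[OF this] obtain c where "fexp (\<lambda>x. \<phi> (y + x)) c"
      "((\<lambda>p. cf (du a) (fst p) (snd p) * mnm y p) has_sum cf c 1 0) UNIV"
      "((\<lambda>p. cf (dv a) (fst p) (snd p) * mnm y p) has_sum cf c 0 1) UNIV" by blast
    with d[OF this(1)] show ?thesis by blast
  qed
  then show ?thesis unfolding eventually_nhds_metric using r by blast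
qed

lemma partial_eq:
  assumes "(\<phi> has_derivative (\<lambda>v. p * v$1 + q * v$2)) (at y)"
  shows "partial 1 \<phi> y = p" "partial 2 \<phi> y = q"
  unfolding partial_def fd_eq[OF assms] by (simp_all add: axis_def)

text \<open>
  The derivative at a nearby point is a first order coefficient of the expansion there, which is the sum of
  the formally differentiated series.
\<close>

lemma fexp_partial:
  assumes "fexp \<phi> a"
  shows "fexp (partial 1 \<phi>) (du a)" "fexp (partial 2 \<phi>) (dv a)"
proof -
  obtain d where d: "d > 0" "\<And>y. norm y < d \<Longrightarrow> \<exists>c. fexp (\<lambda>x. \<phi> (y + x)) c \<and>
     (\<phi> has_derivative (\<lambda>v. cf c 1 0 * v$1 + cf c 0 1 * v$2)) (at y) \<and>
     ((\<lambda>p. cf (du a) (fst p) (snd p) * mnm y p) has_sum cf c 1 0) UNIV \<and>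
     ((\<lambda>p. cf (dv a) (fst p) (snd p) * mnm y p) has_sum cf c 0 1) UNIV"
    using fexp_near[OF assms] by (auto simp: eventually_nhds_metric)
  have "((\<lambda>p. cf (du a) (fst p) (snd p) * mnm y p) has_sum partial 1 \<phi> y) UNIV \<and>
        ((\<lambda>p. cf (dv a) (fst p) (snd p) * mnm y p) has_sum partial 2 \<phi> y) UNIV" if "norm y < d" for y
    using d(2)[OF that] by (auto simp: partial_eq simp del: One_nat_def)
  with d(1) show "fexp (partial 1 \<phi>) (du a)" "fexp (partial 2 \<phi>) (dv a)"
    unfolding fexp_def by blast+
qed

lemma ana_at_cong:
  assumes "ana_at \<phi> a" "\<forall>\<^sub>F x in nhds a. \<phi> x = \<psi> x"
  shows "ana_at \<psi> a"
proof -
  obtain c where "fexp (\<lambda>x. \<phi> (a + x)) c" using assms(1) by (auto simp: ana_at_def)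
  from fexp_cong[OF this assms(2)[unfolded nhds_shift[of _ a]]] show ?thesis
    by (auto simp: ana_at_def)
qed

lemma ana_at_near: "ana_at \<phi> a \<Longrightarrow> \<forall>\<^sub>F y in nhds a. ana_at \<phi> y"
proof -
  assume "ana_at \<phi> a"
  then obtain c where "fexp (\<lambda>x. \<phi> (a + x)) c" by (auto simp: ana_at_def)
  from fexp_near[OF this] show ?thesis
    unfolding nhds_shift[of _ a] ana_at_def by (rule eventually_mono) (auto simp: add.assoc)
qed

lemma ana_at_differentiable: "ana_at \<phi> a \<Longrightarrow> \<phi> differentiable (at a)"
  using fexp_has_derivative_0 has_derivative_shift[of \<phi> a _ 0]
  unfolding ana_at_def differentiable_def by fastforce

lemma ana_at_partial:
  assumes "ana_at \<phi> a"
  shows "ana_at (partial i \<phi>) a"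
proof -
  obtain c where c: "fexp (\<lambda>x. \<phi> (a + x)) c" using assms by (auto simp: ana_at_def)
  have e: "partial i (\<lambda>x. \<phi> (a + x)) = (\<lambda>x. partial i \<phi> (a + x))"
    by (simp add: fun_eq_iff partial_def fd_shift)
  have "i = 1 \<or> i = 2" by (rule exhaust_2)
  then show ?thesis
    using fexp_partial[OF c] e unfolding ana_at_def by metis
qed

lemma ana_at_const: "ana_at (\<lambda>x. c) a"
  unfolding ana_at_def using fexp_cst by blast

lemma ana_at_coord: "ana_at (\<lambda>x. x $ i) a"
proof -
  have "fexp (\<lambda>x. (a + x) $ 1) (cst (a$1) + monom_ser 1 0)" "fexp (\<lambda>x. (a + x) $ 2) (cst (a$2) + monom_ser 0 1)"
    using fexp_add[OF fexp_cst fexp_monom[of 1 0]] fexp_add[OF fexp_cst fexp_monom[of 0 1]] by simp_all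
  then show ?thesis using exhaust_2[of i] unfolding ana_at_def by blast
qed

lemma ana_at_add: "ana_at \<phi> a \<Longrightarrow> ana_at \<psi> a \<Longrightarrow> ana_at (\<lambda>x. \<phi> x + \<psi> x) a"
  and ana_at_diff: "ana_at \<phi> a \<Longrightarrow> ana_at \<psi> a \<Longrightarrow> ana_at (\<lambda>x. \<phi> x - \<psi> x) a"
  and ana_at_mult: "ana_at \<phi> a \<Longrightarrow> ana_at \<psi> a \<Longrightarrow> ana_at (\<lambda>x. \<phi> x * \<psi> x) a"
  unfolding ana_at_def using fexp_add fexp_diff fexp_mult by blast+

lemma ana_at_power: "ana_at \<phi> a \<Longrightarrow> ana_at (\<lambda>x. \<phi> x ^ n) a"
  by (induction n) (simp_all add: ana_at_const ana_at_mult)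

lemma ana_at_compose:
  assumes "ana_at \<phi> (\<theta> a)" "vana_at \<theta> a"
  shows "ana_at (\<lambda>x. \<phi> (\<theta> x)) a"
proof -
  obtain A where A: "fexp (\<lambda>x. \<phi> (\<theta> a + x)) A" using assms(1) by (auto simp: ana_at_def)
  have "\<exists>b. fexp (\<lambda>x. \<theta> (a + x) $ k - \<theta> a $ k) b \<and> cf b 0 0 = 0" for k
  proof -
    obtain c where c: "fexp (\<lambda>x. \<theta> (a + x) $ k) c"
      using assms(2) by (auto simp: ana_at_def vana_at_def)
    have "fexp (\<lambda>x. \<theta> (a + x) $ k - \<theta> a $ k) (c - cst (\<theta> a $ k))"
      by (intro fexp_diff fexp_cst c)
    with fexp_at_0[OF this] show ?thesis by auto
  qed
  then obtain b1 b2 where b: "fexp (\<lambda>x. \<theta> (a + x) $ 1 - \<theta> a $ 1) b1" "cf b1 0 0 = 0"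
    "fexp (\<lambda>x. \<theta> (a + x) $ 2 - \<theta> a $ 2) b2" "cf b2 0 0 = 0" by metis
  have e: "\<theta> a + vector [\<theta> (a + x) $ 1 - \<theta> a $ 1, \<theta> (a + x) $ 2 - \<theta> a $ 2] = \<theta> (a + x)" for x
    by (simp add: vec_eq_iff forall_2)
  show ?thesis
    using fexp_subst[OF A b(1,3,2,4)] unfolding ana_at_def e .
qed

section \<open>Vector valued analytic maps\<close>

lemma has_derivative_vec_iff:
  fixes h :: "'a::real_normed_vector \<Rightarrow> real^'n"
  shows "(h has_derivative h') (at x) \<longleftrightarrow> (\<forall>k. ((\<lambda>y. h y $ k) has_derivative (\<lambda>v. h' v $ k)) (at x))"
  unfolding has_derivative_componentwise_within[of h] by (auto simp: Basis_vec_def inner_axis)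

lemma differentiable_vec_iff:
  fixes h :: "'a::real_normed_vector \<Rightarrow> real^'n"
  shows "h differentiable (at x) \<longleftrightarrow> (\<forall>k. (\<lambda>y. h y $ k) differentiable (at x))"
proof
  assume "\<forall>k. (\<lambda>y. h y $ k) differentiable (at x)"
  then obtain D where D: "\<And>k. ((\<lambda>y. h y $ k) has_derivative D k) (at x)"
    unfolding differentiable_def by metis
  have "(h has_derivative (\<lambda>v. \<chi> k. D k v)) (at x)"
    unfolding has_derivative_vec_iff using D by simp
  then show "h differentiable (at x)" by (auto simp: differentiable_def)
qed (auto simp: differentiable_def has_derivative_vec_iff)

lemma vana_at_differentiable: "vana_at h a \<Longrightarrow> h differentiable (at a)"
  unfolding differentiable_vec_iff vana_at_def by (simp add: ana_at_differentiable)

lemma vana_at_near: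
  fixes h :: "real^2 \<Rightarrow> real^'n"
  assumes "vana_at h a"
  shows "\<forall>\<^sub>F y in nhds a. vana_at h y"
  unfolding vana_at_def
proof (rule eventually_all_finite)
  show "\<forall>\<^sub>F y in nhds a. ana_at (\<lambda>x. h x $ k) y" for k
    by (rule ana_at_near) (use assms in \<open>simp add: vana_at_def\<close>)
qed

lemma fd_nth:
  fixes h :: "'a::real_normed_vector \<Rightarrow> real^'n"
  assumes "h differentiable (at x)"
  shows "fd h x v $ k = fd (\<lambda>y. h y $ k) x v"
proof -
  have "((\<lambda>y. h y $ k) has_derivative (\<lambda>v. fd h x v $ k)) (at x)"
    using fd_works[OF assms] unfolding has_derivative_vec_iff[of h] by simp
  from fd_eq[OF this] show ?thesis by simp
qed

lemma linear_expand_2: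
  fixes L :: "real^2 \<Rightarrow> 'b::real_vector"
  assumes "linear L"
  shows "L v = v$1 *\<^sub>R L (axis 1 1) + v$2 *\<^sub>R L (axis 2 1)"
proof -
  have "v = v$1 *\<^sub>R axis 1 1 + v$2 *\<^sub>R axis 2 1" by (simp add: vec_eq_iff forall_2 axis_def)
  then have "L v = L (v$1 *\<^sub>R axis 1 1 + v$2 *\<^sub>R axis 2 1)" by simp
  then show ?thesis by (simp only: linear_add[OF assms] linear_cmul[OF assms])
qed

lemma linear_fd: "h differentiable (at x) \<Longrightarrow> linear (fd h x)"
  by (simp add: linear_frechet_derivative)

lemma fd_partial:
  fixes \<phi> :: "real^2 \<Rightarrow> real"
  assumes "\<phi> differentiable (at x)"
  shows "fd \<phi> x v = v$1 * partial 1 \<phi> x + v$2 * partial 2 \<phi> x"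
  using linear_expand_2[OF linear_fd[OF assms], of v] by (simp add: partial_def)

lemma vana_at_cong:
  assumes "vana_at h a" "\<forall>\<^sub>F x in nhds a. h x = g x"
  shows "vana_at g a"
  unfolding vana_at_def
proof
  fix k
  have "ana_at (\<lambda>x. h x $ k) a" using assms(1) by (simp add: vana_at_def)
  then show "ana_at (\<lambda>x. g x $ k) a"
    by (rule ana_at_cong) (use assms(2) in \<open>auto elim: eventually_mono\<close>)
qed

lemma vana_at_fd:
  fixes h :: "real^2 \<Rightarrow> real^'n"
  assumes "vana_at h a" "vana_at \<eta> a"
  shows "vana_at (\<lambda>y. fd h y (\<eta> y)) a"
  unfolding vana_at_def
proof
  fix k
  have "ana_at (\<lambda>y. \<eta> y $ 1 * partial 1 (\<lambda>y. h y $ k) y + \<eta> y $ 2 * partial 2 (\<lambda>y. h y $ k) y) a"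
    using assms by (intro ana_at_add ana_at_mult ana_at_partial) (auto simp: vana_at_def)
  then show "ana_at (\<lambda>y. fd h y (\<eta> y) $ k) a"
  proof (rule ana_at_cong)
    show "\<forall>\<^sub>F y in nhds a. \<eta> y $ 1 * partial 1 (\<lambda>y. h y $ k) y + \<eta> y $ 2 * partial 2 (\<lambda>y. h y $ k) y = fd h y (\<eta> y) $ k"
      using vana_at_near[OF assms(1)]
    proof (rule eventually_mono)
      fix y assume y: "vana_at h y"
      then have "(\<lambda>y. h y $ k) differentiable (at y)"
        by (auto simp: vana_at_def intro: ana_at_differentiable)
      from fd_partial[OF this] show "\<eta> y $ 1 * partial 1 (\<lambda>y. h y $ k) y + \<eta> y $ 2 * partial 2 (\<lambda>y. h y $ k) y = fd h y (\<eta> y) $ k"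
        by (simp add: fd_nth[OF vana_at_differentiable[OF y]])
    qed
  qed
qed

lemma vana_at_const: "vana_at (\<lambda>x. c) a"
  by (simp add: vana_at_def ana_at_const)

lemma vana_at_add: "vana_at f a \<Longrightarrow> vana_at g a \<Longrightarrow> vana_at (\<lambda>x. f x + g x) a"
  and vana_at_diff: "vana_at f a \<Longrightarrow> vana_at g a \<Longrightarrow> vana_at (\<lambda>x. f x - g x) a"
  and vana_at_scaleR: "ana_at \<phi> a \<Longrightarrow> vana_at g a \<Longrightarrow> vana_at (\<lambda>x. \<phi> x *\<^sub>R g x) a"
  by (simp_all add: vana_at_def ana_at_add ana_at_diff ana_at_mult)

lemma vana_at_compose:
  assumes "vana_at h (\<theta> a)" "vana_at \<theta> a"
  shows "vana_at (\<lambda>x. h (\<theta> x)) a"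
  using assms ana_at_compose[of _ \<theta> a] unfolding vana_at_def[of h] vana_at_def[of "\<lambda>x. h (\<theta> x)"] by blast

lemma fd_compose:
  assumes "h differentiable (at (\<theta> a))" "\<theta> differentiable (at a)"
  shows "fd (\<lambda>x. h (\<theta> x)) a v = fd h (\<theta> a) (fd \<theta> a v)"
  using fd_eq[OF has_derivative_compose[OF fd_works[OF assms(2)] fd_works[OF assms(1)]]] by simp

lemma has_sum_vec:
  fixes f :: "'a \<Rightarrow> real^'n"
  assumes "\<And>k. ((\<lambda>p. f p $ k) has_sum s $ k) A"
  shows "(f has_sum s) A"
  using assms unfolding has_sum_def by (intro vec_tendstoI) simp

lemma ana_at_iff:
  "ana_at \<phi> a \<longleftrightarrow> (\<exists>r>0. \<exists>coef. \<forall>x. dist x a < r \<longrightarrow>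
     ((\<lambda>p. mnm (x - a) p *\<^sub>R coef p) has_sum \<phi> x) UNIV)"
proof
  assume "ana_at \<phi> a"
  then obtain c s where s: "s > 0" "\<And>x. norm x < s \<Longrightarrow> ((\<lambda>p. cf c (fst p) (snd p) * mnm x p) has_sum \<phi> (a + x)) UNIV"
    by (auto simp: ana_at_def fexp_def)
  have "((\<lambda>p. mnm (x - a) p *\<^sub>R cf c (fst p) (snd p)) has_sum \<phi> x) UNIV" if "dist x a < s" for x
    using s(2)[of "x - a"] that by (simp add: dist_norm mult.commute)
  with s(1) show "\<exists>r>0. \<exists>coef. \<forall>x. dist x a < r \<longrightarrow> ((\<lambda>p. mnm (x - a) p *\<^sub>R coef p) has_sum \<phi> x) UNIV"
    by (intro exI[of _ s] conjI exI[of _ "\<lambda>p. cf c (fst p) (snd p)"]) auto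
next
  assume "\<exists>r>0. \<exists>coef. \<forall>x. dist x a < r \<longrightarrow> ((\<lambda>p. mnm (x - a) p *\<^sub>R coef p) has_sum \<phi> x) UNIV"
  then obtain r coef where r: "r > 0" "\<And>x. dist x a < r \<Longrightarrow> ((\<lambda>p. mnm (x - a) p *\<^sub>R coef p) has_sum \<phi> x) UNIV"
    by blast
  have "((\<lambda>p. cf (mk_ser (\<lambda>i j. coef (i, j))) (fst p) (snd p) * mnm x p) has_sum \<phi> (a + x)) UNIV" if "norm x < r" for x
    using r(2)[of "a + x"] that by (simp add: dist_norm mult.commute)
  with r(1) show "ana_at \<phi> a" unfolding ana_at_def fexp_def by blast
qed

lemma real_analytic_on_iff:
  fixes h :: "real^2 \<Rightarrow> real^'n"
  shows "real_analytic_on D h \<longleftrightarrow> (\<forall>a\<in>D. vana_at h a)"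
proof -
  have "(\<exists>r>0. \<exists>coef :: nat \<times> nat \<Rightarrow> real^'n. \<forall>x. dist x a < r \<longrightarrow>
      ((\<lambda>p. mnm (x - a) p *\<^sub>R coef p) has_sum h x) UNIV) \<longleftrightarrow> vana_at h a" (is "?L \<longleftrightarrow> ?R") for a
  proof
    assume ?L
    then obtain r and coef :: "nat \<times> nat \<Rightarrow> real^'n" where r: "r > 0"
      "\<And>x. dist x a < r \<Longrightarrow> ((\<lambda>p. mnm (x - a) p *\<^sub>R coef p) has_sum h x) UNIV" by blast
    have "((\<lambda>p. mnm (x - a) p *\<^sub>R (coef p $ k)) has_sum h x $ k) UNIV" if "dist x a < r" for x k
      using has_sum_bounded_linear[OF bounded_linear_vec_nth r(2)[OF that]] by simp
    then have "ana_at (\<lambda>x. h x $ k) a" for k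
      unfolding ana_at_iff using r(1) by (intro exI[of _ r] conjI exI[of _ "\<lambda>p. coef p $ k"]) auto
    then show ?R unfolding vana_at_def by blast
  next
    assume ?R
    define Q where "Q k r coef \<longleftrightarrow> (\<forall>x. dist x a < r \<longrightarrow>
      ((\<lambda>p. mnm (x - a) p *\<^sub>R (coef p :: real)) has_sum h x $ k) UNIV)" for k r coef
    have "\<forall>k. \<exists>r coef. r > 0 \<and> Q k r coef"
      using \<open>?R\<close> unfolding vana_at_def ana_at_iff Q_def by blast
    then obtain r coef where rQ: "\<And>k. r k > 0" "\<And>k. Q k (r k) (coef k)" by metis
    then have r: "\<And>k. r k > 0"
      "\<And>k x. dist x a < r k \<Longrightarrow> ((\<lambda>p. mnm (x - a) p *\<^sub>R coef k p) has_sum h x $ k) UNIV"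
      by (auto simp: Q_def)
    define m where "m = Min (range r)"
    have m: "m > 0" "\<And>k. m \<le> r k" using r(1) by (auto simp: m_def)
    have "((\<lambda>p. mnm (x - a) p *\<^sub>R (\<chi> k. coef k p)) has_sum h x) UNIV" if "dist x a < m" for x
      using r(2)[OF less_le_trans[OF that m(2)]] by (intro has_sum_vec) simp
    then show ?L using m(1) by (intro exI[of _ m] conjI exI[of _ "\<lambda>p. \<chi> k. coef k p"] allI impI)
  qed
  then show ?thesis
    unfolding real_analytic_on_def split_def prod.collapse vector_minus_component by (rule ball_cong[OF refl])
qed

text \<open>
  Derivatives of analytic maps are analytic, so the recursion that defines differentiability of order \<open>k\<close>
  never leaves this class.
\<close>

lemma vana_at_imp_Ck_on:
  fixes h :: "real^2 \<Rightarrow> real^'n"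
  assumes "\<And>x. x \<in> S \<Longrightarrow> vana_at h x"
  shows "Ck_on k S h"
  using assms
proof (induction k arbitrary: h)
  case 0
  then show ?case
    by (auto intro!: continuous_at_imp_continuous_on differentiable_imp_continuous_within vana_at_differentiable)
next
  case (Suc k)
  then show ?case
    by (auto intro: vana_at_differentiable intro!: Suc.IH vana_at_fd vana_at_const)
qed

section \<open>Two-jets of curves\<close>

definition twice_diff :: "('a::real_normed_vector \<Rightarrow> 'b::real_normed_vector) \<Rightarrow> 'a \<Rightarrow> bool" where
  "twice_diff h x \<longleftrightarrow> (\<forall>\<^sub>F y in nhds x. h differentiable (at y)) \<and> (\<forall>v. (\<lambda>y. fd h y v) differentiable (at x))"

text \<open>
  The Hessian in the form that chain rules along curves produce.
\<close>

definition D2 :: "('a::real_normed_vector \<Rightarrow> 'b::real_normed_vector) \<Rightarrow> 'a \<Rightarrow> 'a \<Rightarrow> 'a \<Rightarrow> 'b" where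
  "D2 h x v w = fd (\<lambda>y. fd h y v) x w"

lemma vana_at_twice_diff:
  fixes h :: "real^2 \<Rightarrow> real^'n"
  assumes "vana_at h a" shows "twice_diff h a"
  unfolding twice_diff_def
  by (intro conjI allI vana_at_differentiable vana_at_fd vana_at_const assms eventually_mono[OF vana_at_near[OF assms]])

lemma ana_at_twice_diff: assumes "ana_at \<phi> a" shows "twice_diff \<phi> a"
  unfolding twice_diff_def
proof (intro conjI allI)
  show ev: "\<forall>\<^sub>F y in nhds a. \<phi> differentiable (at y)"
    by (rule eventually_mono[OF ana_at_near[OF assms]]) (rule ana_at_differentiable)
  fix v :: "real^2"
  have "(\<lambda>y. v$1 * partial 1 \<phi> y + v$2 * partial 2 \<phi> y) differentiable (at a)"
    by (intro ana_at_differentiable ana_at_add ana_at_mult ana_at_const ana_at_partial assms)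
  then show "(\<lambda>y. fd \<phi> y v) differentiable (at a)"
    by (rule differentiable_cong[rotated]) (use ev fd_partial in \<open>auto elim: eventually_mono\<close>)
qed

text \<open>
  The curvatures see a characteristic curve only through its value, velocity and acceleration at
  parameter 0.
\<close>

definition jet2 :: "(real \<Rightarrow> 'b::real_normed_vector) \<Rightarrow> 'b \<Rightarrow> 'b \<Rightarrow> 'b \<Rightarrow> bool" where
  "jet2 c x a b \<longleftrightarrow> c 0 = x \<and> (\<exists>c'. (\<forall>\<^sub>F t in nhds 0. (c has_vector_derivative c' t) (at t)) \<and>
      c' 0 = a \<and> (c' has_vector_derivative b) (at 0))"

lemma has_vector_derivative_cong:
  assumes "\<forall>\<^sub>F s in nhds t. f s = g s"
  shows "(f has_vector_derivative d) (at t) \<longleftrightarrow> (g has_vector_derivative d) (at t)"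
  using assms unfolding has_vector_derivative_def by (rule has_derivative_cong_nhds)

lemma jet2_velocity:
  assumes "jet2 c x a b"
  shows "c 0 = x" "velocity c 0 = a" "velocity (velocity c) 0 = b"
proof -
  obtain c' where c': "\<forall>\<^sub>F t in nhds 0. (c has_vector_derivative c' t) (at t)" "c' 0 = a" "(c' has_vector_derivative b) (at 0)"
    using assms by (auto simp: jet2_def)
  show "c 0 = x" using assms by (simp add: jet2_def)
  have ev: "\<forall>\<^sub>F t in nhds 0. c' t = velocity c t"
    using c'(1) by (rule eventually_mono) (simp add: vector_derivative_at)
  then show "velocity c 0 = a" using eventually_nhds_x_imp_x c'(2) by force
  show "velocity (velocity c) 0 = b"
    using c'(3) has_vector_derivative_cong[OF ev] by (simp add: vector_derivative_at)
qed

lemma jet2_unique: "jet2 c x a b \<Longrightarrow> jet2 c x' a' b' \<Longrightarrow> x = x' \<and> a = a' \<and> b = b'"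
  using jet2_velocity by metis

lemma jet2_cong:
  assumes "jet2 c x a b" "\<forall>\<^sub>F t in nhds 0. c t = d t"
  shows "jet2 d x a b"
proof -
  obtain c' where c': "\<forall>\<^sub>F t in nhds 0. (c has_vector_derivative c' t) (at t)" "c' 0 = a" "(c' has_vector_derivative b) (at 0)"
    using assms by (auto simp: jet2_def)
  have "\<forall>\<^sub>F t in nhds 0. (d has_vector_derivative c' t) (at t)"
    using c'(1) eventually_nhds_nhds[OF assms(2)]
    by eventually_elim (use has_vector_derivative_cong in blast)
  with c' assms eventually_nhds_x_imp_x[OF assms(2)] show ?thesis by (auto simp: jet2_def)
qed

lemma jet2_const: "jet2 (\<lambda>t. k) k 0 0"
  by (auto simp: jet2_def intro!: exI[of _ "\<lambda>t. 0"] derivative_eq_intros)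

lemma jet2_line: "jet2 (\<lambda>t. x + t *\<^sub>R v) x v 0"
proof -
  have "((\<lambda>t. x + t *\<^sub>R v) has_vector_derivative v) (at t)" for t
    by (auto intro!: derivative_eq_intros)
  then show ?thesis by (auto simp: jet2_def intro!: exI[of _ "\<lambda>t. v"] derivative_eq_intros eventuallyI)
qed

lemma smooth_on_velocity:
  assumes "smooth_on {-\<delta><..<\<delta>} c" "\<delta> > 0"
  shows "t \<in> {-\<delta><..<\<delta>} \<Longrightarrow> (c has_vector_derivative velocity c t) (at t)" "velocity c differentiable (at 0)"
proof -
  have 2: "Ck_on (Suc (Suc 0)) {-\<delta><..<\<delta>} c" using assms(1) unfolding smooth_on_def by blast
  have d1: "c differentiable (at t)" if "t \<in> {-\<delta><..<\<delta>}" for t using 2 that by simp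
  have d2: "(\<lambda>x. fd c x v) differentiable (at t)" if "t \<in> {-\<delta><..<\<delta>}" for t v using 2 that by simp
  have n: "\<forall>\<^sub>F t in nhds 0. t \<in> {-\<delta><..<\<delta>}" using assms(2) by (intro eventually_nhds_in_open) auto
  have v: "velocity c t = fd c t 1" if "t \<in> {-\<delta><..<\<delta>}" for t
    using d1[OF that] by (simp add: frechet_derivative_eq_vector_derivative)
  show "t \<in> {-\<delta><..<\<delta>} \<Longrightarrow> (c has_vector_derivative velocity c t) (at t)"
    using d1 by (simp add: vector_derivative_works[symmetric])
  show "velocity c differentiable (at 0)"
    by (rule differentiable_cong[OF _ d2[of 0 1]]) (use n v assms(2) in \<open>auto elim!: eventually_mono\<close>)
qed

lemma jet2_smooth_on:
  assumes "smooth_on {-\<delta><..<\<delta>} c" "\<delta> > 0"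
  shows "jet2 c (c 0) (velocity c 0) (velocity (velocity c) 0)"
proof -
  have n: "\<forall>\<^sub>F t in nhds 0. t \<in> {-\<delta><..<\<delta>}" using assms(2) by (intro eventually_nhds_in_open) auto
  have "(velocity c has_vector_derivative velocity (velocity c) 0) (at 0)"
    using smooth_on_velocity(2)[OF assms] by (simp add: vector_derivative_works[symmetric])
  moreover have "\<forall>\<^sub>F t in nhds 0. (c has_vector_derivative velocity c t) (at t)"
    by (rule eventually_mono[OF n]) (rule smooth_on_velocity(1)[OF assms])
  ultimately show ?thesis unfolding jet2_def by (intro conjI exI[of _ "velocity c"] refl)
qed

lemma eventually_along_curve:
  assumes "\<forall>\<^sub>F y in nhds x. P y" "jet2 c x a b"
  shows "\<forall>\<^sub>F t in nhds 0. P (c t)"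
proof -
  obtain c' where "\<forall>\<^sub>F t in nhds 0. (c has_vector_derivative c' t) (at t)"
    using assms by (auto simp: jet2_def)
  from eventually_nhds_x_imp_x[OF this] have "isCont c 0"
    by (rule has_vector_derivative_continuous)
  then have "(c \<longlongrightarrow> x) (nhds 0)" using assms(2) by (auto simp: jet2_def isCont_def tendsto_nhds_iff)
  then show ?thesis using assms(1) by (auto simp: filterlim_iff)
qed

lemma has_vector_derivative_chain:
  assumes "(c has_vector_derivative d) (at t)" "h differentiable (at (c t))"
  shows "((\<lambda>t. h (c t)) has_vector_derivative fd h (c t) d) (at t)"
  using has_derivative_compose[OF assms(1)[unfolded has_vector_derivative_def] fd_works[OF assms(2)]]
  unfolding has_vector_derivative_def linear_cmul[OF linear_fd[OF assms(2)]] .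

lemma D2_expand:
  fixes h :: "real^2 \<Rightarrow> 'b::real_normed_vector"
  assumes "twice_diff h x"
  shows "D2 h x a = (\<lambda>w. a$1 *\<^sub>R D2 h x (axis 1 1) w + a$2 *\<^sub>R D2 h x (axis 2 1) w)"
proof -
  have hd: "\<forall>\<^sub>F y in nhds x. h differentiable (at y)" and hv: "\<And>v. (\<lambda>y. fd h y v) differentiable (at x)"
    using assms by (auto simp: twice_diff_def)
  have "\<forall>\<^sub>F y in nhds x. fd h y a = a$1 *\<^sub>R fd h y (axis 1 1) + a$2 *\<^sub>R fd h y (axis 2 1)"
    using hd by (rule eventually_mono) (rule linear_expand_2[OF linear_fd])
  then have "D2 h x a = fd (\<lambda>y. a$1 *\<^sub>R fd h y (axis 1 1) + a$2 *\<^sub>R fd h y (axis 2 1)) x"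
    unfolding D2_def[abs_def] by (simp only: fd_cong)
  moreover have "((\<lambda>y. a$1 *\<^sub>R fd h y (axis 1 1) + a$2 *\<^sub>R fd h y (axis 2 1)) has_derivative
      (\<lambda>w. a$1 *\<^sub>R D2 h x (axis 1 1) w + a$2 *\<^sub>R D2 h x (axis 2 1) w)) (at x)"
    unfolding D2_def by (intro has_derivative_add has_derivative_scaleR_right fd_works hv)
  ultimately show ?thesis by (simp only: fd_eq)
qed

lemma linear_D2: "twice_diff h x \<Longrightarrow> linear (D2 h x v)"
  unfolding D2_def[abs_def] twice_diff_def by (simp add: linear_fd)

lemma D2_scale:
  fixes h :: "real^2 \<Rightarrow> 'b::real_normed_vector"
  assumes "twice_diff h x"
  shows "D2 h x (s *\<^sub>R v) (s *\<^sub>R v) = (s * s) *\<^sub>R D2 h x v v"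
  unfolding D2_expand[OF assms, of "s *\<^sub>R v"] D2_expand[OF assms, of v]
  by (simp add: linear_cmul[OF linear_D2[OF assms]] algebra_simps)

text \<open>
  The second derivative of \<open>h \<circ> c\<close> is the Hessian on the velocity plus the differential on the acceleration.
\<close>

lemma jet2_compose:
  fixes h :: "real^2 \<Rightarrow> 'b::real_normed_vector"
  assumes h: "twice_diff h x" and c: "jet2 c x a b"
  shows "jet2 (\<lambda>t. h (c t)) (h x) (fd h x a) (D2 h x a a + fd h x b)"
proof -
  obtain c' where c': "\<forall>\<^sub>F t in nhds 0. (c has_vector_derivative c' t) (at t)" "c' 0 = a"
      "(c' has_vector_derivative b) (at 0)" and c0: "c 0 = x"
    using c by (auto simp: jet2_def)
  have hd: "\<forall>\<^sub>F y in nhds x. h differentiable (at y)" and hv: "\<And>v. (\<lambda>y. fd h y v) differentiable (at x)"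
    using h by (auto simp: twice_diff_def)
  have hdc: "\<forall>\<^sub>F t in nhds 0. h differentiable (at (c t))" by (rule eventually_along_curve[OF hd c])
  have 1: "\<forall>\<^sub>F t in nhds 0. ((\<lambda>t. h (c t)) has_vector_derivative fd h (c t) (c' t)) (at t)"
    using hdc c'(1)
  proof eventually_elim
    fix t assume "h differentiable (at (c t))" "(c has_vector_derivative c' t) (at t)"
    then show "((\<lambda>t. h (c t)) has_vector_derivative fd h (c t) (c' t)) (at t)"
      by (intro has_vector_derivative_chain)
  qed
  have cd: "(c has_vector_derivative a) (at 0)" using eventually_nhds_x_imp_x[OF c'(1)] c'(2) by simp
  have 2: "((\<lambda>t. fd h (c t) v) has_vector_derivative D2 h x v a) (at 0)" for v
    using has_vector_derivative_chain[OF cd, of "\<lambda>y. fd h y v"] hv[of v] by (simp add: c0 D2_def)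
  have k: "((\<lambda>t. c' t $ k) has_vector_derivative b $ k) (at 0)" for k
    by (rule bounded_linear.has_vector_derivative[OF bounded_linear_vec_nth c'(3)])
  let ?F = "\<lambda>t. c' t $ 1 *\<^sub>R fd h (c t) (axis 1 1) + c' t $ 2 *\<^sub>R fd h (c t) (axis 2 1)"
  have "(?F has_vector_derivative
     (c' 0 $ 1 *\<^sub>R D2 h x (axis 1 1) a + b$1 *\<^sub>R fd h (c 0) (axis 1 1))
   + (c' 0 $ 2 *\<^sub>R D2 h x (axis 2 1) a + b$2 *\<^sub>R fd h (c 0) (axis 2 1))) (at 0)"
    by (intro has_vector_derivative_add has_vector_derivative_scaleR 2 k[unfolded has_real_derivative_iff_has_vector_derivative[symmetric]])
  moreover have "\<forall>\<^sub>F t in nhds 0. ?F t = fd h (c t) (c' t)"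
    using hdc by (rule eventually_mono) (rule linear_expand_2[OF linear_fd, symmetric])
  moreover have "D2 h x a a = a$1 *\<^sub>R D2 h x (axis 1 1) a + a$2 *\<^sub>R D2 h x (axis 2 1) a"
    by (simp only: D2_expand[OF h, of a])
  moreover have "fd h x b = b$1 *\<^sub>R fd h x (axis 1 1) + b$2 *\<^sub>R fd h x (axis 2 1)"
    by (rule linear_expand_2[OF linear_fd[OF eventually_nhds_x_imp_x[OF hd]]])
  ultimately have "((\<lambda>t. fd h (c t) (c' t)) has_vector_derivative D2 h x a a + fd h x b) (at 0)"
    using has_vector_derivative_cong[of ?F "\<lambda>t. fd h (c t) (c' t)" 0] by (simp add: c0 c'(2) algebra_simps)
  then show ?thesis unfolding jet2_def
    by (intro conjI exI[of _ "\<lambda>t. fd h (c t) (c' t)"] 1) (simp_all add: c0 c'(2))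
qed

section \<open>Integration operators\<close>

text \<open>
  The primitives that vanish on \<open>v = 0\<close> and on \<open>u = 0\<close>.
\<close>

definition iv :: "real fps fps \<Rightarrow> real fps fps" where
  "iv a = mk_ser (\<lambda>i j. if j = 0 then 0 else cf a i (j - 1) / real j)"

definition iu :: "real fps fps \<Rightarrow> real fps fps" where
  "iu a = mk_ser (\<lambda>i j. if i = 0 then 0 else cf a (i - 1) j / real i)"

lemma cf_iv [simp]: "cf (iv a) i j = (if j = 0 then 0 else cf a i (j - 1) / real j)"
  by (simp add: iv_def)

lemma cf_iu [simp]: "cf (iu a) i j = (if i = 0 then 0 else cf a (i - 1) j / real i)"
  by (simp add: iu_def)

lemma dv_iv [simp]: "dv (iv a) = a" and du_iu [simp]: "du (iu a) = a"
  by (rule ser_eqI; simp)+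

lemma du_iv: "du (iv a) = iv (du a)"
  by (rule ser_eqI) simp

lemma iv_linear: "iv (a + b) = iv a + iv b" "iv (a - b) = iv a - iv b" "iv (cst c * a) = cst c * iv a"
  by (rule ser_eqI; simp add: add_divide_distrib diff_divide_distrib)+

lemma inj_on_pred:
  "inj_on (\<lambda>p::nat \<times> nat. (fst p, snd p - 1)) {p. snd p \<noteq> 0}"
  "inj_on (\<lambda>p::nat \<times> nat. (fst p + 1, snd p - 1)) {p. snd p \<noteq> 0}"
  "inj_on (\<lambda>p::nat \<times> nat. (fst p - 1, snd p)) {p. fst p \<noteq> 0}"
  by (auto simp: inj_def inj_on_def prod_eq_iff gr0_conv_Suc)

lemma wsum_iv:
  assumes "wsum a" shows "wsum (iv a)" "wnorm (iv a) \<le> wnorm a"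
proof -
  have "wterm (iv a) (i, Suc j) \<le> 1 * wterm a (i, j)" for i j
  proof -
    have "wt i (j + 1) = real (j + 1) * wt i j / real (i + j + 1)"
      unfolding wt_Suc_right by simp
    then have "wterm (iv a) (i, Suc j) = \<bar>cf a i j\<bar> * wt i j * (1 / real (i + j + 1))"
      by (simp add: wterm_def abs_mult)
    also have "\<dots> \<le> \<bar>cf a i j\<bar> * wt i j * 1"
      by (intro mult_left_mono) auto
    finally show ?thesis by (simp add: wterm_def)
  qed
  then have "wterm (iv a) p \<le> 1 * wterm a (fst p, snd p - 1)" if "snd p \<noteq> 0" for p
    using that by (cases p; cases "snd p") auto
  note * = wsum_dominated[OF assms _ inj_on_pred(1) this]
  show "wsum (iv a)" "wnorm (iv a) \<le> wnorm a"
    using * by (auto simp: wterm_def)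
qed

text \<open>
  The point of the weights: this operator loses a derivative in \<open>u\<close> and gains an integration in \<open>v\<close>, and it
  maps every monomial to zero or to a multiple of a monomial, of the same norm.
\<close>

lemma wsum_du_iv:
  assumes "wsum a" shows "wsum (du (iv a))" "wnorm (du (iv a)) \<le> wnorm a"
proof -
  have "wterm (du (iv a)) (i, Suc j) = 1 * wterm a (i + 1, j)" for i j
  proof -
    have "real (i + 1) * wt i (j + 1) = real (i + 1) * (real (j + 1) * wt i j / real (i + j + 1))"
      unfolding wt_Suc_right by simp
    also have "\<dots> = real (j + 1) * (real (i + 1) * wt i j / real (i + j + 1))" by simp
    also have "\<dots> = real (j + 1) * wt (i + 1) j" unfolding wt_Suc_left by simp
    finally have "real (i + 1) * wt i (j + 1) = real (j + 1) * wt (i + 1) j" .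
    then have e: "real (i + 1) * wt i (j + 1) / real (j + 1) = wt (i + 1) j" by (simp add: field_simps)
    have "wterm (du (iv a)) (i, Suc j) = \<bar>cf a (i + 1) j\<bar> * (real (i + 1) * wt i (j + 1) / real (j + 1))"
      by (simp add: wterm_def abs_mult)
    then show ?thesis unfolding e by (simp add: wterm_def)
  qed
  then have "wterm (du (iv a)) p \<le> 1 * wterm a (fst p + 1, snd p - 1)" if "snd p \<noteq> 0" for p
    using that by (cases p; cases "snd p") (auto simp del: du_def cf_du)
  note * = wsum_dominated[OF assms _ inj_on_pred(2) this]
  show "wsum (du (iv a))" "wnorm (du (iv a)) \<le> wnorm a"
    using * by (auto simp: wterm_def)
qed

lemma wsum_iu:
  assumes "wsum a" shows "wsum (iu a)"
proof -
  have "wterm (iu a) (Suc i, j) \<le> 1 * wterm a (i, j)" for i j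
  proof -
    have "wt (i + 1) j = real (i + 1) * wt i j / real (i + j + 1)"
      unfolding wt_Suc_left by simp
    then have "wterm (iu a) (Suc i, j) = \<bar>cf a i j\<bar> * wt i j * (1 / real (i + j + 1))"
      by (simp add: wterm_def abs_mult)
    also have "\<dots> \<le> \<bar>cf a i j\<bar> * wt i j * 1"
      by (intro mult_left_mono) auto
    finally show ?thesis by (simp add: wterm_def)
  qed
  then have "wterm (iu a) p \<le> 1 * wterm a (fst p - 1, snd p)" if "fst p \<noteq> 0" for p
    using that by (cases p; cases "fst p") auto
  note * = wsum_dominated[OF assms _ inj_on_pred(3) this]
  show "wsum (iu a)"
    using * by (auto simp: wterm_def)
qed

text \<open>
  Division by \<open>u\<close> of a series without constant term in \<open>u\<close>.
\<close>

definition shiftu :: "real fps fps \<Rightarrow> real fps fps" where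
  "shiftu a = mk_ser (\<lambda>i j. cf a (i + 1) j)"

lemma cf_shiftu [simp]: "cf (shiftu a) i j = cf a (i + 1) j"
  by (simp add: shiftu_def)

lemma conv_iv: "conv a \<Longrightarrow> conv (iv a)" and conv_iu: "conv a \<Longrightarrow> conv (iu a)"
  and conv_shiftu: "conv a \<Longrightarrow> conv (shiftu a)"
proof -
  assume "conv a"
  then obtain s where s: "s > 0" "wsum (scl s s a)" by (auto simp: conv_def)
  have "scl s s (iv a) = cst s * iv (scl s s a)" "scl s s (iu a) = cst s * iu (scl s s a)"
    by (rule ser_eqI; auto simp: gr0_conv_Suc)+
  then show "conv (iv a)" "conv (iu a)"
    unfolding conv_def using s wsum_iv wsum_iu wsum_cst_mult by metis+
  obtain t where t: "t > 0" "wsum (scl t t (du a))"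
    using conv_du[OF \<open>conv a\<close>] by (auto simp: conv_def)
  have "wterm (scl t t (shiftu a)) p \<le> wterm (scl t t (du a)) p" for p
    unfolding wterm_def cf_scl cf_shiftu cf_du abs_mult
    by (intro mult_right_mono mult_left_mono) (auto intro: order_trans[OF _ mult_right_mono[of 1]])
  from wsum_compare(1)[OF wnorm_has_sum[OF t(2)] this] t(1) show "conv (shiftu a)"
    by (auto simp: conv_def)
qed


section \<open>Contractions depending on a small parameter\<close>

text \<open>
  Maps depending on the scale \<open>s\<close> that, on bounded sets and for small \<open>s\<close>, are of size \<open>s ^ p\<close> and have
  Lipschitz constant of size \<open>s ^ q\<close>. These two orders can be computed structurally, which replaces
  estimates for the nonlinear equations below.
\<close>

definition fam :: "nat \<Rightarrow> nat \<Rightarrow> (real \<Rightarrow> 'z::real_normed_vector \<Rightarrow> 'w::real_normed_vector) \<Rightarrow> bool" where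
  "fam p q T \<longleftrightarrow> (\<forall>R. \<exists>C s0. 0 \<le> C \<and> 0 < s0 \<and> s0 \<le> 1 \<and>
     (\<forall>s z z'. 0 < s \<and> s \<le> s0 \<and> norm z \<le> R \<and> norm z' \<le> R \<longrightarrow>
        norm (T s z) \<le> C * s ^ p \<and> norm (T s z - T s z') \<le> C * s ^ q * norm (z - z')))"

lemma famE:
  assumes "fam p q T"
  obtains C s0 where "0 \<le> C" "0 < s0" "s0 \<le> 1"
    "\<And>s z. 0 < s \<Longrightarrow> s \<le> s0 \<Longrightarrow> norm z \<le> R \<Longrightarrow> norm (T s z) \<le> C * s ^ p"
    "\<And>s z z'. 0 < s \<Longrightarrow> s \<le> s0 \<Longrightarrow> norm z \<le> R \<Longrightarrow> norm z' \<le> R \<Longrightarrow> norm (T s z - T s z') \<le> C * s ^ q * norm (z - z')"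
proof -
  obtain C s0 where "0 \<le> C" "0 < s0" "s0 \<le> 1" and *: "\<And>s z z'. 0 < s \<and> s \<le> s0 \<and> norm z \<le> R \<and> norm z' \<le> R \<Longrightarrow>
        norm (T s z) \<le> C * s ^ p \<and> norm (T s z - T s z') \<le> C * s ^ q * norm (z - z')"
    using assms unfolding fam_def by blast
  then show ?thesis using *[of _ _ 0] by (intro that[of C s0]) (use * in blast)+
qed

lemma famI:
  assumes "\<And>R. \<exists>C s0. 0 \<le> C \<and> 0 < s0 \<and> s0 \<le> 1 \<and>
     (\<forall>s z z'. 0 < s \<longrightarrow> s \<le> s0 \<longrightarrow> norm z \<le> R \<longrightarrow> norm z' \<le> R \<longrightarrow>
        norm (T s z) \<le> C * s ^ p \<and> norm (T s z - T s z') \<le> C * s ^ q * norm (z - z'))"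
  shows "fam p q T"
  unfolding fam_def imp_conjL by (rule allI) (rule assms)

lemma fam_add:
  fixes T T' :: "real \<Rightarrow> 'z::real_normed_vector \<Rightarrow> 'w::real_normed_vector"
  assumes "fam p q T" "fam p q T'"
  shows "fam p q (\<lambda>s z. T s z + T' s z)"
proof (rule famI)
  fix R
  show "\<exists>C s0. 0 \<le> C \<and> 0 < s0 \<and> s0 \<le> 1 \<and>
     (\<forall>s z z'. 0 < s \<longrightarrow> s \<le> s0 \<longrightarrow> norm z \<le> R \<longrightarrow> norm z' \<le> R \<longrightarrow>
        norm (T s z + T' s z) \<le> C * s ^ p \<and> norm (T s z + T' s z - (T s z' + T' s z')) \<le> C * s ^ q * norm (z - z'))"
  proof (rule famE[OF assms(1), of R], rule famE[OF assms(2), of R])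
    fix C s0 D t0 :: real
    assume 1: "0 \<le> C" "0 < s0" "s0 \<le> 1"
      "\<And>s z. 0 < s \<Longrightarrow> s \<le> s0 \<Longrightarrow> norm z \<le> R \<Longrightarrow> norm (T s z) \<le> C * s ^ p"
      "\<And>s z z'. 0 < s \<Longrightarrow> s \<le> s0 \<Longrightarrow> norm z \<le> R \<Longrightarrow> norm z' \<le> R \<Longrightarrow> norm (T s z - T s z') \<le> C * s ^ q * norm (z - z')"
    assume 2: "0 \<le> D" "0 < t0" "t0 \<le> 1"
      "\<And>s z. 0 < s \<Longrightarrow> s \<le> t0 \<Longrightarrow> norm z \<le> R \<Longrightarrow> norm (T' s z) \<le> D * s ^ p"
      "\<And>s z z'. 0 < s \<Longrightarrow> s \<le> t0 \<Longrightarrow> norm z \<le> R \<Longrightarrow> norm z' \<le> R \<Longrightarrow> norm (T' s z - T' s z') \<le> D * s ^ q * norm (z - z')"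
    show ?thesis
    proof (rule exI[of _ "C + D"], rule exI[of _ "min s0 t0"], intro conjI allI impI)
      fix s :: real and z z' :: 'z assume s: "0 < s" "s \<le> min s0 t0" "norm z \<le> R" "norm z' \<le> R"
      then have s': "s \<le> s0" "s \<le> t0" by auto
      show "norm (T s z + T' s z) \<le> (C + D) * s ^ p"
        using norm_triangle_ineq[of "T s z" "T' s z"] 1(4)[OF s(1) s'(1) s(3)] 2(4)[OF s(1) s'(2) s(3)]
        by (simp add: algebra_simps)
      show "norm (T s z + T' s z - (T s z' + T' s z')) \<le> (C + D) * s ^ q * norm (z - z')"
        using norm_triangle_ineq[of "T s z - T s z'" "T' s z - T' s z'"]
          1(5)[OF s(1) s'(1) s(3,4)] 2(5)[OF s(1) s'(2) s(3,4)]
        by (simp add: algebra_simps)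
    qed (use 1 2 in auto)
  qed
qed

text \<open>
  The Lipschitz order of a product follows from splitting a difference of products in the usual way.
\<close>

lemma fam_mult:
  fixes T T' :: "real \<Rightarrow> 'z::real_normed_vector \<Rightarrow> 'w::real_normed_algebra"
  assumes "fam p q T" "fam p' q' T'" "k \<le> p + p'" "l \<le> p + q'" "l \<le> p' + q"
  shows "fam k l (\<lambda>s z. T s z * T' s z)"
proof (rule famI)
  fix R
  show "\<exists>C s0. 0 \<le> C \<and> 0 < s0 \<and> s0 \<le> 1 \<and>
     (\<forall>s z z'. 0 < s \<longrightarrow> s \<le> s0 \<longrightarrow> norm z \<le> R \<longrightarrow> norm z' \<le> R \<longrightarrow>
        norm (T s z * T' s z) \<le> C * s ^ k \<and> norm (T s z * T' s z - T s z' * T' s z') \<le> C * s ^ l * norm (z - z'))"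
  proof (rule famE[OF assms(1), of R], rule famE[OF assms(2), of R])
    fix C s0 D t0 :: real
    assume 1: "0 \<le> C" "0 < s0" "s0 \<le> 1"
      "\<And>s z. 0 < s \<Longrightarrow> s \<le> s0 \<Longrightarrow> norm z \<le> R \<Longrightarrow> norm (T s z) \<le> C * s ^ p"
      "\<And>s z z'. 0 < s \<Longrightarrow> s \<le> s0 \<Longrightarrow> norm z \<le> R \<Longrightarrow> norm z' \<le> R \<Longrightarrow> norm (T s z - T s z') \<le> C * s ^ q * norm (z - z')"
    assume 2: "0 \<le> D" "0 < t0" "t0 \<le> 1"
      "\<And>s z. 0 < s \<Longrightarrow> s \<le> t0 \<Longrightarrow> norm z \<le> R \<Longrightarrow> norm (T' s z) \<le> D * s ^ p'"
      "\<And>s z z'. 0 < s \<Longrightarrow> s \<le> t0 \<Longrightarrow> norm z \<le> R \<Longrightarrow> norm z' \<le> R \<Longrightarrow> norm (T' s z - T' s z') \<le> D * s ^ q' * norm (z - z')"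
    show ?thesis
    proof (rule exI[of _ "2 * (C * D)"], rule exI[of _ "min s0 t0"], intro conjI allI impI)
      fix s :: real and z z' :: 'z assume s: "0 < s" "s \<le> min s0 t0" "norm z \<le> R" "norm z' \<le> R"
      then have s': "s \<le> s0" "s \<le> t0" "s \<le> 1" using 1(3) by auto
      have CD: "0 \<le> C * D" using 1 2 by simp
      have pk: "s ^ (p + p') \<le> s ^ k" "s ^ (p + q') \<le> s ^ l" "s ^ (p' + q) \<le> s ^ l"
        using s s' assms by (auto intro!: power_decreasing)
      have "norm (T s z * T' s z) \<le> (C * s ^ p) * (D * s ^ p')"
        using 1(4)[OF s(1) s'(1) s(3)] 2(4)[OF s(1) s'(2) s(3)] 1(1) s(1)
        by (intro order_trans[OF norm_mult_ineq] mult_mono) auto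
      also have "\<dots> = (C * D) * s ^ (p + p')" by (simp add: power_add)
      also have "\<dots> \<le> (C * D) * s ^ k" by (intro mult_left_mono pk CD)
      also have "\<dots> \<le> 2 * (C * D) * s ^ k" using CD s(1) by (intro mult_right_mono) auto
      finally show "norm (T s z * T' s z) \<le> 2 * (C * D) * s ^ k" .
      have e: "T s z * T' s z - T s z' * T' s z' = T s z * (T' s z - T' s z') + (T s z - T s z') * T' s z'"
        by (simp add: algebra_simps)
      have "norm (T s z * (T' s z - T' s z')) \<le> (C * s ^ p) * (D * s ^ q' * norm (z - z'))"
        using 1(4)[OF s(1) s'(1) s(3)] 2(5)[OF s(1) s'(2) s(3,4)] 1(1) s(1)
        by (intro order_trans[OF norm_mult_ineq] mult_mono) auto
      also have "\<dots> = (C * D) * s ^ (p + q') * norm (z - z')" by (simp add: power_add)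
      also have "\<dots> \<le> (C * D) * s ^ l * norm (z - z')" by (intro mult_right_mono mult_left_mono pk CD) auto
      finally have A: "norm (T s z * (T' s z - T' s z')) \<le> (C * D) * s ^ l * norm (z - z')" .
      have "norm ((T s z - T s z') * T' s z') \<le> (C * s ^ q * norm (z - z')) * (D * s ^ p')"
        using 1(5)[OF s(1) s'(1) s(3,4)] 2(4)[OF s(1) s'(2) s(4)] 1(1) s(1)
        by (intro order_trans[OF norm_mult_ineq] mult_mono) auto
      also have "\<dots> = (C * D) * s ^ (p' + q) * norm (z - z')" by (simp add: power_add)
      also have "\<dots> \<le> (C * D) * s ^ l * norm (z - z')" by (intro mult_right_mono mult_left_mono pk CD) auto
      finally have B: "norm ((T s z - T s z') * T' s z') \<le> (C * D) * s ^ l * norm (z - z')" .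
      show "norm (T s z * T' s z - T s z' * T' s z') \<le> 2 * (C * D) * s ^ l * norm (z - z')"
        unfolding e using norm_triangle_ineq[of "T s z * (T' s z - T' s z')" "(T s z - T s z') * T' s z'"] A B
        by (simp add: algebra_simps)
    qed (use 1 2 in auto)
  qed
qed

text \<open>
  Linear operators of norm \<open>O(s ^ n)\<close> raise both orders by \<open>n\<close>; they include powers of \<open>s\<close> times the
  integration operators.
\<close>

lemma fam_bounded:
  fixes T :: "real \<Rightarrow> 'z::real_normed_vector \<Rightarrow> 'w::real_normed_vector"
    and L :: "real \<Rightarrow> 'w \<Rightarrow> 'v::real_normed_vector"
  assumes T: "fam p q T" and "k \<le> p + n" "l \<le> q + n"
    and L: "\<And>s a b. 0 < s \<Longrightarrow> s \<le> 1 \<Longrightarrow> norm (L s a) \<le> K * s ^ n * norm a"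
      "\<And>s a b. L s (a - b) = L s a - L s b" and "K \<ge> 0"
  shows "fam k l (\<lambda>s z. L s (T s z))"
proof (rule famI)
  fix R
  show "\<exists>C s0. 0 \<le> C \<and> 0 < s0 \<and> s0 \<le> 1 \<and>
     (\<forall>s z z'. 0 < s \<longrightarrow> s \<le> s0 \<longrightarrow> norm z \<le> R \<longrightarrow> norm z' \<le> R \<longrightarrow>
        norm (L s (T s z)) \<le> C * s ^ k \<and> norm (L s (T s z) - L s (T s z')) \<le> C * s ^ l * norm (z - z'))"
  proof (rule famE[OF T, of R])
    fix C s0 :: real
    assume 1: "0 \<le> C" "0 < s0" "s0 \<le> 1"
      "\<And>s z. 0 < s \<Longrightarrow> s \<le> s0 \<Longrightarrow> norm z \<le> R \<Longrightarrow> norm (T s z) \<le> C * s ^ p"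
      "\<And>s z z'. 0 < s \<Longrightarrow> s \<le> s0 \<Longrightarrow> norm z \<le> R \<Longrightarrow> norm z' \<le> R \<Longrightarrow> norm (T s z - T s z') \<le> C * s ^ q * norm (z - z')"
    show ?thesis
    proof (rule exI[of _ "K * C"], rule exI[of _ s0], intro conjI allI impI)
      fix s :: real and z z' :: 'z assume s: "0 < s" "s \<le> s0" "norm z \<le> R" "norm z' \<le> R"
      then have s1: "s \<le> 1" using 1(3) by auto
      have pk: "s ^ (p + n) \<le> s ^ k" "s ^ (q + n) \<le> s ^ l"
        using s s1 assms by (auto intro!: power_decreasing)
      have KC: "0 \<le> K * C" using assms 1 by simp
      have "norm (L s (T s z)) \<le> K * s ^ n * (C * s ^ p)"
        using 1(4)[OF s(1,2,3)] assms(6) s(1) by (intro order_trans[OF L(1)[OF s(1) s1]] mult_left_mono) auto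
      also have "\<dots> = (K * C) * s ^ (p + n)" by (simp add: power_add)
      also have "\<dots> \<le> (K * C) * s ^ k" by (intro mult_left_mono pk KC)
      finally show "norm (L s (T s z)) \<le> K * C * s ^ k" .
      have "norm (L s (T s z) - L s (T s z')) \<le> K * s ^ n * (C * s ^ q * norm (z - z'))"
        unfolding L(2)[symmetric]
        using 1(5)[OF s] assms(6) s(1) by (intro order_trans[OF L(1)[OF s(1) s1]] mult_left_mono) auto
      also have "\<dots> = (K * C) * s ^ (q + n) * norm (z - z')" by (simp add: power_add)
      also have "\<dots> \<le> (K * C) * s ^ l * norm (z - z')" by (intro mult_right_mono mult_left_mono pk KC) auto
      finally show "norm (L s (T s z) - L s (T s z')) \<le> K * C * s ^ l * norm (z - z')" .
    qed (use 1 assms in auto)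
  qed
qed

lemma fam_scaleR: "fam p q T \<Longrightarrow> fam p q (\<lambda>s z. c *\<^sub>R T s z)"
  using fam_bounded[of p q T p 0 q "\<lambda>s a. c *\<^sub>R a" "\<bar>c\<bar>"] by (simp add: scaleR_diff_right)

lemma fam_diff: "fam p q T \<Longrightarrow> fam p q T' \<Longrightarrow> fam p q (\<lambda>s z. T s z - T' s z)"
  using fam_add[OF _ fam_scaleR[of p q T' "-1"], of T] by simp

lemma fam_id: "fam 0 0 (\<lambda>s z. z)"
proof (rule famI)
  fix R :: real
  show "\<exists>C s0. 0 \<le> C \<and> 0 < s0 \<and> s0 \<le> 1 \<and> (\<forall>s. \<forall>z z'::'a. 0 < s \<longrightarrow> s \<le> s0 \<longrightarrow> norm z \<le> R \<longrightarrow> norm z' \<le> R \<longrightarrow>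
        norm z \<le> C * s ^ 0 \<and> norm (z - z') \<le> C * s ^ 0 * norm (z - z'))"
    by (rule exI[of _ "\<bar>R\<bar> + 1"], rule exI[of _ 1]) (auto simp: algebra_simps)
qed

lemma fam_nth: "fam 0 0 (\<lambda>s z :: 'z::real_normed_vector ^ 'n. z $ k)"
  by (rule fam_bounded[OF fam_id, of _ 0 _ "\<lambda>s z. z $ k" 1]) (auto simp: Finite_Cartesian_Product.norm_nth_le)

lemma fam_vec:
  fixes T :: "real \<Rightarrow> 'z::real_normed_vector \<Rightarrow> 'w::real_normed_vector ^ 'n"
  assumes "\<And>k. fam p q (\<lambda>s z. T s z $ k)"
  shows "fam p q T"
proof (rule famI)
  fix R
  have "\<forall>k. \<exists>C s0. 0 \<le> C \<and> 0 < s0 \<and> s0 \<le> 1 \<and>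
     (\<forall>s z z'. 0 < s \<and> s \<le> s0 \<and> norm z \<le> R \<and> norm z' \<le> R \<longrightarrow>
        norm (T s z $ k) \<le> C * s ^ p \<and> norm (T s z $ k - T s z' $ k) \<le> C * s ^ q * norm (z - z'))"
    using assms unfolding fam_def by blast
  then obtain C s0 where *: "\<And>k. 0 \<le> C k" "\<And>k. 0 < s0 k" "\<And>k. s0 k \<le> 1"
    "\<And>k s z z'. 0 < s \<and> s \<le> s0 k \<and> norm z \<le> R \<and> norm z' \<le> R \<Longrightarrow>
        norm (T s z $ k) \<le> C k * s ^ p \<and> norm (T s z $ k - T s z' $ k) \<le> C k * s ^ q * norm (z - z')"
    unfolding choice_iff by blast
  define m where "m = Min (range s0)"
  have m: "0 < m" "\<And>k. m \<le> s0 k" using *(2) by (auto simp: m_def)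
  have m1: "m \<le> 1" using m(2) *(3) order_trans by blast
  show "\<exists>C s0. 0 \<le> C \<and> 0 < s0 \<and> s0 \<le> 1 \<and>
     (\<forall>s z z'. 0 < s \<longrightarrow> s \<le> s0 \<longrightarrow> norm z \<le> R \<longrightarrow> norm z' \<le> R \<longrightarrow>
        norm (T s z) \<le> C * s ^ p \<and> norm (T s z - T s z') \<le> C * s ^ q * norm (z - z'))"
  proof (rule exI[of _ "\<Sum>k\<in>UNIV. C k"], rule exI[of _ m], intro conjI allI impI)
    fix s :: real and z z' :: 'z assume s: "0 < s" "s \<le> m" "norm z \<le> R" "norm z' \<le> R"
    then have b: "0 < s \<and> s \<le> s0 k \<and> norm z \<le> R \<and> norm z' \<le> R" for k using m(2)[of k] by auto
    have l1: "norm v \<le> (\<Sum>k\<in>UNIV. norm (v $ k))" for v :: "'w ^ 'n"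
      unfolding norm_vec_def by (rule L2_set_le_sum) simp
    show "norm (T s z) \<le> (\<Sum>k\<in>UNIV. C k) * s ^ p"
      using *(4)[OF b] unfolding sum_distrib_right by (intro order_trans[OF l1] sum_mono) auto
    show "norm (T s z - T s z') \<le> (\<Sum>k\<in>UNIV. C k) * s ^ q * norm (z - z')"
      using *(4)[OF b] unfolding sum_distrib_right by (intro order_trans[OF l1] sum_mono) auto
  qed (use * m m1 in \<open>auto intro: sum_nonneg\<close>)
qed

text \<open>
  For small \<open>s\<close> the map is a contraction of the ball whose radius is governed by the bound at the origin.
\<close>

lemma fam_fixed_point:
  fixes T :: "real \<Rightarrow> 'z::banach \<Rightarrow> 'z"
  assumes "fam 0 1 T"
  shows "\<exists>s0>0. \<forall>s. 0 < s \<and> s \<le> s0 \<longrightarrow> (\<exists>z. T s z = z)"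
proof (rule famE[OF assms, of 0])
  fix C0 t0 :: real
  assume 0: "0 \<le> C0" "0 < t0" "\<And>s z. 0 < s \<Longrightarrow> s \<le> t0 \<Longrightarrow> norm z \<le> 0 \<Longrightarrow> norm (T s z) \<le> C0 * s ^ 0"
  let ?R = "2 * C0 + 1"
  show ?thesis
  proof (rule famE[OF assms, of ?R])
    fix C s1 :: real
    assume 1: "0 \<le> C" "0 < s1" "s1 \<le> 1" "\<And>s z z'. 0 < s \<Longrightarrow> s \<le> s1 \<Longrightarrow> norm z \<le> ?R \<Longrightarrow> norm z' \<le> ?R \<Longrightarrow> norm (T s z - T s z') \<le> C * s ^ 1 * norm (z - z')"
    define s0 where "s0 = Min {t0, s1, 1 / (2 * (C + 1))}"
    have s0: "0 < s0" "s0 \<le> t0" "s0 \<le> s1" "s0 \<le> 1 / (2 * (C + 1))" using 0 1 by (auto simp: s0_def)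
    have "\<exists>z. T s z = z" if s: "0 < s" "s \<le> s0" for s
    proof -
      have "s * (2 * (C + 1)) \<le> 1" using s s0(4) 1(1) by (simp add: pos_le_divide_eq[symmetric])
      then have Cs: "C * s \<le> 1/2" using s by (simp add: algebra_simps)
      have lip: "norm (T s z - T s z') \<le> 1/2 * norm (z - z')" if "norm z \<le> ?R" "norm z' \<le> ?R" for z z' :: 'z
        using 1(4)[OF s(1) _ that] s s0 mult_right_mono[OF Cs, of "norm (z - z')"] by simp
      have "\<exists>!z\<in>cball 0 ?R. T s z = z"
      proof (rule Banach_fix[of _ "1/2"])
        show "complete (cball (0::'z) ?R)" by (simp add: complete_eq_closed)
        show "cball (0::'z) ?R \<noteq> {}" using 0(1) by simp
        show "T s ` cball 0 ?R \<subseteq> cball 0 ?R"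
        proof (clarsimp)
          fix z :: 'z assume z: "norm z \<le> ?R"
          have "norm (T s z) \<le> norm (T s z - T s 0) + norm (T s 0)" by (metis diff_add_cancel norm_triangle_ineq)
          also have "\<dots> \<le> 1/2 * norm z + C0"
            using lip[OF z, of 0] 0(1) 0(3)[OF s(1), of 0] s s0 by (intro add_mono) auto
          finally show "norm (T s z) \<le> ?R" using z by simp
        qed
        show "dist (T s x) (T s y) \<le> 1/2 * dist x y" if "x \<in> cball 0 ?R" "y \<in> cball 0 ?R" for x y
          using lip that by (simp add: dist_norm)
      qed auto
      then show ?thesis by blast
    qed
    with s0(1) show ?thesis by blast
  qed
qed

text \<open>
  The rescaled series as an element of the Banach algebra; the default 0 only concerns values of \<open>s\<close> for which
  the rescaled series does not have finite norm.
\<close>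

definition rescaled :: "real \<Rightarrow> real fps fps \<Rightarrow> wser" where
  "rescaled s a = Abs_wser (if wsum (scl s (s\<^sup>2) a) then scl s (s\<^sup>2) a else 0)"

lemma ser_rescaled: "wsum (scl s (s\<^sup>2) a) \<Longrightarrow> ser (rescaled s a) = scl s (s\<^sup>2) a"
  by (simp add: rescaled_def Abs_wser_inverse)

lemma ser_of_real: "ser (of_real c) = cst c"
  by (simp add: of_real_def scaleR_wser.rep_eq one_wser.rep_eq)

text \<open>
  Fixed convergent series are constant in \<open>z\<close>, so their Lipschitz order is arbitrary; after removal of the
  constant term they are small of first order.
\<close>

lemma fam_data:
  assumes "conv a"
  shows "fam 0 q (\<lambda>s z. rescaled s a)" "fam 1 q (\<lambda>s z. rescaled s a - of_real (cf a 0 0))"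
    "\<exists>s0>0. \<forall>s. 0 < s \<and> s \<le> s0 \<longrightarrow> wsum (scl s (s\<^sup>2) a)"
proof -
  show "fam 0 q (\<lambda>s z. rescaled s a)" "fam 1 q (\<lambda>s z. rescaled s a - of_real (cf a 0 0))"
    "\<exists>s0>0. \<forall>s. 0 < s \<and> s \<le> s0 \<longrightarrow> wsum (scl s (s\<^sup>2) a)"
  proof (atomize(full), rule conv_scale[OF assms])
    fix s0 C :: real
    assume s0: "0 < s0" "s0 \<le> 1" "0 \<le> C" and *: "\<And>s t. 0 < s \<Longrightarrow> s \<le> s0 \<Longrightarrow> 0 \<le> t \<Longrightarrow> t \<le> s \<Longrightarrow>
       wsum (scl s t a) \<and> wnorm (scl s t a) \<le> C \<and> wnorm (scl s t a - cst (cf a 0 0)) \<le> C * s"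
    have sq: "s\<^sup>2 \<le> s" if "0 < s" "s \<le> s0" for s
      using that s0 by (simp add: power2_eq_square mult_left_le)
    have w: "wsum (scl s (s\<^sup>2) a)" "wnorm (scl s (s\<^sup>2) a) \<le> C" "wnorm (scl s (s\<^sup>2) a - cst (cf a 0 0)) \<le> C * s"
      if "0 < s" "s \<le> s0" for s
      using *[OF that _ sq[OF that]] by auto
    have "norm (rescaled s a) \<le> C" "norm (rescaled s a - of_real (cf a 0 0)) \<le> C * s" if "0 < s" "s \<le> s0" for s
      using w[OF that] by (simp_all add: norm_wser.rep_eq minus_wser.rep_eq ser_rescaled ser_of_real)
    note n = this
    have "fam 0 q (\<lambda>s z. rescaled s a)"
      by (rule famI, rule exI[of _ C], rule exI[of _ s0]) (use s0 n in auto)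
    moreover have "fam 1 q (\<lambda>s z. rescaled s a - of_real (cf a 0 0))"
      by (rule famI, rule exI[of _ C], rule exI[of _ s0]) (use s0 n in auto)
    ultimately show "fam 0 q (\<lambda>s z. rescaled s a) \<and> fam 1 q (\<lambda>s z. rescaled s a - of_real (cf a 0 0)) \<and>
        (\<exists>s0>0. \<forall>s. 0 < s \<and> s \<le> s0 \<longrightarrow> wsum (scl s (s\<^sup>2) a))"
      using w(1) s0(1) by blast
  qed
qed

section \<open>The Lorentz product over commutative rings\<close>

text \<open>
  The Lorentz product for vectors of formal series and of elements of the Banach algebra.
\<close>

definition lp :: "'r::comm_ring_1 ^ 3 \<Rightarrow> 'r ^ 3 \<Rightarrow> 'r" where
  "lp a b = a$1 * b$1 + a$2 * b$2 - a$3 * b$3"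

definition vm :: "('a \<Rightarrow> 'b) \<Rightarrow> 'a ^ 3 \<Rightarrow> 'b ^ 3" where
  "vm f a = (\<chi> k. f (a$k))"

abbreviation cv :: "real^3 \<Rightarrow> real fps fps ^ 3" where "cv \<equiv> vm cst"

lemma vm_nth [simp]: "vm f a $ k = f (a$k)"
  by (simp add: vm_def)

lemma lp_commute: "lp a b = lp b a"
  by (simp add: lp_def mult.commute)

lemma lp_linear:
  "lp (a + b) c = lp a c + lp b c" "lp (a - b) c = lp a c - lp b c" "lp (x *s a) c = x * lp a c"
  "lp c (a + b) = lp c a + lp c b" "lp c (a - b) = lp c a - lp c b" "lp c (x *s a) = x * lp c a"
  by (simp_all add: lp_def algebra_simps)

lemma lp_cv: "lp (cv a) (cv b) = cst (lprod a b)"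
  by (simp add: lp_def lprod_def)

lemma cf_lp_00: "cf (lp a b) 0 0 = lprod (\<chi> k. cf (a$k) 0 0) (\<chi> k. cf (b$k) 0 0)"
  by (simp add: lp_def lprod_def cf_mult)

lemma scl_lp: "scl s t (lp a b) = lp (vm (scl s t) a) (vm (scl s t) b)"
  by (simp add: lp_def)

lemma ser_hom: "ser (a + b) = ser a + ser b" "ser (a - b) = ser a - ser b" "ser (a * b) = ser a * ser b"
    "ser (c *\<^sub>R a) = cst c * ser a"
  by (simp_all add: plus_wser.rep_eq minus_wser.rep_eq times_wser.rep_eq scaleR_wser.rep_eq)

lemma ser_lp: "ser (lp a b) = lp (vm ser a) (vm ser b)"
  by (simp add: lp_def ser_hom)

lemma du_lp: "du (lp a b) = lp (vm du a) b + lp a (vm du b)"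
  and dv_lp: "dv (lp a b) = lp (vm dv a) b + lp a (vm dv b)"
  by (simp_all add: lp_def du_mult dv_mult algebra_simps)

lemma conv_lp: "(\<And>k. conv (a$k)) \<Longrightarrow> (\<And>k. conv (b$k)) \<Longrightarrow> conv (lp a b)"
  unfolding lp_def by (intro conv_add conv_diff conv_mult)

lemma fam_lp:
  assumes "\<And>k. fam p q (\<lambda>s z. T s z $ k)" "\<And>k. fam p' q' (\<lambda>s z. T' s z $ k)"
    "k \<le> p + p'" "l \<le> p + q'" "l \<le> p' + q"
  shows "fam k l (\<lambda>s z. lp (T s z) (T' s z :: wser^3))"
  unfolding lp_def by (intro fam_add fam_diff fam_mult[OF assms(1) assms(2) assms(3-5)])

text \<open>
  In the order \<open>l, p, r\<close> the Gram matrix has zeros above the antidiagonal and non-zero entries on it, so it is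
  inverted by back substitution.
\<close>

lemma dual_frame:
  fixes p l r :: "real^3"
  assumes "lprod p p \<noteq> 0" "lprod p l = 0" "lprod l l = 0" "lprod r l \<noteq> 0"
  obtains d1 d2 d3 where
    "lprod d1 p = 1" "lprod d1 l = 0" "lprod d1 r = 0"
    "lprod d2 p = 0" "lprod d2 l = 1" "lprod d2 r = 0"
    "lprod d3 p = 0" "lprod d3 l = 0" "lprod d3 r = 1"
proof -
  have lin: "lprod (a + b) c = lprod a c + lprod b c" "lprod (a - b) c = lprod a c - lprod b c"
    "lprod (x *\<^sub>R a) c = x * lprod a c" for a b c x
    by (simp_all add: lprod_def algebra_simps)
  have com: "lprod l p = 0" "lprod l r = lprod r l" "lprod p r = lprod r p"
    using assms(2) by (simp_all add: lprod_def mult.commute)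
  let ?e = "lprod p p" and ?m = "lprod r l"
  let ?x = "- lprod r p / (?m * ?e)"
  show ?thesis
  proof (rule that)
    show "lprod ((1 / ?e) *\<^sub>R p + ?x *\<^sub>R l) p = 1" "lprod ((1 / ?e) *\<^sub>R p + ?x *\<^sub>R l) l = 0"
      "lprod ((1 / ?e) *\<^sub>R p + ?x *\<^sub>R l) r = 0"
      using assms by (simp_all add: lin com)
    show "lprod ((1 / ?m) *\<^sub>R r + ?x *\<^sub>R p + (- (lprod r r / ?m + ?x * lprod r p) / ?m) *\<^sub>R l) p = 0"
      "lprod ((1 / ?m) *\<^sub>R r + ?x *\<^sub>R p + (- (lprod r r / ?m + ?x * lprod r p) / ?m) *\<^sub>R l) l = 1"
      "lprod ((1 / ?m) *\<^sub>R r + ?x *\<^sub>R p + (- (lprod r r / ?m + ?x * lprod r p) / ?m) *\<^sub>R l) r = 0"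
      using assms by (simp_all add: lin com)
    show "lprod ((1 / ?m) *\<^sub>R l) p = 0" "lprod ((1 / ?m) *\<^sub>R l) l = 0" "lprod ((1 / ?m) *\<^sub>R l) r = 1"
      using assms by (simp_all add: lin com)
  qed
qed

text \<open>
  A linear system with constant coefficients is solved by the dual frame. The perturbations are of order \<open>s\<close>,
  so moving them to the right hand side leaves a contraction.
\<close>

lemma solve_in_frame:
  fixes p l r :: "real^3" and a1 a2 a3 :: "real \<Rightarrow> wser^3 \<Rightarrow> wser^3" and r1 r2 r3 :: "real \<Rightarrow> wser^3 \<Rightarrow> wser"
  assumes fr: "lprod p p \<noteq> 0" "lprod p l = 0" "lprod l l = 0" "lprod r l \<noteq> 0"
    and a: "\<And>k. fam 1 1 (\<lambda>s z. a1 s z $ k)" "\<And>k. fam 1 1 (\<lambda>s z. a2 s z $ k)" "\<And>k. fam 1 1 (\<lambda>s z. a3 s z $ k)"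
    and r: "fam 0 1 r1" "fam 0 1 r2" "fam 0 1 r3"
  shows "\<exists>s0>0. \<forall>s. 0 < s \<and> s \<le> s0 \<longrightarrow> (\<exists>z. lp z (vm of_real p + a1 s z) = r1 s z \<and>
     lp z (vm of_real l + a2 s z) = r2 s z \<and> lp z (vm of_real r + a3 s z) = r3 s z)"
proof (rule dual_frame[OF fr])
  fix d1 d2 d3 :: "real^3"
  assume d: "lprod d1 p = 1" "lprod d1 l = 0" "lprod d1 r = 0"
    "lprod d2 p = 0" "lprod d2 l = 1" "lprod d2 r = 0"
    "lprod d3 p = 0" "lprod d3 l = 0" "lprod d3 r = 1"
  define X1 X2 X3 where "X1 s z = r1 s z - lp z (a1 s z)" and "X2 s z = r2 s z - lp z (a2 s z)"
    and "X3 s z = r3 s z - lp z (a3 s z)" for s z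
  \<comment> \<open>a fixed point of \<open>T\<close> has the products \<open>X1\<close>, \<open>X2\<close>, \<open>X3\<close> with the frame, which are the equations to be solved\<close>
  define T where "T s z = (\<chi> k. d1$k *\<^sub>R X1 s z + d2$k *\<^sub>R X2 s z + d3$k *\<^sub>R X3 s z)" for s z
  have "fam 0 1 X1" "fam 0 1 X2" "fam 0 1 X3"
    unfolding X1_def[abs_def] X2_def[abs_def] X3_def[abs_def]
    by (intro fam_diff r fam_lp[OF fam_nth a(1)] fam_lp[OF fam_nth a(2)] fam_lp[OF fam_nth a(3)]; simp)+
  then have "fam 0 1 T"
    by (intro fam_vec) (simp add: T_def, intro fam_add fam_scaleR)
  from fam_fixed_point[OF this] obtain s0 where s0: "s0 > 0" "\<And>s. 0 < s \<and> s \<le> s0 \<Longrightarrow> \<exists>z. T s z = z"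
    by blast
  have "\<exists>z. lp z (vm of_real p + a1 s z) = r1 s z \<and>
     lp z (vm of_real l + a2 s z) = r2 s z \<and> lp z (vm of_real r + a3 s z) = r3 s z" if s: "0 < s \<and> s \<le> s0" for s
  proof -
    obtain z where z: "T s z = z" using s0(2)[OF s] by blast
    have T: "lp (T s z) (vm of_real q) = lprod d1 q *\<^sub>R X1 s z + lprod d2 q *\<^sub>R X2 s z + lprod d3 q *\<^sub>R X3 s z" for q
      by (simp add: lp_def lprod_def T_def of_real_def algebra_simps)
    have "lp z (vm of_real p) = X1 s z" "lp z (vm of_real l) = X2 s z" "lp z (vm of_real r) = X3 s z"
      using T[of p] T[of l] T[of r] d z by simp_all
    then show ?thesis by (intro exI[of _ z]) (simp add: lp_linear X1_def X2_def X3_def)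
  qed
  with s0(1) show ?thesis by blast
qed

lemma conv_finite:
  assumes "finite A" "\<And>a. a \<in> A \<Longrightarrow> conv a"
  shows "\<exists>s0>0. \<forall>s. 0 < s \<and> s \<le> s0 \<longrightarrow> (\<forall>a\<in>A. wsum (scl s (s\<^sup>2) a))"
  using assms
proof (induction A rule: finite_induct)
  case empty
  then show ?case by (intro exI[of _ 1]) simp
next
  case (insert x A)
  obtain s1 where s1: "s1 > 0" "\<And>s. 0 < s \<and> s \<le> s1 \<Longrightarrow> \<forall>a\<in>A. wsum (scl s (s\<^sup>2) a)"
    using insert by auto
  obtain s2 where s2: "s2 > 0" "\<And>s. 0 < s \<and> s \<le> s2 \<Longrightarrow> wsum (scl s (s\<^sup>2) x)"
    using fam_data(3)[of x] insert by auto
  show ?case using s1 s2 by (intro exI[of _ "min s1 s2"]) auto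
qed

definition unscl :: "real \<Rightarrow> wser \<Rightarrow> real fps fps" where
  "unscl s b = scl (1 / s) (1 / s\<^sup>2) (ser b)"

lemma scl_unscl: "s > 0 \<Longrightarrow> scl s (s\<^sup>2) (unscl s b) = ser b"
  by (simp add: unscl_def scl_scl)

lemma conv_unscl_ser: "s > 0 \<Longrightarrow> conv (unscl s b)"
  using conv_unscl[of s "s\<^sup>2" "unscl s b"] by (simp add: scl_unscl)

lemma scl_inject: "s > 0 \<Longrightarrow> scl s (s\<^sup>2) a = scl s (s\<^sup>2) b \<Longrightarrow> a = b"
proof -
  assume "s > 0" and e: "scl s (s\<^sup>2) a = scl s (s\<^sup>2) b"
  have "scl (1 / s) (1 / s\<^sup>2) (scl s (s\<^sup>2) c) = c" for c using \<open>s > 0\<close> by (simp add: scl_scl)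
  from this[of a] this[of b] show "a = b" unfolding e by (rule trans[OF sym])
qed

text \<open>
  Under \<open>(u, v) \<mapsto> (s u, s\<^sup>2 v)\<close> an integration in \<open>v\<close> gains \<open>s\<^sup>2\<close> and a derivative in \<open>u\<close> costs only one
  factor \<open>s\<close>.
\<close>

lemma scl_iv: "scl s (s\<^sup>2) (iv a) = cst (s\<^sup>2) * iv (scl s (s\<^sup>2) a)"
  and scl_du_iv: "scl s (s\<^sup>2) (du (iv a)) = cst s * du (iv (scl s (s\<^sup>2) a))"
  by (rule ser_eqI; auto simp: gr0_conv_Suc power2_eq_square simp del: cst_simps)+

section \<open>Initial data\<close>

definition Xu :: "real fps fps" where "Xu = monom_ser 1 0"
definition Xv :: "real fps fps" where "Xv = monom_ser 0 1"

text \<open>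
  Restriction to \<open>v = 0\<close>.
\<close>

definition res :: "real fps fps \<Rightarrow> real fps fps" where
  "res a = fps_const (fps_nth a 0)"

lemma cf_res: "cf (res a) i j = (if j = 0 then cf a i 0 else 0)"
  by (simp add: res_def cf_def)

lemma res_mult [simp]: "res (a * b) = res a * res b"
  by (simp add: res_def)

lemma res_hom [simp]: "res 0 = 0" "res (a + b) = res a + res b" "res (a - b) = res a - res b"
    "res (cst c) = cst c" "res (res a) = res a" "res (iv a) = 0" "res Xu = Xu" "res Xv = 0" "res (iu a) = iu (res a)"
  by (rule ser_eqI; simp add: cf_res cf_cst monom_ser_def Xu_def Xv_def)+

lemma res_lp: "res (lp a b) = lp (vm res a) (vm res b)"
  by (simp add: lp_def)

lemma res_du: "res (du a) = du (res a)"
  by (rule ser_eqI) (simp add: cf_res)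

lemma dv_res [simp]: "dv (res a) = 0"
  by (rule ser_eqI) (simp add: cf_res)

lemma conv_res: "conv a \<Longrightarrow> conv (res a)"
proof -
  assume "conv a"
  then obtain s where s: "s > 0" "wsum (scl s s a)" by (auto simp: conv_def)
  have "wterm (scl s s (res a)) p \<le> wterm (scl s s a) p" for p
    by (simp add: wterm_def cf_res)
  from wsum_compare(1)[OF wnorm_has_sum[OF s(2)] this] s(1) show ?thesis by (auto simp: conv_def)
qed

lemma dv_res_zero: "dv a = 0 \<Longrightarrow> res a = 0 \<Longrightarrow> a = 0"
  by (rule dv_zero_imp_zero) (metis cf_res cf_simps(1))+


lemma cf_Xu_mult: "cf (Xu * a) i j = (if i = 0 then 0 else cf a (i - 1) j)"
proof -
  have "cf (Xu * a) i j = (\<Sum>q\<in>{..i} \<times> {..j}. if q = (1, 0) then cf a (i - 1) j else 0)"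
    unfolding cf_mult by (rule sum.cong) (auto simp: monom_ser_def Xu_def)
  then show ?thesis by auto
qed

lemma Xu_shiftu: "res a = a \<Longrightarrow> cf a 0 0 = 0 \<Longrightarrow> Xu * shiftu a = a"
proof (rule ser_eqI)
  fix i j assume "res a = a" "cf a 0 0 = 0"
  then have "cf a 0 j = 0" by (metis cf_res)
  then show "cf (Xu * shiftu a) i j = cf a i j" by (simp add: cf_Xu_mult)
qed

lemma du_Xu: "du Xu = 1" and dv_Xv: "dv Xv = 1" and du_Xv: "du Xv = 0"
  by (rule ser_eqI; simp add: monom_ser_def cf_one Xu_def Xv_def)+

lemma conv_Xu: "conv Xu" and conv_Xv: "conv Xv"
  unfolding Xu_def Xv_def by (rule conv_wsum, rule wsum_monom_ser)+

text \<open>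
  \<open>P\<close> is \<open>exp (u A) p\<close> for the infinitesimal rotation \<open>A x = \<langle>l, x\<rangle> p0 - \<langle>p0, x\<rangle> l\<close>. Since \<open>A p0 = - e l\<close> and
  \<open>A l = 0\<close>, the cube of \<open>A\<close> vanishes and the exponential is quadratic in \<open>u\<close>.
\<close>

lemma null_rotation:
  fixes p :: "real fps fps ^ 3" and p0 l :: "real^3"
  assumes "lprod p0 l = 0" "lprod l l = 0" "lprod p0 p0 = e"
  defines "P \<equiv> p + (Xu * lp (cv l) p) *s cv p0 - (Xu * lp (cv p0) p + cst (e / 2) * (Xu * Xu * lp (cv l) p)) *s cv l"
  shows "lp P P = lp p p"
proof -
  define h where "h = cst (e / 2)"
  have h: "cst e = h + h" unfolding h_def cst_simps(3)[symmetric] by simp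
  let ?\<alpha> = "lp (cv l) p" and ?\<beta> = "lp (cv p0) p"
  have c: "lp (cv p0) (cv p0) = h + h" "lp (cv p0) (cv l) = 0" "lp (cv l) (cv p0) = 0" "lp (cv l) (cv l) = 0"
    "lp p (cv l) = ?\<alpha>" "lp p (cv p0) = ?\<beta>"
    using assms h lp_commute[of p] lprod_def[of l p0] lprod_def[of p0 l] by (auto simp: lp_cv mult.commute)
  show ?thesis
    unfolding P_def h_def[symmetric] by (simp add: lp_linear c algebra_simps)
qed

lemma cf_00_mult: "cf (a * b) 0 0 = cf a 0 0 * cf b 0 0"
  by (simp add: cf_mult)

lemma cf_Xu_00 [simp]: "cf Xu 0 0 = 0" and cf_Xv_00 [simp]: "cf Xv 0 0 = 0"
  by (simp_all add: Xu_def Xv_def monom_ser_def)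

lemma vm_scl_lp_cancel:
  assumes "s > 0" "lp (vm (scl s (s\<^sup>2)) a) (vm (scl s (s\<^sup>2)) b) = scl s (s\<^sup>2) c"
  shows "lp a b = c"
  using scl_inject[OF assms(1), of "lp a b" c] assms(2) by (simp add: scl_lp)

text \<open>
  Initial curves for the Cauchy problem: \<open>P\<close> is the null rotation of \<open>F\<^sub>u\<close> on \<open>v = 0\<close>, and \<open>\<xi>\<close> takes the role
  of \<open>F\<^sub>v\<close>. The rotation has the same value as \<open>F\<^sub>u\<close> at the origin, and its derivative there differs by
  \<open>\<langle>l, p\<rangle> p - \<langle>p, p\<rangle> l = - \<langle>p, p\<rangle> l\<close>. Writing \<open>\<xi> = l + u \<zeta>\<close> turns the conditions on \<open>\<xi>\<close> into a system for \<open>\<zeta>\<close>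
  that has the shape of \<open>solve_in_frame\<close>.
\<close>

lemma initial_data:
  fixes F :: "real fps fps ^ 3" and p l r :: "real^3"
  assumes F: "\<And>k. conv (F$k)"
    and p: "\<And>k. cf (du (F$k)) 0 0 = p$k" and l: "\<And>k. cf (dv (F$k)) 0 0 = l$k"
    and r: "\<And>k. cf (du (du (F$k))) 0 0 = r$k"
    and fr: "lprod p p \<noteq> 0" "lprod p l = 0" "lprod l l = 0" "lprod r l \<noteq> 0"
  obtains P \<xi> :: "real fps fps ^ 3" where "\<And>k. conv (P$k)" "\<And>k. conv (\<xi>$k)"
    "\<And>k. res (P$k) = P$k" "\<And>k. res (\<xi>$k) = \<xi>$k"
    "lp P P = res (lp (vm du F) (vm du F))" "lp \<xi> P = res (lp (vm dv F) (vm du F))"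
    "lp \<xi> \<xi> = res (lp (vm dv F) (vm dv F))" "lp \<xi> (vm du P) = res (lp (vm dv F) (vm du (vm du F)))"
    "\<And>k. cf (P$k) 0 0 = p$k" "\<And>k. cf (\<xi>$k) 0 0 = l$k" "\<And>k. cf (du (P$k)) 0 0 = (r - lprod p p *\<^sub>R l) $ k"
proof -
  define e where "e = lprod p p"
  define q where "q = vm res (vm du F)"
  define P where "P = q + (Xu * lp (cv l) q) *s cv p - (Xu * lp (cv p) q + cst (e / 2) * (Xu * Xu * lp (cv l) q)) *s cv l"
  define r' where "r' = r - e *\<^sub>R l"
  have convq: "conv (q$k)" for k unfolding q_def by (simp add: conv_res conv_du F)
  have ccv: "conv (cv x $ k)" for x k by (simp add: conv_cst)
  have convP: "conv (P$k)" for k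
    unfolding P_def vector_add_component vector_minus_component vector_smult_component
    by (intro conv_add conv_diff conv_mult conv_Xu conv_cst conv_lp convq ccv)
  have rq: "vm res q = q" "vm res (cv x) = cv x" for x by (simp_all add: q_def vec_eq_iff)
  have resP: "res (P$k) = P$k" for k
  proof -
    have "res (q$k) = q$k" by (simp add: q_def)
    then show ?thesis by (simp add: P_def res_lp rq)
  qed
  have rr: "vm res (vm res x) = vm res x" for x by (simp add: vec_eq_iff)
  have vresP: "vm res P = P" "vm res (vm du P) = vm du P" by (simp_all add: vec_eq_iff resP res_du)
  have q0: "cf (q$k) 0 0 = p$k" for k using p[of k] by (simp add: q_def cf_res)
  have P0: "cf (P$k) 0 0 = p$k" for k
    by (simp add: P_def cf_00_mult q0)
  have q00: "(\<chi> k. cf (q$k) 0 0) = p" "(\<chi> k. cf (cv x$k) 0 0) = x" for x by (simp_all add: vec_eq_iff q0 cf_cst)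
  have lp0: "lprod l p = 0" using fr(2) by (simp add: lprod_def mult.commute)
  have duq: "cf (du (q$k)) 0 0 = r$k" for k
    using r[of k] by (simp add: q_def res_du[symmetric] cf_res del: cf_du)
  have dP0: "cf (du (P$k)) 0 0 = r'$k" for k
    using duq[of k]
    by (simp add: P_def du_mult du_Xu cf_00_mult cf_lp_00 q00 lp0 r'_def e_def cf_cst del: cf_du)
  have PP: "lp P P = lp q q" unfolding P_def by (rule null_rotation) (use fr in \<open>auto simp: e_def\<close>)
  have r'l: "lprod r' l \<noteq> 0"
  proof -
    have "lprod r' l = lprod r l - e * lprod l l" by (simp add: r'_def lprod_def algebra_simps)
    then show ?thesis using fr by simp
  qed
  define F0 where "F0 = res (lp (vm dv F) (vm du F))"
  define G0 where "G0 = res (lp (vm dv F) (vm dv F))"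
  define M0 where "M0 = res (lp (vm dv F) (vm du (vm du F)))"
  have convd: "conv (vm du F $ k)" "conv (vm dv F $ k)" "conv (vm du (vm du F) $ k)" "conv (vm du P $ k)" for k
    by (simp_all add: conv_du conv_dv F convP)
  have conv0: "conv F0" "conv G0" "conv M0" "conv (lp (cv l) P)" "conv (lp (cv l) (vm du P))"
    unfolding F0_def G0_def M0_def by (intro conv_res conv_lp convd convP ccv)+
  have Fc: "(\<chi> k. cf (vm du F $ k) 0 0) = p" "(\<chi> k. cf (vm dv F $ k) 0 0) = l" "(\<chi> k. cf (vm du (vm du F) $ k) 0 0) = r"
    "(\<chi> k. cf (P $ k) 0 0) = p" "(\<chi> k. cf (vm du P $ k) 0 0) = r'"
    using p l r P0 dP0 by (simp_all add: vec_eq_iff del: cf_du cf_dv)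
  have res00: "cf (res x) 0 0 = cf x 0 0" for x by (simp add: cf_res)
  have c00: "cf (F0 - lp (cv l) P) 0 0 = 0" "cf G0 0 0 = 0" "cf (M0 - lp (cv l) (vm du P)) 0 0 = 0"
  proof -
    have "lprod l r' = lprod l r - e * lprod l l" by (simp add: r'_def lprod_def algebra_simps)
    with fr(3) have "lprod l r' = lprod l r" by simp
    then show "cf (F0 - lp (cv l) P) 0 0 = 0" "cf G0 0 0 = 0" "cf (M0 - lp (cv l) (vm du P)) 0 0 = 0"
      using fr unfolding cf_simps F0_def G0_def M0_def res00 cf_lp_00 Fc q00 by simp_all
  qed
  \<comment> \<open>with \<open>\<xi> = l + u \<zeta>\<close> the three conditions, divided by \<open>u\<close>, are \<open>\<langle>\<zeta>, P\<rangle> = S1\<close>,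
    \<open>\<langle>\<zeta>, l + u \<zeta> / 2\<rangle> = S2\<close> and \<open>\<langle>\<zeta>, P\<^sub>u\<rangle> = S3\<close>\<close>
  define S1 where "S1 = shiftu (F0 - lp (cv l) P)"
  define S2 where "S2 = cst (1/2) * shiftu G0"
  define S3 where "S3 = shiftu (M0 - lp (cv l) (vm du P))"
  have US: "Xu * S1 = F0 - lp (cv l) P" "Xu * shiftu G0 = G0" "Xu * S3 = M0 - lp (cv l) (vm du P)"
    unfolding S1_def S3_def
    by (intro Xu_shiftu c00; simp add: F0_def G0_def M0_def res_lp rq rr vresP)+
  have convS: "conv S1" "conv S2" "conv S3" "conv (cst (1/2) * Xu)"
    unfolding S1_def S2_def S3_def by (intro conv_mult conv_cst conv_shiftu conv_diff conv0 conv_Xu)+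
  let ?a1 = "\<lambda>(s::real) (z::wser^3). vm (rescaled s) P - vm of_real p"
  let ?a2 = "\<lambda>(s::real) (z::wser^3). rescaled s (cst (1/2) * Xu) *s z"
  let ?a3 = "\<lambda>(s::real) (z::wser^3). vm (rescaled s) (vm du P) - vm of_real r'"
  have f1: "fam 1 1 (\<lambda>s z. ?a1 s z $ k)" for k
    using fam_data(2)[OF convP, of 1 k] by (simp add: P0)
  have f3: "fam 1 1 (\<lambda>s z. ?a3 s z $ k)" for k
    using fam_data(2)[OF conv_du[OF convP], of 1 k] by (simp add: dP0 del: cf_du)
  have f2: "fam 1 1 (\<lambda>s z. ?a2 s z $ k)" for k
  proof -
    have "fam 1 1 (\<lambda>s (z::wser^3). rescaled s (cst (1/2) * Xu))"
      using fam_data(2)[OF convS(4), of 1] by simp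
    from fam_mult[OF this fam_nth[of k], of 1 1] show ?thesis by simp
  qed
  obtain s1 where s1: "s1 > 0" "\<And>s. 0 < s \<and> s \<le> s1 \<Longrightarrow> \<exists>z. lp z (vm of_real p + ?a1 s z) = rescaled s S1 \<and>
     lp z (vm of_real l + ?a2 s z) = rescaled s S2 \<and> lp z (vm of_real r' + ?a3 s z) = rescaled s S3"
    using solve_in_frame[OF fr(1-3) r'l f1 f2 f3 fam_data(1)[OF convS(1)] fam_data(1)[OF convS(2)] fam_data(1)[OF convS(3)]]
    by blast
  have "finite ({S1, S2, S3, cst (1/2) * Xu} \<union> range (\<lambda>k. P$k) \<union> range (\<lambda>k. du (P$k)))" by simp
  note fin = this
  have "conv a" if "a \<in> {S1, S2, S3, cst (1/2) * Xu} \<union> range (\<lambda>k. P$k) \<union> range (\<lambda>k. du (P$k))" for a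
    using that convS convP conv_du[OF convP] by auto
  from conv_finite[OF fin this] obtain s2 where s2: "s2 > 0" "\<And>s. 0 < s \<and> s \<le> s2 \<Longrightarrow>
     \<forall>a\<in>{S1, S2, S3, cst (1/2) * Xu} \<union> range (\<lambda>k. P$k) \<union> range (\<lambda>k. du (P$k)). wsum (scl s (s\<^sup>2) a)"
    by blast
  define s where "s = min s1 s2"
  have s: "s > 0" using s1 s2 by (simp add: s_def)
  have "\<forall>a\<in>{S1, S2, S3, cst (1/2) * Xu} \<union> range (\<lambda>k. P$k) \<union> range (\<lambda>k. du (P$k)). wsum (scl s (s\<^sup>2) a)"
    using s by (intro s2(2)) (simp add: s_def)
  then have w: "wsum (scl s (s\<^sup>2) S1)" "wsum (scl s (s\<^sup>2) S2)" "wsum (scl s (s\<^sup>2) S3)" "wsum (scl s (s\<^sup>2) (cst (1/2) * Xu))"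
     "\<And>k. wsum (scl s (s\<^sup>2) (P$k))" "\<And>k. wsum (scl s (s\<^sup>2) (du (P$k)))"
    by blast+
  obtain z where z: "lp z (vm of_real p + ?a1 s z) = rescaled s S1" "lp z (vm of_real l + ?a2 s z) = rescaled s S2"
      "lp z (vm of_real r' + ?a3 s z) = rescaled s S3"
    using s1(2)[of s] s by (auto simp: s_def)
  define \<zeta> where "\<zeta> = vm (unscl s) z"
  have \<zeta>: "vm (scl s (s\<^sup>2)) \<zeta> = vm ser z" by (simp add: vec_eq_iff \<zeta>_def scl_unscl s)
  have conv\<zeta>: "conv (\<zeta>$k)" for k by (simp add: \<zeta>_def conv_unscl_ser s)
  have E1: "lp \<zeta> P = S1"
  proof (rule vm_scl_lp_cancel[OF s])
    have "vm ser (vm of_real p + ?a1 s z) = vm (scl s (s\<^sup>2)) P"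
      by (simp add: vec_eq_iff ser_hom ser_of_real ser_rescaled w)
    with arg_cong[OF z(1), of ser] show "lp (vm (scl s (s\<^sup>2)) \<zeta>) (vm (scl s (s\<^sup>2)) P) = scl s (s\<^sup>2) S1"
      by (simp only: ser_lp \<zeta> ser_rescaled[OF w(1)])
  qed
  have E3: "lp \<zeta> (vm du P) = S3"
  proof (rule vm_scl_lp_cancel[OF s])
    have "vm ser (vm of_real r' + ?a3 s z) = vm (scl s (s\<^sup>2)) (vm du P)"
      by (simp add: vec_eq_iff ser_hom ser_of_real ser_rescaled w)
    with arg_cong[OF z(3), of ser] show "lp (vm (scl s (s\<^sup>2)) \<zeta>) (vm (scl s (s\<^sup>2)) (vm du P)) = scl s (s\<^sup>2) S3"
      by (simp only: ser_lp \<zeta> ser_rescaled[OF w(3)])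
  qed
  have E2: "lp \<zeta> (cv l + (cst (1/2) * Xu) *s \<zeta>) = S2"
  proof (rule vm_scl_lp_cancel[OF s])
    have "scl s (s\<^sup>2) (\<zeta>$k) = ser (z$k)" for k using \<zeta> by (simp add: vec_eq_iff)
    then have "vm ser (vm of_real l + ?a2 s z) = vm (scl s (s\<^sup>2)) (cv l + (cst (1/2) * Xu) *s \<zeta>)"
      using ser_rescaled[OF w(4)] by (simp add: vec_eq_iff ser_hom ser_of_real)
    with arg_cong[OF z(2), of ser] show "lp (vm (scl s (s\<^sup>2)) \<zeta>) (vm (scl s (s\<^sup>2)) (cv l + (cst (1/2) * Xu) *s \<zeta>)) = scl s (s\<^sup>2) S2"
      by (simp only: ser_lp \<zeta> ser_rescaled[OF w(2)])
  qed
  \<comment> \<open>the unknown lives in two variables; its restriction to \<open>v = 0\<close> solves the same equations\<close>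
  define \<xi>0 where "\<xi>0 = cv l + Xu *s \<zeta>"
  define \<xi> where "\<xi> = vm res \<xi>0"
  have X1: "lp \<xi>0 P = F0" and X3: "lp \<xi>0 (vm du P) = M0"
    by (simp_all add: \<xi>0_def lp_linear E1 E3 US)
  have "lp \<xi>0 \<xi>0 = Xu * (S2 + S2)"
  proof -
    define h where "h = cst (1/2)"
    have h: "h + h = 1" unfolding h_def cst_simps(3)[symmetric] by simp
    have S2: "S2 = lp \<zeta> (cv l) + h * Xu * lp \<zeta> \<zeta>" unfolding E2[symmetric] by (simp add: lp_linear h_def)
    have "lp \<xi>0 \<xi>0 = lp (cv l) (cv l) + Xu * (lp \<zeta> (cv l) + lp \<zeta> (cv l) + Xu * lp \<zeta> \<zeta>)"
      by (simp add: \<xi>0_def lp_linear lp_commute[of "cv l" \<zeta>] algebra_simps)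
    also have "lp (cv l) (cv l) = 0" using fr(3) by (simp add: lp_cv)
    also have "Xu * lp \<zeta> \<zeta> = (h + h) * (Xu * lp \<zeta> \<zeta>)" unfolding h by simp
    finally show ?thesis unfolding S2 by (simp add: algebra_simps)
  qed
  also have "S2 + S2 = shiftu G0"
  proof -
    have "cst (1/2) + cst (1/2) = 1" unfolding cst_simps(3)[symmetric] by simp
    then show ?thesis unfolding S2_def distrib_right[symmetric] by simp
  qed
  finally have X2: "lp \<xi>0 \<xi>0 = G0" by (simp only: US)
  show thesis
  proof (rule that)
    show "conv (P$k)" "res (P$k) = P$k" "cf (P$k) 0 0 = p$k" for k by (rule convP resP P0)+
    show "conv (\<xi>$k)" for k
      by (simp add: \<xi>_def \<xi>0_def) (intro conv_add conv_mult conv_res conv_cst conv_Xu conv\<zeta>)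
    show "res (\<xi>$k) = \<xi>$k" for k by (simp add: \<xi>_def)
    show "lp P P = res (lp (vm du F) (vm du F))" by (simp add: PP res_lp q_def)
    show "lp \<xi> P = res (lp (vm dv F) (vm du F))"
      using arg_cong[OF X1, of res] by (simp add: res_lp rr \<xi>_def[symmetric] vresP F0_def)
    show "lp \<xi> \<xi> = res (lp (vm dv F) (vm dv F))"
      using arg_cong[OF X2, of res] by (simp add: res_lp rr \<xi>_def[symmetric] G0_def)
    show "lp \<xi> (vm du P) = res (lp (vm dv F) (vm du (vm du F)))"
      using arg_cong[OF X3, of res] by (simp add: res_lp rr \<xi>_def[symmetric] vresP M0_def)
    show "cf (\<xi>$k) 0 0 = l$k" for k
      by (simp add: \<xi>_def \<xi>0_def cf_00_mult cf_cst cf_res)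
    show "cf (du (P$k)) 0 0 = (r - lprod p p *\<^sub>R l) $ k" for k
      using dP0[of k] unfolding r'_def e_def .
  qed
qed

section \<open>The Cauchy problem for isometric immersions\<close>

lemma double_inj:
  assumes "a + a = b + b"
  shows "a = (b :: real fps fps)"
proof (rule ser_eqI)
  fix i j
  have "cf a i j + cf a i j = cf b i j + cf b i j"
    using arg_cong[OF assms, of "\<lambda>x. cf x i j"] by (simp only: cf_simps(2))
  then show "cf a i j = cf b i j" by linarith
qed

text \<open>
  Both sides of each claim agree on \<open>v = 0\<close>, so it is enough to compare their derivatives in \<open>v\<close>. These are
  expressed by the three equations and by derivatives in \<open>u\<close> of the products treated before, in the order
  \<open>\<langle>G\<^sub>v, G\<^sub>v\<rangle>\<close>, \<open>\<langle>G\<^sub>v, G\<^sub>u\<rangle>\<close>, \<open>\<langle>G\<^sub>v, G\<^sub>u\<^sub>u\<rangle>\<close>, \<open>\<langle>G\<^sub>u, G\<^sub>u\<rangle>\<close>.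
\<close>

lemma isometric_if_normal_equations:
  fixes F G :: "real fps fps ^ 3"
  defines "Fu \<equiv> vm du F" and "Fv \<equiv> vm dv F" and "Gu \<equiv> vm du G" and "Gv \<equiv> vm dv G"
  assumes e1: "lp (vm dv Gv) Gu = lp (vm dv Fv) Fu" and e2: "lp (vm dv Gv) Gv = lp (vm dv Fv) Fv"
    and e3: "lp (vm dv Gv) (vm du Gu) - lp (vm du Gv) (vm du Gv) = lp (vm dv Fv) (vm du Fu) - lp (vm du Fv) (vm du Fv)"
    and r: "res (lp Gu Gu) = res (lp Fu Fu)" "res (lp Gv Gu) = res (lp Fv Fu)" "res (lp Gv Gv) = res (lp Fv Fv)"
      "res (lp Gv (vm du Gu)) = res (lp Fv (vm du Fu))"
  shows "lp Gu Gu = lp Fu Fu" "lp Gv Gu = lp Fv Fu" "lp Gv Gv = lp Fv Fv"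
proof -
  have zero: "a = b" if "dv a = dv b" "res a = res b" for a b
    using dv_res_zero[of "a - b"] that by simp
  have sw: "vm dv Gu = vm du Gv" "vm dv Fu = vm du Fv" "vm dv (vm du Gu) = vm du (vm du Gv)" "vm dv (vm du Fu) = vm du (vm du Fv)"
    by (simp_all add: Gu_def Gv_def Fu_def Fv_def vec_eq_iff du_dv)
  show vv: "lp Gv Gv = lp Fv Fv"
    by (rule zero) (simp_all only: dv_lp e2 lp_commute[of Gv "vm dv Gv"] lp_commute[of Fv "vm dv Fv"] r)
  have uv: "lp (vm du Gv) Gv = lp (vm du Fv) Fv"
    by (rule double_inj)
      (use arg_cong[OF vv, of du] in \<open>simp only: du_lp lp_commute[of Gv "vm du Gv"] lp_commute[of Fv "vm du Fv"]\<close>)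
  show vu: "lp Gv Gu = lp Fv Fu"
    by (rule zero) (simp_all only: dv_lp sw e1 uv lp_commute[of Gv "vm du Gv"] lp_commute[of Fv "vm du Fv"] r)
  have n: "lp Gv (vm du Gu) = lp Fv (vm du Fu)"
  proof (rule zero)
    have *: "lp Gv (vm du (vm du Gv)) + lp (vm du Gv) (vm du Gv) = lp Fv (vm du (vm du Fv)) + lp (vm du Fv) (vm du Fv)"
      using arg_cong[OF uv, of du]
      by (simp only: du_lp lp_commute[of "vm du (vm du Gv)" Gv] lp_commute[of "vm du (vm du Fv)" Fv])
    have "dv (lp Gv (vm du Gu)) = (lp (vm dv Gv) (vm du Gu) - lp (vm du Gv) (vm du Gv)) + (lp Gv (vm du (vm du Gv)) + lp (vm du Gv) (vm du Gv))"
      by (simp add: dv_lp sw)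
    also have "\<dots> = (lp (vm dv Fv) (vm du Fu) - lp (vm du Fv) (vm du Fv)) + (lp Fv (vm du (vm du Fv)) + lp (vm du Fv) (vm du Fv))"
      by (simp only: e3 *)
    also have "\<dots> = dv (lp Fv (vm du Fu))"
      by (simp add: dv_lp sw)
    finally show "dv (lp Gv (vm du Gu)) = dv (lp Fv (vm du Fu))" .
  qed (rule r)
  have "lp (vm du Gv) Gu + lp Gv (vm du Gu) = lp (vm du Fv) Fu + lp Fv (vm du Fu)"
    using arg_cong[OF vu, of du] by (simp only: du_lp)
  then have uuv: "lp (vm du Gv) Gu = lp (vm du Fv) Fu" unfolding n by simp
  show "lp Gu Gu = lp Fu Fu"
    by (rule zero) (simp_all only: dv_lp sw uuv lp_commute[of Gu "vm du Gv"] lp_commute[of Fu "vm du Fv"] r)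
qed


text \<open>
  On the Banach algebra: integration in \<open>v\<close>, and the operator \<open>\<partial>\<^sub>u \<integral> dv\<close> of norm at most one.
\<close>

lift_definition wI :: "wser \<Rightarrow> wser" is iv by (rule wsum_iv)
lift_definition wA :: "wser \<Rightarrow> wser" is "\<lambda>a. du (iv a)" by (rule wsum_du_iv)

lemma norm_wI: "norm (wI a) \<le> norm a" and norm_wA: "norm (wA a) \<le> norm a"
  by (transfer, erule wsum_iv wsum_du_iv)+

lemma wI_diff: "wI (a - b) = wI a - wI b" and wA_diff: "wA (a - b) = wA a - wA b"
  by (transfer, simp add: iv_linear)+

text \<open>
  The unknown is \<open>h = G\<^sub>v\<^sub>v\<close>. All other second derivatives of \<open>G\<close> are the initial data plus \<open>\<partial>\<^sub>u \<integral> dv\<close> applied at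
  most twice to \<open>h\<close>, so after rescaling they depend on \<open>h\<close> with a Lipschitz constant of order \<open>s\<close>, and the three
  equations for \<open>h\<close> are a small perturbation of a linear system in the frame \<open>p, l, r - \<langle>p, p\<rangle> l\<close>.
\<close>

lemma isometric_deformation_series:
  fixes F :: "real fps fps ^ 3" and p l r :: "real^3"
  assumes F: "\<And>k. conv (F$k)"
    and p: "\<And>k. cf (du (F$k)) 0 0 = p$k" and l: "\<And>k. cf (dv (F$k)) 0 0 = l$k"
    and r: "\<And>k. cf (du (du (F$k))) 0 0 = r$k"
    and fr: "lprod p p \<noteq> 0" "lprod p l = 0" "lprod l l = 0" "lprod r l \<noteq> 0"
  obtains G :: "real fps fps ^ 3" where "\<And>k. conv (G$k)"
    "lp (vm du G) (vm du G) = lp (vm du F) (vm du F)"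
    "lp (vm dv G) (vm du G) = lp (vm dv F) (vm du F)"
    "lp (vm dv G) (vm dv G) = lp (vm dv F) (vm dv F)"
    "\<And>k. cf (du (G$k)) 0 0 = p$k" "\<And>k. cf (dv (G$k)) 0 0 = l$k"
    "\<And>k. cf (du (du (G$k))) 0 0 = (r - lprod p p *\<^sub>R l) $ k"
proof (rule initial_data[OF F p l r fr])
  fix P \<xi> :: "real fps fps ^ 3"
  assume convP: "\<And>k. conv (P$k)" and conv\<xi>: "\<And>k. conv (\<xi>$k)"
    and resP: "\<And>k. res (P$k) = P$k" and res\<xi>: "\<And>k. res (\<xi>$k) = \<xi>$k"
    and data: "lp P P = res (lp (vm du F) (vm du F))" "lp \<xi> P = res (lp (vm dv F) (vm du F))"
      "lp \<xi> \<xi> = res (lp (vm dv F) (vm dv F))" "lp \<xi> (vm du P) = res (lp (vm dv F) (vm du (vm du F)))"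
    and P0: "\<And>k. cf (P$k) 0 0 = p$k" and \<xi>0: "\<And>k. cf (\<xi>$k) 0 0 = l$k"
    and dP0: "\<And>k. cf (du (P$k)) 0 0 = (r - lprod p p *\<^sub>R l) $ k"
  define r' where "r' = r - lprod p p *\<^sub>R l"
  have r'l: "lprod r' l \<noteq> 0"
  proof -
    have "lprod r' l = lprod r l - lprod p p * lprod l l" by (simp add: r'_def lprod_def algebra_simps)
    then show ?thesis using fr by simp
  qed
  \<comment> \<open>\<open>Pd\<close>, \<open>\<xi>\<close>, \<open>Rd\<close>, \<open>\<xi>\<^sub>u\<close> are \<open>G\<^sub>u\<close>, \<open>G\<^sub>v\<close>, \<open>G\<^sub>u\<^sub>u\<close>, \<open>G\<^sub>u\<^sub>v\<close> for \<open>G\<^sub>v\<^sub>v = 0\<close>; the \<open>K\<close>s are the right hand sides\<close>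
  define Pd where "Pd = P + Xv *s vm du \<xi>"
  define Rd where "Rd = vm du P + Xv *s vm du (vm du \<xi>)"
  define K1 where "K1 = lp (vm dv (vm dv F)) (vm du F)"
  define K2 where "K2 = lp (vm dv (vm dv F)) (vm dv F)"
  define K3 where "K3 = lp (vm dv (vm dv F)) (vm du (vm du F)) - lp (vm du (vm dv F)) (vm du (vm dv F))"
  have convd: "conv (vm du F $ k)" "conv (vm dv F $ k)" "conv (vm du (vm du F) $ k)" "conv (vm dv (vm dv F) $ k)"
    "conv (vm du (vm dv F) $ k)" "conv (vm du \<xi> $ k)" "conv (vm du (vm du \<xi>) $ k)" "conv (vm du P $ k)" for k
    by (simp_all add: conv_du conv_dv F conv\<xi> convP)
  have convPd: "conv (Pd$k)" and convRd: "conv (Rd$k)" for k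
    unfolding Pd_def Rd_def vector_add_component vector_smult_component
    by (intro conv_add conv_mult conv_Xv convP convd)+
  have convK: "conv K1" "conv K2" "conv K3"
    unfolding K1_def K2_def K3_def by (intro conv_diff conv_lp convd)+
  have Pd0: "cf (Pd$k) 0 0 = p$k" and Rd0: "cf (Rd$k) 0 0 = r'$k" for k
    using P0[of k] dP0[of k] by (simp_all add: Pd_def Rd_def cf_00_mult r'_def del: cf_du)
  \<comment> \<open>\<open>G\<^sub>u\<close>, \<open>G\<^sub>v\<close>, \<open>G\<^sub>u\<^sub>u\<close> and \<open>G\<^sub>u\<^sub>v\<close> after rescaling, the first three without their values at the origin\<close>
  let ?a1 = "\<lambda>(s::real) (z::wser^3). (vm (rescaled s) Pd - vm of_real p) + (\<chi> k. s ^ 3 *\<^sub>R wI (wA (z$k)))"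
  let ?a2 = "\<lambda>(s::real) (z::wser^3). (vm (rescaled s) \<xi> - vm of_real l) + (\<chi> k. s\<^sup>2 *\<^sub>R wI (z$k))"
  let ?a3 = "\<lambda>(s::real) (z::wser^3). (vm (rescaled s) Rd - vm of_real r') + (\<chi> k. s\<^sup>2 *\<^sub>R wA (wA (z$k)))"
  let ?w = "\<lambda>(s::real) (z::wser^3). \<chi> k. rescaled s (du (\<xi>$k)) + s *\<^sub>R wA (z$k)"
  have L: "fam k' l' (\<lambda>s (z::wser^3). s ^ n *\<^sub>R f (z$k))"
    if "k' \<le> n" "l' \<le> n" "\<And>a. norm (f a) \<le> norm a" "\<And>a b. f (a - b) = f a - f b" for f n k' l' k
    by (rule fam_bounded[OF fam_nth, of _ n _ "\<lambda>s a. s ^ n *\<^sub>R f a" 1])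
      (use that in \<open>auto simp: scaleR_diff_right mult_left_mono\<close>)
  have nIA: "norm (wI (wA a)) \<le> norm a" "norm (wA (wA a)) \<le> norm a" for a
    using norm_wI[of "wA a"] norm_wA[of "wA a"] norm_wA[of a] by linarith+
  have f1: "fam 1 1 (\<lambda>s z. ?a1 s z $ k)" for k
  proof -
    have "fam 1 1 (\<lambda>s (z::wser^3). (rescaled s (Pd$k) - of_real (p$k)) + s ^ 3 *\<^sub>R wI (wA (z$k)))"
      using fam_data(2)[OF convPd, of 1 k] by (intro fam_add L) (simp_all add: Pd0 wI_diff wA_diff nIA)
    then show ?thesis by simp
  qed
  have f2: "fam 1 1 (\<lambda>s z. ?a2 s z $ k)" for k
  proof -
    have "fam 1 1 (\<lambda>s (z::wser^3). (rescaled s (\<xi>$k) - of_real (l$k)) + s ^ 2 *\<^sub>R wI (z$k))"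
      using fam_data(2)[OF conv\<xi>, of 1 k] by (intro fam_add L) (simp_all add: \<xi>0 wI_diff norm_wI)
    then show ?thesis by simp
  qed
  have f3: "fam 1 1 (\<lambda>s z. ?a3 s z $ k)" for k
  proof -
    have "fam 1 1 (\<lambda>s (z::wser^3). (rescaled s (Rd$k) - of_real (r'$k)) + s ^ 2 *\<^sub>R wA (wA (z$k)))"
      using fam_data(2)[OF convRd, of 1 k] by (intro fam_add L) (simp_all add: Rd0 wA_diff nIA)
    then show ?thesis by simp
  qed
  have fw: "fam 0 1 (\<lambda>s z. ?w s z $ k)" for k
  proof -
    have "fam 0 1 (\<lambda>s (z::wser^3). rescaled s (du (\<xi>$k)) + s ^ 1 *\<^sub>R wA (z$k))"
      using fam_data(1)[OF conv_du[OF conv\<xi>], of 1 k] by (intro fam_add L) (simp_all add: wA_diff norm_wA)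
    then show ?thesis by simp
  qed
  have fr3: "fam 0 1 (\<lambda>s z. rescaled s K3 + lp (?w s z) (?w s z))"
    by (intro fam_add fam_data(1) convK fam_lp[OF fw fw]) simp_all
  obtain s1 where s1: "s1 > 0" "\<And>s. 0 < s \<and> s \<le> s1 \<Longrightarrow> \<exists>z. lp z (vm of_real p + ?a1 s z) = rescaled s K1 \<and>
     lp z (vm of_real l + ?a2 s z) = rescaled s K2 \<and> lp z (vm of_real r' + ?a3 s z) = rescaled s K3 + lp (?w s z) (?w s z)"
    using solve_in_frame[OF fr(1-3) r'l f1 f2 f3 fam_data(1)[OF convK(1)] fam_data(1)[OF convK(2)] fr3] by blast
  have "finite ({K1, K2, K3} \<union> range (\<lambda>k. Pd$k) \<union> range (\<lambda>k. \<xi>$k) \<union> range (\<lambda>k. Rd$k) \<union> range (\<lambda>k. du (\<xi>$k)))" by simp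
  note fin = this
  have "conv a" if "a \<in> {K1, K2, K3} \<union> range (\<lambda>k. Pd$k) \<union> range (\<lambda>k. \<xi>$k) \<union> range (\<lambda>k. Rd$k) \<union> range (\<lambda>k. du (\<xi>$k))" for a
    using that convK convPd conv\<xi> convRd conv_du[OF conv\<xi>] by auto
  from conv_finite[OF fin this] obtain s2 where s2: "s2 > 0" "\<And>s. 0 < s \<and> s \<le> s2 \<Longrightarrow>
     \<forall>a\<in>{K1, K2, K3} \<union> range (\<lambda>k. Pd$k) \<union> range (\<lambda>k. \<xi>$k) \<union> range (\<lambda>k. Rd$k) \<union> range (\<lambda>k. du (\<xi>$k)). wsum (scl s (s\<^sup>2) a)"
    by blast
  define s where "s = min s1 s2"
  have s: "s > 0" using s1 s2 by (simp add: s_def)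
  have w: "wsum (scl s (s\<^sup>2) K1)" "wsum (scl s (s\<^sup>2) K2)" "wsum (scl s (s\<^sup>2) K3)"
     "\<And>k. wsum (scl s (s\<^sup>2) (Pd$k))" "\<And>k. wsum (scl s (s\<^sup>2) (\<xi>$k))" "\<And>k. wsum (scl s (s\<^sup>2) (Rd$k))"
     "\<And>k. wsum (scl s (s\<^sup>2) (du (\<xi>$k)))"
    using s2(2)[of s] s by (auto simp: s_def)
  obtain z where z: "lp z (vm of_real p + ?a1 s z) = rescaled s K1" "lp z (vm of_real l + ?a2 s z) = rescaled s K2"
      "lp z (vm of_real r' + ?a3 s z) = rescaled s K3 + lp (?w s z) (?w s z)"
    using s1(2)[of s] s by (auto simp: s_def)
  define h where "h = vm (unscl s) z"
  have h: "vm (scl s (s\<^sup>2)) h = vm ser z" by (simp add: vec_eq_iff h_def scl_unscl s)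
  have hk: "ser (z$k) = scl s (s\<^sup>2) (h$k)" for k using h by (simp add: vec_eq_iff)
  have convh: "conv (h$k)" for k by (simp add: h_def conv_unscl_ser s)
  define Gu where "Gu = Pd + vm (\<lambda>a. iv (du (iv a))) h"
  define Gv where "Gv = \<xi> + vm iv h"
  define Guu where "Guu = Rd + vm (\<lambda>a. du (iv (du (iv a)))) h"
  define Guv where "Guv = vm du \<xi> + vm (\<lambda>a. du (iv a)) h"
  have cs: "cst (s ^ 3) * x = cst (s\<^sup>2) * (cst s * x)" "cst (s\<^sup>2) * x = cst s * (cst s * x)" for x
    unfolding mult.assoc[symmetric] cst_simps(5)[symmetric] by (simp_all add: power2_eq_square power3_eq_cube mult.assoc)
  have E1: "lp h Gu = K1"
  proof (rule vm_scl_lp_cancel[OF s])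
    have "vm ser (vm of_real p + ?a1 s z) = vm (scl s (s\<^sup>2)) Gu"
      by (simp add: vec_eq_iff ser_hom ser_of_real ser_rescaled w Gu_def wI.rep_eq wA.rep_eq hk scl_iv scl_du_iv cs(1) iv_linear del: cst_simps)
    with arg_cong[OF z(1), of ser] show "lp (vm (scl s (s\<^sup>2)) h) (vm (scl s (s\<^sup>2)) Gu) = scl s (s\<^sup>2) K1"
      by (simp only: ser_lp h ser_rescaled[OF w(1)])
  qed
  have E2: "lp h Gv = K2"
  proof (rule vm_scl_lp_cancel[OF s])
    have "vm ser (vm of_real l + ?a2 s z) = vm (scl s (s\<^sup>2)) Gv"
      by (simp add: vec_eq_iff ser_hom ser_of_real ser_rescaled w Gv_def wI.rep_eq hk scl_iv del: cst_simps)
    with arg_cong[OF z(2), of ser] show "lp (vm (scl s (s\<^sup>2)) h) (vm (scl s (s\<^sup>2)) Gv) = scl s (s\<^sup>2) K2"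
      by (simp only: ser_lp h ser_rescaled[OF w(2)])
  qed
  have E3: "lp h Guu = K3 + lp Guv Guv"
  proof (rule vm_scl_lp_cancel[OF s])
    have 1: "vm ser (vm of_real r' + ?a3 s z) = vm (scl s (s\<^sup>2)) Guu"
      by (simp add: vec_eq_iff ser_hom ser_of_real ser_rescaled w Guu_def wA.rep_eq hk scl_du_iv cs(2) iv_linear del: cst_simps)
    have 2: "vm ser (?w s z) = vm (scl s (s\<^sup>2)) Guv"
      by (simp add: vec_eq_iff ser_hom ser_rescaled w Guv_def wA.rep_eq hk scl_du_iv del: cst_simps)
    show "lp (vm (scl s (s\<^sup>2)) h) (vm (scl s (s\<^sup>2)) Guu) = scl s (s\<^sup>2) (K3 + lp Guv Guv)"
      using arg_cong[OF z(3), of ser]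
      by (simp only: ser_lp ser_hom h 1 2 ser_rescaled[OF w(3)] scl_lp scl_linear)
  qed
  \<comment> \<open>the map with initial values \<open>G\<^sub>u = P\<close>, \<open>G\<^sub>v = \<xi>\<close> on \<open>v = 0\<close> and \<open>G\<^sub>v\<^sub>v = h\<close>\<close>
  define G where "G = (\<chi> k. iu (P$k)) + Xv *s \<xi> + vm (\<lambda>a. iv (iv a)) h"
  have dv\<xi>: "dv (\<xi>$k) = 0" and dvP: "dv (P$k) = 0" "dv (iu (P$k)) = 0" for k
    using dv_res[of "\<xi>$k"] dv_res[of "P$k"] dv_res[of "iu (P$k)"] by (simp_all add: res\<xi> resP)
  have gu: "vm du G = Gu" by (simp add: vec_eq_iff G_def Gu_def Pd_def du_mult du_Xv du_iv)
  have gv: "vm dv G = Gv" by (simp add: vec_eq_iff G_def Gv_def dv_mult dv_Xv dv\<xi> dvP)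
  have guu: "vm du Gu = Guu" by (simp add: vec_eq_iff Gu_def Guu_def Pd_def Rd_def du_mult du_Xv)
  have guv: "vm du Gv = Guv" by (simp add: vec_eq_iff Gv_def Guv_def)
  have gvv: "vm dv Gv = h" by (simp add: vec_eq_iff Gv_def dv\<xi>)
  have rs: "vm res Gu = P" "vm res Gv = \<xi>" "vm res Guu = vm du P"
    by (simp_all add: vec_eq_iff Gu_def Gv_def Guu_def Pd_def Rd_def resP res\<xi> res_du)
  note iso = isometric_if_normal_equations[of G F, unfolded gu gv guu guv gvv]
  have isom: "lp Gu Gu = lp (vm du F) (vm du F)" "lp Gv Gu = lp (vm dv F) (vm du F)" "lp Gv Gv = lp (vm dv F) (vm dv F)"
    by (rule iso; simp add: E1 E2 E3 K1_def K2_def K3_def res_lp rs data[unfolded res_lp])+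
  show thesis
  proof (rule that[of G])
    show "conv (G$k)" for k
      by (simp add: G_def) (intro conv_add conv_mult conv_iu conv_iv conv_Xv convP conv\<xi> convh)
    show "lp (vm du G) (vm du G) = lp (vm du F) (vm du F)" "lp (vm dv G) (vm du G) = lp (vm dv F) (vm du F)"
      "lp (vm dv G) (vm dv G) = lp (vm dv F) (vm dv F)" by (simp_all only: gu gv isom)
    have "du (G$k) = Gu$k" "dv (G$k) = Gv$k" "du (du (G$k)) = Guu$k" for k
      using gu gv guu by (metis vm_nth)+
    then show "cf (du (G$k)) 0 0 = p$k" "cf (dv (G$k)) 0 0 = l$k" "cf (du (du (G$k))) 0 0 = (r - lprod p p *\<^sub>R l) $ k" for k
      by (simp_all add: Gu_def Gv_def Guu_def Pd0 \<xi>0 Rd0 r'_def)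
  qed
qed

section \<open>From series to maps\<close>

abbreviation e1 :: "real^2" where "e1 \<equiv> axis 1 1"
abbreviation e2 :: "real^2" where "e2 \<equiv> axis 2 1"

lemma fd_e1: "h differentiable (at x) \<Longrightarrow> fd h x e1 $ k = partial 1 (\<lambda>y. h y $ k) x"
  and fd_e2: "h differentiable (at x) \<Longrightarrow> fd h x e2 $ k = partial 2 (\<lambda>y. h y $ k) x"
  for h :: "real^2 \<Rightarrow> real^'n"
  by (simp_all add: fd_nth partial_def)

lemma lprod_linear:
  "lprod (u + v) w = lprod u w + lprod v w" "lprod (u - v) w = lprod u w - lprod v w" "lprod (x *\<^sub>R u) w = x * lprod u w"
  "lprod w (u + v) = lprod w u + lprod w v" "lprod w (u - v) = lprod w u - lprod w v" "lprod w (x *\<^sub>R u) = x * lprod w u"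
  "lprod 0 w = 0" "lprod w 0 = 0"
  by (simp_all add: lprod_def algebra_simps)

lemma lprod_commute: "lprod u v = lprod v u"
  by (simp add: lprod_def mult.commute)

lemma ds2_commute: "ds2 h x u v = ds2 h x v u"
  by (simp add: ds2_def lprod_commute)

lemma ds2_linear:
  assumes "h differentiable (at x)"
  shows "ds2 h x (u + v) w = ds2 h x u w + ds2 h x v w" "ds2 h x (u - v) w = ds2 h x u w - ds2 h x v w"
    "ds2 h x (s *\<^sub>R u) w = s * ds2 h x u w"
    "ds2 h x w (u + v) = ds2 h x w u + ds2 h x w v" "ds2 h x w (u - v) = ds2 h x w u - ds2 h x w v"
    "ds2 h x w (s *\<^sub>R u) = s * ds2 h x w u"
  using linear_fd[OF assms]
  by (simp_all add: ds2_def linear_add linear_diff linear_cmul lprod_linear)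

lemma ds2_expand:
  assumes "h differentiable (at x)"
  shows "ds2 h x u v = u$1 * v$1 * ds2 h x e1 e1 + (u$1 * v$2 + u$2 * v$1) * ds2 h x e2 e1 + u$2 * v$2 * ds2 h x e2 e2"
proof -
  have "u = u$1 *\<^sub>R e1 + u$2 *\<^sub>R e2" "v = v$1 *\<^sub>R e1 + v$2 *\<^sub>R e2"
    by (simp_all add: vec_eq_iff forall_2 axis_def)
  then have "ds2 h x u v = ds2 h x (u$1 *\<^sub>R e1 + u$2 *\<^sub>R e2) (v$1 *\<^sub>R e1 + v$2 *\<^sub>R e2)" by simp
  then show ?thesis
    by (simp add: ds2_linear[OF assms] ds2_commute[of h x e1 e2] algebra_simps)
qed

text \<open>
  Dictionary between a map and its component series at the origin.
\<close>

lemma expansion_facts: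
  fixes h :: "real^2 \<Rightarrow> real^3" and F :: "real fps fps ^ 3"
  assumes F: "\<And>k. fexp (\<lambda>z. h z $ k) (F $ k)"
  shows "vana_at h 0" "\<And>k. fd h 0 e1 $ k = cf (du (F$k)) 0 0" "\<And>k. fd h 0 e2 $ k = cf (dv (F$k)) 0 0"
    "\<And>k. D2 h 0 e1 e1 $ k = cf (du (du (F$k))) 0 0"
    "fexp (\<lambda>z. ds2 h z e1 e1) (lp (vm du F) (vm du F))"
    "fexp (\<lambda>z. ds2 h z e2 e1) (lp (vm dv F) (vm du F))"
    "fexp (\<lambda>z. ds2 h z e2 e2) (lp (vm dv F) (vm dv F))"
proof -
  show va: "vana_at h 0" unfolding vana_at_def ana_at_def using F by auto
  have near: "\<forall>\<^sub>F y in nhds 0. h differentiable (at y)"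
    using vana_at_near[OF va] by (rule eventually_mono) (rule vana_at_differentiable)
  have d0: "h differentiable (at 0)" by (rule vana_at_differentiable[OF va])
  have f1: "fexp (partial 1 (\<lambda>z. h z $ k)) (du (F$k))" and f2: "fexp (partial 2 (\<lambda>z. h z $ k)) (dv (F$k))" for k
    using fexp_partial[OF F[of k]] by auto
  have g1: "fexp (\<lambda>y. fd h y e1 $ k) (du (F$k))" for k
    by (rule fexp_cong[OF f1]) (use near in \<open>auto elim!: eventually_mono simp: fd_e1\<close>)
  have g2: "fexp (\<lambda>y. fd h y e2 $ k) (dv (F$k))" for k
    by (rule fexp_cong[OF f2]) (use near in \<open>auto elim!: eventually_mono simp: fd_e2\<close>)
  show "fd h 0 e1 $ k = cf (du (F$k)) 0 0" "fd h 0 e2 $ k = cf (dv (F$k)) 0 0" for k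
    by (rule fexp_at_0[OF g1] fexp_at_0[OF g2])+
  show "D2 h 0 e1 e1 $ k = cf (du (du (F$k))) 0 0" for k
  proof -
    have "(\<lambda>y. fd h y e1) differentiable (at 0)"
      by (intro vana_at_differentiable vana_at_fd va vana_at_const)
    then have "D2 h 0 e1 e1 $ k = partial 1 (\<lambda>y. fd h y e1 $ k) 0" unfolding D2_def by (rule fd_e1)
    also have "\<dots> = cf (du (du (F$k))) 0 0" by (rule fexp_at_0[OF fexp_partial(1)[OF g1]])
    finally show ?thesis .
  qed
  show "fexp (\<lambda>z. ds2 h z e1 e1) (lp (vm du F) (vm du F))"
    "fexp (\<lambda>z. ds2 h z e2 e1) (lp (vm dv F) (vm du F))"
    "fexp (\<lambda>z. ds2 h z e2 e2) (lp (vm dv F) (vm dv F))"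
    unfolding ds2_def lprod_def lp_def vm_nth by (intro fexp_add fexp_diff fexp_mult g1 g2)+
qed

lemma ds2_compose:
  assumes "h differentiable (at (\<theta> y))" "\<theta> differentiable (at y)"
  shows "ds2 (\<lambda>x. h (\<theta> x)) y u v = ds2 h (\<theta> y) (fd \<theta> y u) (fd \<theta> y v)"
  by (simp add: ds2_def fd_compose[OF assms])

lemma ds2_cong: "\<forall>\<^sub>F y in nhds x. f y = g y \<Longrightarrow> ds2 f x = ds2 g x"
  by (simp add: ds2_def fun_eq_iff fd_cong)

lemma tendsto_differentiable:
  assumes "\<theta> differentiable (at a)" "\<forall>\<^sub>F y in nhds (\<theta> a). P y"
  shows "\<forall>\<^sub>F x in nhds a. P (\<theta> x)"
proof -
  have "(\<theta> \<longlongrightarrow> \<theta> a) (nhds a)"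
    using differentiable_imp_continuous_within[OF assms(1)] by (simp add: isCont_def tendsto_nhds_iff)
  then show ?thesis using assms(2) by (auto simp: filterlim_iff)
qed

text \<open>
  Coordinates in the basis \<open>a, w\<close> reduce the claim to series at the origin. The conditions on \<open>a\<close> and \<open>w\<close> are the
  frame conditions; the last one is the non-vanishing of the lightlike singular curvature.
\<close>

lemma isometric_deformation_local:
  fixes h :: "real^2 \<Rightarrow> real^3" and a w :: "real^2"
  assumes h: "vana_at h x" and aw: "a$1 * w$2 - a$2 * w$1 \<noteq> 0"
    and fr: "ds2 h x a a \<noteq> 0" "ds2 h x a w = 0" "ds2 h x w w = 0" "lprod (D2 h x a a) (fd h x w) \<noteq> 0"
  obtains g :: "real^2 \<Rightarrow> real^3" where "vana_at g x" "\<forall>\<^sub>F y in nhds x. ds2 g y = ds2 h y"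
    "fd g x = fd h x" "D2 g x a a = D2 h x a a - ds2 h x a a *\<^sub>R fd h x w"
proof -
  define k where "k = 1 / (a$1 * w$2 - a$2 * w$1)"
  have k: "k * (a$1 * w$2 - a$2 * w$1) = 1" using aw by (simp add: k_def)
  \<comment> \<open>affine coordinates \<open>M\<close>, with inverse \<open>L\<close>, in which \<open>a\<close> and \<open>w\<close> are the coordinate directions at the origin\<close>
  define L where "L z = x + (z$1 *\<^sub>R a + z$2 *\<^sub>R w)" for z :: "real^2"
  define m1 m2 where "m1 y = (k * w$2) * (y$1 - x$1) - (k * w$1) * (y$2 - x$2)"
    and "m2 y = (k * a$1) * (y$2 - x$2) - (k * a$2) * (y$1 - x$1)" for y :: "real^2"
  define M where "M y = (vector [m1 y, m2 y] :: real^2)" for y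
  have L_M: "L (M y) = y" for y
  proof -
    have "m1 y * a$1 + m2 y * w$1 = k * (a$1 * w$2 - a$2 * w$1) * (y$1 - x$1)"
      "m1 y * a$2 + m2 y * w$2 = k * (a$1 * w$2 - a$2 * w$1) * (y$2 - x$2)"
      unfolding m1_def m2_def by algebra+
    then show ?thesis unfolding k by (simp add: L_def M_def vec_eq_iff forall_2)
  qed
  have M_L: "M (L z) = z" for z
  proof -
    have "m1 (L z) = k * (a$1 * w$2 - a$2 * w$1) * z$1" "m2 (L z) = k * (a$1 * w$2 - a$2 * w$1) * z$2"
      by (simp_all add: L_def m1_def m2_def algebra_simps)
    then show ?thesis unfolding k by (simp add: M_def vec_eq_iff forall_2)
  qed
  have M0: "M x = 0" using M_L[of 0] by (simp add: L_def)
  have L0: "L 0 = x" by (simp add: L_def)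
  have anaL: "vana_at L z" for z
    unfolding L_def by (intro vana_at_add vana_at_const vana_at_scaleR ana_at_coord)
  have "ana_at m1 y" "ana_at m2 y" for y
    unfolding m1_def m2_def by (intro ana_at_diff ana_at_mult ana_at_const ana_at_coord)+
  then have anaM: "vana_at M y" for y
    by (simp add: vana_at_def forall_2 M_def)
  define h0 where "h0 z = h (L z)" for z
  have h0: "vana_at h0 0" unfolding h0_def[abs_def] by (rule vana_at_compose[OF _ anaL]) (simp add: L0 h)
  have hM: "h y = h0 (M y)" for y by (simp add: h0_def L_M)
  have "\<exists>c. fexp (\<lambda>z. h0 z $ k) c" for k
    using h0 by (simp add: vana_at_def ana_at_def)
  then obtain F' where F': "\<And>k. fexp (\<lambda>z. h0 z $ k) (F' k)" by metis
  define F where "F = (\<chi> k. F' k)"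
  have F: "fexp (\<lambda>z. h0 z $ k) (F $ k)" for k using F' by (simp add: F_def)
  note hf = expansion_facts[OF F]
  \<comment> \<open>the jet of a map along the first axis is the jet of its transplant along \<open>a\<close>\<close>
  have jets: "fd (\<lambda>y. q (M y)) x a = fd q 0 e1" "fd (\<lambda>y. q (M y)) x w = fd q 0 e2"
    "D2 (\<lambda>y. q (M y)) x a a = D2 q 0 e1 e1"
    if q: "vana_at q 0" for q :: "real^2 \<Rightarrow> real^3"
  proof -
    have qM: "vana_at (\<lambda>y. q (M y)) x" by (rule vana_at_compose[OF _ anaM]) (simp add: M0 q)
    have la: "M (x + t *\<^sub>R a) = 0 + t *\<^sub>R e1" and lw: "M (x + t *\<^sub>R w) = 0 + t *\<^sub>R e2" for t
      using M_L[of "t *\<^sub>R e1"] M_L[of "t *\<^sub>R e2"] by (simp_all add: L_def axis_def)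
    have z: "fd q 0 0 = 0" "fd (\<lambda>y. q (M y)) x 0 = 0"
      using q qM by (simp_all add: linear_0 linear_fd vana_at_differentiable)
    note J = jet2_compose[OF vana_at_twice_diff[OF qM] jet2_line] jet2_compose[OF vana_at_twice_diff[OF q] jet2_line]
    have "fd (\<lambda>y. q (M y)) x a = fd q 0 e1 \<and> D2 (\<lambda>y. q (M y)) x a a + 0 = D2 q 0 e1 e1 + 0"
      using jet2_unique[OF J(1)[of a, unfolded la z] J(2)[of e1, unfolded z]] by blast
    then show "fd (\<lambda>y. q (M y)) x a = fd q 0 e1" "D2 (\<lambda>y. q (M y)) x a a = D2 q 0 e1 e1" by simp_all
    show "fd (\<lambda>y. q (M y)) x w = fd q 0 e2"
      using jet2_unique[OF J(1)[of w, unfolded lw z] J(2)[of e2, unfolded z]] by blast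
  qed
  have hM': "(\<lambda>y. h0 (M y)) = h" by (rule ext) (rule hM[symmetric])
  note hj = jets[OF h0, unfolded hM']
  define p l r where "p = fd h x a" and "l = fd h x w" and "r = D2 h x a a"
  show thesis
  proof (rule isometric_deformation_series[of F p l r])
    show "conv (F$k)" for k by (rule fexp_imp_conv[OF F])
    show "cf (du (F$k)) 0 0 = p$k" "cf (dv (F$k)) 0 0 = l$k" "cf (du (du (F$k))) 0 0 = r$k" for k
      unfolding p_def l_def r_def hj hf(2,3,4) by simp_all
    show "lprod p p \<noteq> 0" "lprod p l = 0" "lprod l l = 0" "lprod r l \<noteq> 0"
      using fr by (simp_all add: p_def l_def r_def ds2_def)
  next
    fix G :: "real fps fps ^ 3"
    assume convG: "\<And>k. conv (G$k)"
      and iso: "lp (vm du G) (vm du G) = lp (vm du F) (vm du F)"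
        "lp (vm dv G) (vm du G) = lp (vm dv F) (vm du F)" "lp (vm dv G) (vm dv G) = lp (vm dv F) (vm dv F)"
      and Gj: "\<And>k. cf (du (G$k)) 0 0 = p$k" "\<And>k. cf (dv (G$k)) 0 0 = l$k"
        "\<And>k. cf (du (du (G$k))) 0 0 = (r - lprod p p *\<^sub>R l) $ k"
    define g0 where "g0 z = (\<chi> k. evf (G$k) z)" for z
    have G: "fexp (\<lambda>z. g0 z $ k) (G$k)" for k
      using conv_imp_fexp[OF convG[of k]] by (simp add: g0_def)
    note gf = expansion_facts[OF G]
    define g where "g y = g0 (M y)" for y
    have g: "vana_at g x" unfolding g_def[abs_def] by (rule vana_at_compose[OF _ anaM]) (simp add: M0 gf(1))
    note gj = jets[OF gf(1), folded g_def[abs_def]]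
    have e: "fd g x a = p" "fd g x w = l" "D2 g x a a = r - lprod p p *\<^sub>R l"
      unfolding gj by (simp_all add: vec_eq_iff gf(2,3,4) Gj del: cf_du cf_dv)
    have basis: "v = m1 (x + v) *\<^sub>R a + m2 (x + v) *\<^sub>R w" for v
      using L_M[of "x + v"] by (simp add: L_def M_def)
    have fde: "fd g x = fd h x"
    proof
      fix v
      have "linear (fd g x)" "linear (fd h x)" using g h by (auto intro: linear_fd vana_at_differentiable)
      then have "fd g x (m1 (x + v) *\<^sub>R a + m2 (x + v) *\<^sub>R w) = fd h x (m1 (x + v) *\<^sub>R a + m2 (x + v) *\<^sub>R w)"
        by (simp add: linear_add linear_cmul e p_def l_def)
      then show "fd g x v = fd h x v" using basis[of v] by simp
    qed
    have near: "\<forall>\<^sub>F z in nhds 0. g0 differentiable (at z) \<and> h0 differentiable (at z) \<and> ds2 g0 z = ds2 h0 z"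
      using vana_at_near[OF gf(1)] vana_at_near[OF h0]
        fexp_same_series[OF gf(5)[unfolded iso] hf(5)] fexp_same_series[OF gf(6)[unfolded iso] hf(6)]
        fexp_same_series[OF gf(7)[unfolded iso] hf(7)]
    proof eventually_elim
      case (elim z)
      then have 1: "g0 differentiable (at z)" "h0 differentiable (at z)" by (auto intro: vana_at_differentiable)
      then have "ds2 g0 z u v = ds2 h0 z u v" for u v
        using ds2_expand[OF 1(1), of u v] ds2_expand[OF 1(2), of u v] elim by simp
      with 1 show ?case by (simp add: fun_eq_iff)
    qed
    have "\<forall>\<^sub>F y in nhds x. ds2 g y = ds2 h y"
      using tendsto_differentiable[OF vana_at_differentiable[OF anaM[of x]], unfolded M0, OF near]
    proof eventually_elim
      case (elim y)
      then have "ds2 (\<lambda>y. g0 (M y)) y u v = ds2 (\<lambda>y. h0 (M y)) y u v" for u v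
        using vana_at_differentiable[OF anaM[of y]] by (simp add: ds2_compose)
      then show ?case by (simp add: fun_eq_iff g_def[abs_def] hM')
    qed
    with g fde e(3) show thesis by (intro that[of g]) (simp_all add: p_def l_def r_def ds2_def)
  qed
qed

section \<open>Null vectors and transversal null vectors\<close>

text \<open>
  Among the vectors orthogonal to \<open>e\<close> with product 1 with \<open>l\<close>, which form a line of direction \<open>l\<close>, the
  scalar square is affine and not constant.
\<close>

lemma transversal_null_unique:
  fixes e l :: "real^3"
  assumes "lprod e e > 0" "lprod e l = 0" "lprod l l = 0" "l \<noteq> 0"
  shows "\<exists>!n. lprod n n = 0 \<and> lprod n e = 0 \<and> lprod n l = 1"
proof -
  have "\<exists>y. lprod y l \<noteq> 0"
  proof (rule ccontr)
    assume "\<not> ?thesis"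
    then have z: "lprod y l = 0" for y by auto
    have "l$k = 0" for k using z[of "axis k 1"] exhaust_3[of k] by (auto simp: lprod_def axis_def)
    then show False using assms(4) by (simp add: vec_eq_iff)
  qed
  then obtain y where y: "lprod y l \<noteq> 0" by blast
  have le: "lprod l e = 0" using assms(2) lprod_commute by metis
  define z where "z = (1 / lprod y l) *\<^sub>R (y - (lprod y e / lprod e e) *\<^sub>R e)"
  have z: "lprod z l = 1" "lprod z e = 0"
    using y assms by (simp_all add: z_def lprod_linear)
  define n where "n = z - (lprod z z / 2) *\<^sub>R l"
  have n: "lprod n n = 0" "lprod n e = 0" "lprod n l = 1"
    using z assms le by (simp_all add: n_def lprod_linear lprod_commute[of l z])
  have "lprod e e \<noteq> 0" "lprod e n = 0" "lprod n n = 0" "lprod l n \<noteq> 0"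
    using n assms lprod_commute[of e n] lprod_commute[of l n] by auto
  then obtain d1 d2 d3 where d: "lprod d1 e = 1" "lprod d1 n = 0" "lprod d1 l = 0"
    "lprod d2 e = 0" "lprod d2 n = 1" "lprod d2 l = 0" "lprod d3 e = 0" "lprod d3 n = 0" "lprod d3 l = 1"
    by (rule dual_frame)
  show ?thesis
  proof (rule ex1I[of _ n])
    show "lprod n n = 0 \<and> lprod n e = 0 \<and> lprod n l = 1" using n by simp
    fix m assume m: "lprod m m = 0 \<and> lprod m e = 0 \<and> lprod m l = 1"
    \<comment> \<open>the difference is orthogonal to \<open>e\<close> and \<open>l\<close>, hence a multiple of \<open>l\<close>\<close>
    define v where "v = (m - n) - lprod (m - n) n *\<^sub>R l"
    have v: "lprod v e = 0" "lprod v l = 0" "lprod v n = 0"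
      using m n assms le lprod_commute[of l n] by (simp_all add: v_def lprod_linear)
    define T where "T u = (vector [lprod u e, lprod u n, lprod u l] :: real^3)" for u
    have T: "linear T"
      by (intro linearI) (simp_all add: T_def lprod_linear vec_eq_iff forall_3)
    have "surj T"
    proof (rule surjI[where f = "\<lambda>t. t$1 *\<^sub>R d1 + t$2 *\<^sub>R d2 + t$3 *\<^sub>R d3"])
      show "T (t$1 *\<^sub>R d1 + t$2 *\<^sub>R d2 + t$3 *\<^sub>R d3) = t" for t
        by (simp add: T_def lprod_linear d vec_eq_iff forall_3)
    qed
    then have "inj T" by (rule linear_surj_imp_inj[OF T])
    moreover have "T v = T 0" by (simp add: T_def v lprod_linear)
    ultimately have "v = 0" by (rule injD)
    then have "m = n + lprod (m - n) n *\<^sub>R l" by (simp add: v_def algebra_simps)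
    moreover have "lprod (n + c *\<^sub>R l) (n + c *\<^sub>R l) = 2 * c" for c
      using n assms lprod_commute[of l n] by (simp add: lprod_linear)
    ultimately show "m = n" using m by (metis add.right_neutral mult_eq_0_iff scaleR_zero_left zero_neq_numeral)
  qed
qed

section \<open>The degenerate locus of the first fundamental form\<close>

lemma lam_eq: "lam h y = ds2 h y e1 e1 * ds2 h y e2 e2 - (ds2 h y e2 e1)\<^sup>2"
  by (simp add: lam_def metric_def ds2_commute[of h y e1 e2])

text \<open>
  Both sides are the determinant of the congruence transform of the metric by the matrix with columns
  \<open>u\<close> and \<open>v\<close>.
\<close>

lemma gram_det:
  assumes "h differentiable (at y)"
  shows "ds2 h y u u * ds2 h y v v - (ds2 h y u v)\<^sup>2 = (u$1 * v$2 - u$2 * v$1)\<^sup>2 * lam h y"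
  unfolding lam_eq ds2_expand[OF assms, of u u] ds2_expand[OF assms, of v v] ds2_expand[OF assms, of u v]
  by algebra

lemma det2_zero:
  fixes a w :: "real^2"
  assumes "a \<noteq> 0" "a$1 * w$2 - a$2 * w$1 = 0"
  shows "\<exists>s. w = s *\<^sub>R a"
proof (cases "a$1 = 0")
  case True
  then have "a$2 \<noteq> 0" "w$1 = 0" using assms by (auto simp: vec_eq_iff forall_2)
  then show ?thesis using True by (intro exI[of _ "w$2 / a$2"]) (simp add: vec_eq_iff forall_2)
next
  case False
  then have "w$2 = w$1 / a$1 * a$2" using assms(2) by (simp add: field_simps)
  then show ?thesis using False by (intro exI[of _ "w$1 / a$1"]) (simp add: vec_eq_iff forall_2)
qed

lemma det2_basis:
  fixes a w :: "real^2"
  assumes "a$1 * w$2 - a$2 * w$1 \<noteq> 0"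
  shows "\<exists>s t. v = s *\<^sub>R a + t *\<^sub>R w"
proof -
  define k where "k = 1 / (a$1 * w$2 - a$2 * w$1)"
  have k: "k * (a$1 * w$2 - a$2 * w$1) = 1" using assms by (simp add: k_def)
  have "(k * (v$1 * w$2 - v$2 * w$1)) * a$1 + (k * (a$1 * v$2 - a$2 * v$1)) * w$1 = k * (a$1 * w$2 - a$2 * w$1) * v$1"
    "(k * (v$1 * w$2 - v$2 * w$1)) * a$2 + (k * (a$1 * v$2 - a$2 * v$1)) * w$2 = k * (a$1 * w$2 - a$2 * w$1) * v$2"
    by algebra+
  then show ?thesis unfolding k
    by (intro exI[of _ "k * (v$1 * w$2 - v$2 * w$1)"] exI[of _ "k * (a$1 * v$2 - a$2 * v$1)"])
       (simp add: vec_eq_iff forall_2)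
qed

lemma degenerate_iff:
  assumes "h differentiable (at y)"
  shows "degenerate_form (ds2 h y) \<longleftrightarrow> lam h y = 0"
proof
  assume "degenerate_form (ds2 h y)"
  then obtain w where w: "w \<noteq> 0" "\<And>v. ds2 h y w v = 0" by (auto simp: degenerate_form_def)
  obtain v :: "real^2" where v: "v$1 * w$2 - v$2 * w$1 \<noteq> 0"
  proof -
    have "w$1 \<noteq> 0 \<or> w$2 \<noteq> 0" using w(1) by (auto simp: vec_eq_iff forall_2)
    then show thesis using that[of e1] that[of e2] by (auto simp: axis_def)
  qed
  show "lam h y = 0"
    using gram_det[OF assms, of v w] w(2)[of w] w(2)[of v] v by (simp add: ds2_commute[of h y v w])
next
  assume l: "lam h y = 0"
  have deg: "degenerate_form (ds2 h y)" if "w \<noteq> 0" "ds2 h y w e1 = 0" "ds2 h y w e2 = 0" for w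
  proof -
    have "ds2 h y w v = 0" for v
    proof -
      have "v = v$1 *\<^sub>R e1 + v$2 *\<^sub>R e2" by (simp add: vec_eq_iff forall_2 axis_def)
      then have "ds2 h y w v = ds2 h y w (v$1 *\<^sub>R e1 + v$2 *\<^sub>R e2)" by simp
      then show ?thesis using that by (simp add: ds2_linear[OF assms])
    qed
    then show ?thesis unfolding degenerate_form_def using that(1) by blast
  qed
  let ?E = "ds2 h y e1 e1" and ?F = "ds2 h y e2 e1" and ?G = "ds2 h y e2 e2"
  have ne: "s *\<^sub>R e1 - t *\<^sub>R e2 \<noteq> 0" if "s \<noteq> 0 \<or> t \<noteq> 0" for s t :: real
    using that by (auto simp: vec_eq_iff forall_2 axis_def)
  show "degenerate_form (ds2 h y)"
  proof (cases "?E = 0 \<and> ?F = 0")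
    case True
    then show ?thesis
      using ne[of 1 0] by (intro deg[of e1]) (simp_all add: ds2_commute[of h y e1 e2])
  next
    case False
    show ?thesis
    proof (rule deg)
      show "?F *\<^sub>R e1 - ?E *\<^sub>R e2 \<noteq> 0" using False by (intro ne) auto
      show "ds2 h y (?F *\<^sub>R e1 - ?E *\<^sub>R e2) e1 = 0" by (simp add: ds2_linear[OF assms])
      show "ds2 h y (?F *\<^sub>R e1 - ?E *\<^sub>R e2) e2 = 0"
        using l by (simp add: ds2_linear[OF assms] lam_eq ds2_commute[of h y e1 e2] power2_eq_square)
    qed
  qed
qed

lemma ana_at_ds2:
  assumes "vana_at h x" "vana_at \<eta> x" "vana_at \<zeta> x"
  shows "ana_at (\<lambda>y. ds2 h y (\<eta> y) (\<zeta> y)) x"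
proof -
  have "ana_at (\<lambda>y. fd h y (\<eta> y) $ k) x" "ana_at (\<lambda>y. fd h y (\<zeta> y) $ k) x" for k
    using vana_at_fd[OF assms(1,2)] vana_at_fd[OF assms(1,3)] by (auto simp: vana_at_def)
  then show ?thesis unfolding ds2_def lprod_def by (intro ana_at_diff ana_at_add ana_at_mult)
qed

lemma ana_at_lam: "vana_at h x \<Longrightarrow> ana_at (lam h) x"
  unfolding lam_eq[abs_def] by (intro ana_at_diff ana_at_mult ana_at_power ana_at_ds2 vana_at_const)

lemma lam_compose:
  assumes "h differentiable (at (\<theta> y))" "\<theta> differentiable (at y)"
  shows "lam (\<lambda>x. h (\<theta> x)) y = (fd \<theta> y e1 $ 1 * fd \<theta> y e2 $ 2 - fd \<theta> y e1 $ 2 * fd \<theta> y e2 $ 1)\<^sup>2 * lam h (\<theta> y)"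
  unfolding lam_eq ds2_compose[OF assms] using gram_det[OF assms(1), of "fd \<theta> y e1" "fd \<theta> y e2"]
  by (simp add: lam_eq ds2_commute[of h "\<theta> y" "fd \<theta> y e2" "fd \<theta> y e1"])

text \<open>
  A null vector is transversal to every vector that is not null, and the null line is one-dimensional.
\<close>

lemma null_vector_scale:
  assumes h: "h differentiable (at x)" and w: "null_vector h x w" "null_vector h x w'" and a: "ds2 h x a a \<noteq> 0"
  shows "a$1 * w$2 - a$2 * w$1 \<noteq> 0" "\<exists>\<phi>. \<phi> \<noteq> 0 \<and> w' = \<phi> *\<^sub>R w"
proof -
  have a0: "a \<noteq> 0" using a linear_0[OF linear_fd[OF h]] by (auto simp: ds2_def lprod_linear)
  show d: "a$1 * w$2 - a$2 * w$1 \<noteq> 0"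
  proof
    assume "a$1 * w$2 - a$2 * w$1 = 0"
    from det2_zero[OF a0 this] obtain s where s: "w = s *\<^sub>R a" by blast
    have "s * ds2 h x a a = 0" using w(1) by (simp add: null_vector_def s ds2_linear[OF h] flip: ds2_linear(3)[OF h])
    with a s w(1) show False by (simp add: null_vector_def)
  qed
  obtain s t where st: "w' = s *\<^sub>R a + t *\<^sub>R w" using det2_basis[OF d] by blast
  have "ds2 h x w' a = 0" "ds2 h x w a = 0" using w by (auto simp: null_vector_def)
  then have "s * ds2 h x a a = 0" by (simp add: st ds2_linear[OF h])
  then have "w' = t *\<^sub>R w" using a st by simp
  moreover then have "t \<noteq> 0" using w(2) by (auto simp: null_vector_def)
  ultimately show "\<exists>\<phi>. \<phi> \<noteq> 0 \<and> w' = \<phi> *\<^sub>R w" by blast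
qed

lemma null_vector_orthogonal:
  assumes "null_vector h x w"
  shows "lprod (fd h x w) (fd h x v) = 0" "lprod (fd h x v) (fd h x w) = 0"
  using assms lprod_commute[of "fd h x v" "fd h x w"] by (simp_all add: null_vector_def ds2_def)

section \<open>The curvatures in terms of two-jets\<close>

text \<open>
  The derivative of \<open>\<langle>df(\<eta>), df(\<eta>)\<rangle>\<close> in direction \<open>\<eta>\<close> for a null vector field with value \<open>w\<close> at the point; see
  \<open>beta_eq_cubic\<close>.
\<close>

definition cubic :: "(real^2 \<Rightarrow> real^3) \<Rightarrow> real^2 \<Rightarrow> real^2 \<Rightarrow> real" where
  "cubic h x w = 2 * lprod (D2 h x w w) (fd h x w)"

definition normal_null :: "real^3 \<Rightarrow> real^3 \<Rightarrow> real^3" where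
  "normal_null e l = (THE n. lprod n n = 0 \<and> lprod n e = 0 \<and> lprod n l = 1)"

text \<open>
  The two curvatures in terms of a null vector \<open>w\<close> and of the velocity \<open>a\<close> and acceleration \<open>b\<close> of the
  characteristic curve in the coordinate plane.
\<close>

definition jet_kappa_L :: "(real^2 \<Rightarrow> real^3) \<Rightarrow> real^2 \<Rightarrow> real^2 \<Rightarrow> real^2 \<Rightarrow> real" where
  "jet_kappa_L h x w a = lprod (D2 h x a a) (fd h x w) / (root 3 (cubic h x w) * ds2 h x a a)"

definition jet_kappa_N :: "(real^2 \<Rightarrow> real^3) \<Rightarrow> real^2 \<Rightarrow> real^2 \<Rightarrow> real^2 \<Rightarrow> real^2 \<Rightarrow> real" where
  "jet_kappa_N h x w a b = root 3 (cubic h x w) *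
     lprod (D2 h x a a + fd h x b) (normal_null (fd h x a) (fd h x w)) / ds2 h x a a"

lemma normal_null:
  assumes "lprod e e > 0" "lprod e l = 0" "lprod l l = 0" "l \<noteq> 0"
  shows "lprod (normal_null e l) (normal_null e l) = 0" "lprod (normal_null e l) e = 0" "lprod (normal_null e l) l = 1"
    and "\<And>n. lprod n n = 0 \<Longrightarrow> lprod n e = 0 \<Longrightarrow> lprod n l = 1 \<Longrightarrow> normal_null e l = n"
proof -
  note u = transversal_null_unique[OF assms]
  from theI'[OF u] show "lprod (normal_null e l) (normal_null e l) = 0" "lprod (normal_null e l) e = 0" "lprod (normal_null e l) l = 1"
    by (auto simp: normal_null_def)
  show "normal_null e l = n" if "lprod n n = 0" "lprod n e = 0" "lprod n l = 1" for n
    unfolding normal_null_def by (rule the1_equality[OF u]) (use that in simp)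
qed

text \<open>
  The derivative of the null vector field contributes only a tangent vector, to which the image of
  the null vector is orthogonal.
\<close>

lemma beta_eq_cubic:
  fixes \<eta> :: "real^2 \<Rightarrow> real^2"
  assumes h: "vana_at h x" and \<eta>: "\<eta> differentiable (at x)" and w: "null_vector h x (\<eta> x)" and c: "c 0 = x"
  shows "beta h c \<eta> 0 = cubic h x (\<eta> x)"
proof -
  have hd: "h differentiable (at x)" by (rule vana_at_differentiable[OF h])
  define Z where "Z y = fd h y (\<eta> y)" for y
  let ?Z' = "\<lambda>v. (\<eta> x $ 1 *\<^sub>R D2 h x e1 v + fd \<eta> x v $ 1 *\<^sub>R fd h x e1) + (\<eta> x $ 2 *\<^sub>R D2 h x e2 v + fd \<eta> x v $ 2 *\<^sub>R fd h x e2)"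
  have \<eta>k: "((\<lambda>y. \<eta> y $ k) has_derivative (\<lambda>v. fd \<eta> x v $ k)) (at x)" for k
    using fd_works[OF \<eta>] unfolding has_derivative_vec_iff[of \<eta>] by simp
  have hk: "((\<lambda>y. fd h y v) has_derivative D2 h x v) (at x)" for v
    unfolding D2_def[abs_def] by (intro fd_works vana_at_differentiable vana_at_fd h vana_at_const)
  have "((\<lambda>y. \<eta> y $ 1 *\<^sub>R fd h y e1 + \<eta> y $ 2 *\<^sub>R fd h y e2) has_derivative ?Z') (at x)"
    by (intro has_derivative_add has_derivative_scaleR \<eta>k hk)
  moreover have "\<forall>\<^sub>F y in nhds x. \<eta> y $ 1 *\<^sub>R fd h y e1 + \<eta> y $ 2 *\<^sub>R fd h y e2 = Z y"
    using vana_at_near[OF h]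
    by (rule eventually_mono) (simp add: Z_def linear_expand_2[OF linear_fd[OF vana_at_differentiable], of _ _ "\<eta> _", symmetric])
  ultimately have Z: "(Z has_derivative ?Z') (at x)" by (simp only: has_derivative_cong_nhds)
  then have Zk: "((\<lambda>y. Z y $ k) has_derivative (\<lambda>v. ?Z' v $ k)) (at x)" for k
    unfolding has_derivative_vec_iff[of Z] by blast
  have D: "((\<lambda>y. ds2 h y (\<eta> y) (\<eta> y)) has_derivative (\<lambda>v. 2 * lprod (?Z' v) (Z x))) (at x)"
    unfolding ds2_def Z_def[symmetric] lprod_def
    by (rule derivative_eq_intros Zk | simp add: algebra_simps)+
  have "?Z' (\<eta> x) = D2 h x (\<eta> x) (\<eta> x) + fd h x (fd \<eta> x (\<eta> x))"
    using linear_expand_2[OF linear_fd[OF hd], of "fd \<eta> x (\<eta> x)"] D2_expand[OF vana_at_twice_diff[OF h], of "\<eta> x"]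
    by (simp add: algebra_simps)
  moreover have "lprod (fd h x (fd \<eta> x (\<eta> x))) (Z x) = 0"
    unfolding Z_def by (rule null_vector_orthogonal[OF w])
  ultimately show ?thesis
    unfolding beta_def c fd_eq[OF D] cubic_def by (simp add: lprod_linear Z_def)
qed

lemma kappa_formulas:
  assumes h: "vana_at h x" and inj: "inj (fd h x)" and c: "jet2 c x a b" and \<eta>: "\<eta> differentiable (at x)"
    and w: "null_vector h x (\<eta> x)" and a: "ds2 h x a a > 0"
  shows "kappa_L_formula h c \<eta> = jet_kappa_L h x (\<eta> x) a" "kappa_N_formula h c \<eta> = jet_kappa_N h x (\<eta> x) a b"
proof -
  note J = jet2_velocity[OF jet2_compose[OF vana_at_twice_diff[OF h] c]]
  have v: "velocity (h \<circ> c) 0 = fd h x a" "velocity (velocity (h \<circ> c)) 0 = D2 h x a a + fd h x b"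
    using J(2,3) by (simp_all add: o_def)
  have c0: "c 0 = x" by (rule jet2_velocity[OF c])
  have hd: "h differentiable (at x)" by (rule vana_at_differentiable[OF h])
  have n: "(lnorm (velocity (h \<circ> c) 0))\<^sup>2 = ds2 h x a a" "lnorm (velocity (h \<circ> c) 0) \<noteq> 0"
    using a by (simp_all add: v lnorm_def ds2_def)
  have L: "null_direction h c \<eta> 0 = fd h x (\<eta> x)" by (simp add: null_direction_def c0)
  have be: "beta h c \<eta> 0 = cubic h x (\<eta> x)" by (rule beta_eq_cubic[OF h \<eta> w]) (rule c0)
  have "lprod (fd h x b) (fd h x (\<eta> x)) = 0"
    by (rule null_vector_orthogonal[OF w])
  then show "kappa_L_formula h c \<eta> = jet_kappa_L h x (\<eta> x) a"
    unfolding kappa_L_formula_def jet_kappa_L_def be L n v(2) by (simp add: lprod_linear)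
  have "transversal_null h c \<eta> 0 = normal_null (fd h x a) (fd h x (\<eta> x))"
    unfolding transversal_null_def normal_null_def L unit_tangent_def v(1)
    by (rule arg_cong[of _ _ The]) (use n(2) in \<open>auto simp: fun_eq_iff lightlike_def lprod_linear v(1)\<close>)
  then show "kappa_N_formula h c \<eta> = jet_kappa_N h x (\<eta> x) a b"
    unfolding kappa_N_formula_def jet_kappa_N_def be n v(2) by simp
qed

text \<open>
  The first and second order conditions for a curve with velocity \<open>a\<close> and acceleration \<open>b\<close> to lie in the zero set of
  the determinant of the metric.
\<close>

definition lam_jet :: "(real^2 \<Rightarrow> real^3) \<Rightarrow> real^2 \<Rightarrow> real^2 \<Rightarrow> real^2 \<Rightarrow> bool" where
  "lam_jet h x a b \<longleftrightarrow> a \<noteq> 0 \<and> fd (lam h) x a = 0 \<and> D2 (lam h) x a a + fd (lam h) x b = 0"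

lemma lam_jet_curve:
  assumes h: "vana_at h x" and c: "jet2 c x a b" and "a \<noteq> 0" and "\<forall>\<^sub>F t in nhds 0. lam h (c t) = 0"
  shows "lam_jet h x a b"
proof -
  have "jet2 (\<lambda>t. lam h (c t)) (lam h x) (fd (lam h) x a) (D2 (lam h) x a a + fd (lam h) x b)"
    by (rule jet2_compose[OF ana_at_twice_diff[OF ana_at_lam[OF h]] c])
  moreover have "jet2 (\<lambda>t. lam h (c t)) 0 0 0"
    by (rule jet2_cong[OF jet2_const]) (use assms(4) in \<open>auto elim: eventually_mono\<close>)
  ultimately show ?thesis using jet2_unique assms(3) unfolding lam_jet_def by blast
qed

text \<open>
  Two jets in the zero set of the determinant differ by a reparametrisation, \<open>a' = \<mu> a\<close> and
  \<open>b' = \<mu>\<^sup>2 b + \<nu> a\<close>, and two null vectors by a factor \<open>\<phi>\<close>. The cubic scales by \<open>\<phi>\<^sup>3\<close> and the null normal by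
  \<open>1 / \<phi>\<close>, and the tangential term \<open>\<nu> a\<close> is orthogonal to both null directions.
\<close>

lemma jet_kappa_invariant:
  assumes h: "vana_at h x" and inj: "inj (fd h x)" and nd: "fd (lam h) x v0 \<noteq> 0"
    and j: "lam_jet h x a b" "lam_jet h x a' b'" and w: "null_vector h x w" "null_vector h x w'"
    and a: "ds2 h x a a > 0"
  shows "ds2 h x a' a' > 0" "jet_kappa_L h x w' a' = jet_kappa_L h x w a" "jet_kappa_N h x w' a' b' = jet_kappa_N h x w a b"
proof -
  have hd: "h differentiable (at x)" by (rule vana_at_differentiable[OF h])
  note td = vana_at_twice_diff[OF h] and lt = ana_at_twice_diff[OF ana_at_lam[OF h]]
  have ll: "linear (fd (lam h) x)" by (rule linear_fd[OF ana_at_differentiable[OF ana_at_lam[OF h]]])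
  have hl: "linear (fd h x)" by (rule linear_fd[OF hd])
  have a0: "a \<noteq> 0" using j(1) by (simp add: lam_jet_def)
  \<comment> \<open>the kernel of the differential of \<open>lam\<close> is one-dimensional\<close>
  have ker: "\<exists>s. v = s *\<^sub>R a" if "fd (lam h) x v = 0" for v
  proof (rule det2_zero[OF a0], rule ccontr)
    assume "a$1 * v$2 - a$2 * v$1 \<noteq> 0"
    from det2_basis[OF this, of v0] obtain s t where "v0 = s *\<^sub>R a + t *\<^sub>R v" by blast
    then have "fd (lam h) x v0 = 0" using that j(1) by (simp add: lam_jet_def linear_add[OF ll] linear_cmul[OF ll])
    with nd show False by simp
  qed
  obtain \<mu> where \<mu>: "a' = \<mu> *\<^sub>R a" using ker j(2) by (auto simp: lam_jet_def)
  have \<mu>0: "\<mu> \<noteq> 0" using j(2) by (auto simp: lam_jet_def \<mu>)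
  have "fd (lam h) x (b' - (\<mu> * \<mu>) *\<^sub>R b) = 0"
  proof -
    have "D2 (lam h) x a a = - fd (lam h) x b" "\<mu> * \<mu> * D2 (lam h) x a a + fd (lam h) x b' = 0"
      using j by (simp_all add: lam_jet_def \<mu> D2_scale[OF lt])
    then have "fd (lam h) x b' = \<mu> * \<mu> * fd (lam h) x b" by algebra
    then show ?thesis by (simp add: linear_diff[OF ll] linear_cmul[OF ll])
  qed
  then obtain \<nu> where \<nu>: "b' = (\<mu> * \<mu>) *\<^sub>R b + \<nu> *\<^sub>R a" using ker[of "b' - (\<mu> * \<mu>) *\<^sub>R b"] by (metis diff_add_cancel add.commute)
  obtain \<phi> where \<phi>: "\<phi> \<noteq> 0" "w' = \<phi> *\<^sub>R w" using null_vector_scale(2)[OF hd w, of a] a by auto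
  have aa: "ds2 h x a' a' = \<mu> * \<mu> * ds2 h x a a" by (simp add: \<mu> ds2_linear[OF hd])
  then show "ds2 h x a' a' > 0" using a \<mu>0 by (metis mult_pos_pos not_square_less_zero linorder_neqE_linordered_idom mult_eq_0_iff)
  have cub: "cubic h x w' = \<phi> ^ 3 * cubic h x w"
    by (simp add: cubic_def \<phi>(2) D2_scale[OF td] linear_cmul[OF hl] lprod_linear power3_eq_cube)
  have rt: "root 3 (cubic h x w') = \<phi> * root 3 (cubic h x w)"
    by (simp add: cub real_root_mult odd_real_root_power_cancel)
  show "jet_kappa_L h x w' a' = jet_kappa_L h x w a"
    unfolding jet_kappa_L_def rt aa using \<phi>(1) \<mu>0
    by (simp add: \<mu> \<phi>(2) D2_scale[OF td] linear_cmul[OF hl] lprod_linear)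
  have nl: "lprod (fd h x a) (fd h x a) > 0" "lprod (fd h x a) (fd h x w) = 0" "lprod (fd h x w) (fd h x w) = 0"
    "fd h x w \<noteq> 0"
  proof -
    show "lprod (fd h x a) (fd h x a) > 0" using a by (simp add: ds2_def)
    show "lprod (fd h x a) (fd h x w) = 0" "lprod (fd h x w) (fd h x w) = 0"
      by (rule null_vector_orthogonal[OF w(1)])+
    show "fd h x w \<noteq> 0"
      using w(1) inj linear_0[OF hl] by (metis injD null_vector_def)
  qed
  note n = normal_null[OF nl]
  let ?n = "normal_null (fd h x a) (fd h x w)"
  have n': "normal_null (fd h x a') (fd h x w') = (1 / \<phi>) *\<^sub>R ?n"
  proof (rule normal_null(4))
    show "lprod (fd h x a') (fd h x a') > 0" using \<open>ds2 h x a' a' > 0\<close> by (simp add: ds2_def)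
  qed (use nl n(1-3) \<phi> in \<open>simp_all add: \<mu> \<phi>(2) linear_cmul[OF hl] lprod_linear\<close>)
  have "lprod (D2 h x a' a' + fd h x b') ?n = \<mu> * \<mu> * lprod (D2 h x a a + fd h x b) ?n"
    using n(2) by (simp add: \<mu> \<nu> D2_scale[OF td] linear_add[OF hl] linear_cmul[OF hl] lprod_linear lprod_commute[of "fd h x a" ?n] algebra_simps)
  then show "jet_kappa_N h x w' a' b' = jet_kappa_N h x w a b"
    unfolding jet_kappa_N_def rt aa n' using \<phi>(1) \<mu>0 by (simp add: lprod_linear)
qed

text \<open>
  The jet formulas are compatible with a change of coordinates: by the chain rule both sides are computed
  from the same vectors in the ambient space.
\<close>

lemma jet_kappa_transport:
  assumes h: "vana_at h (\<theta> x)" and \<theta>: "vana_at \<theta> x" "inj (fd \<theta> x)"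
    and h1: "\<forall>\<^sub>F y in nhds x. h1 y = h (\<theta> y)" and w: "null_vector h1 x w"
  shows "null_vector h (\<theta> x) (fd \<theta> x w)"
    "jet_kappa_L h1 x w a = jet_kappa_L h (\<theta> x) (fd \<theta> x w) (fd \<theta> x a)"
    "jet_kappa_N h1 x w a b = jet_kappa_N h (\<theta> x) (fd \<theta> x w) (fd \<theta> x a) (D2 \<theta> x a a + fd \<theta> x b)"
proof -
  have hd: "h differentiable (at (\<theta> x))" and td: "\<theta> differentiable (at x)"
    using h \<theta> by (auto intro: vana_at_differentiable)
  have h1a: "vana_at h1 x"
    by (rule vana_at_cong[OF vana_at_compose[OF h \<theta>(1)]]) (use h1 in \<open>auto elim: eventually_mono\<close>)
  have F: "fd h1 x v = fd h (\<theta> x) (fd \<theta> x v)" for v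
    unfolding fd_cong[OF h1] by (rule fd_compose[OF hd td])
  have ds: "ds2 h1 x u v = ds2 h (\<theta> x) (fd \<theta> x u) (fd \<theta> x v)" for u v by (simp add: ds2_def F)
  have lt: "linear (fd \<theta> x)" by (rule linear_fd[OF td])
  have D: "D2 h1 x u u + fd h1 x v = D2 h (\<theta> x) (fd \<theta> x u) (fd \<theta> x u) + fd h (\<theta> x) (D2 \<theta> x u u + fd \<theta> x v)" for u v
  proof -
    define c where "c t = x + (t *\<^sub>R u + (t * t / 2) *\<^sub>R v)" for t
    have c: "jet2 c x u v"
    proof -
      have "(c has_vector_derivative (u + t *\<^sub>R v)) (at t)" for t
        unfolding c_def by (auto intro!: derivative_eq_intros simp: algebra_simps)
      moreover have "((\<lambda>t. u + t *\<^sub>R v) has_vector_derivative v) (at 0)"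
        by (auto intro!: derivative_eq_intros)
      ultimately show ?thesis unfolding jet2_def
        by (intro conjI exI[of _ "\<lambda>t. u + t *\<^sub>R v"]) (auto simp: c_def)
    qed
    have J1: "jet2 (\<lambda>t. h1 (c t)) (h1 x) (fd h1 x u) (D2 h1 x u u + fd h1 x v)"
      by (rule jet2_compose[OF vana_at_twice_diff[OF h1a] c])
    have J2: "jet2 (\<lambda>t. h (\<theta> (c t))) (h (\<theta> x)) (fd h (\<theta> x) (fd \<theta> x u))
        (D2 h (\<theta> x) (fd \<theta> x u) (fd \<theta> x u) + fd h (\<theta> x) (D2 \<theta> x u u + fd \<theta> x v))"
      by (rule jet2_compose[OF vana_at_twice_diff[OF h] jet2_compose[OF vana_at_twice_diff[OF \<theta>(1)] c]])
    have "\<forall>\<^sub>F t in nhds 0. h1 (c t) = h (\<theta> (c t))" by (rule eventually_along_curve[OF h1 c])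
    from jet2_unique[OF jet2_cong[OF J1 this] J2] show ?thesis by blast
  qed
  have "surj (fd \<theta> x)" by (rule linear_inj_imp_surj[OF lt \<theta>(2)])
  then show nv: "null_vector h (\<theta> x) (fd \<theta> x w)"
    using w \<theta>(2) linear_0[OF lt] unfolding null_vector_def ds by (metis injD surjD)
  have z: "fd h1 x 0 = 0" "fd \<theta> x 0 = 0"
    using linear_0[OF linear_fd[OF vana_at_differentiable[OF h1a]]] linear_0[OF lt] by auto
  have null: "lprod (fd h (\<theta> x) v) (fd h (\<theta> x) (fd \<theta> x w)) = 0" for v
    by (rule null_vector_orthogonal[OF nv])
  have DL: "lprod (D2 h1 x u u) (fd h1 x w) = lprod (D2 h (\<theta> x) (fd \<theta> x u) (fd \<theta> x u)) (fd h (\<theta> x) (fd \<theta> x w))" for u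
    using D[of u 0] by (simp add: z F[of w] lprod_linear null)
  then have cu: "cubic h1 x w = cubic h (\<theta> x) (fd \<theta> x w)" by (simp add: cubic_def)
  show "jet_kappa_L h1 x w a = jet_kappa_L h (\<theta> x) (fd \<theta> x w) (fd \<theta> x a)"
    unfolding jet_kappa_L_def cu DL ds ..
  show "jet_kappa_N h1 x w a b = jet_kappa_N h (\<theta> x) (fd \<theta> x w) (fd \<theta> x a) (D2 \<theta> x a a + fd \<theta> x b)"
    unfolding jet_kappa_N_def cu D ds unfolding F ..
qed


section \<open>Characteristic curves and null vector fields\<close>

lemma eventually_nhds_nonzero: "z \<noteq> 0 \<Longrightarrow> \<forall>\<^sub>F y in nhds (z :: real). y \<noteq> 0"
  using eventually_nhds_in_open[OF open_Compl[OF closed_singleton[of 0]], of z] by simp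

text \<open>
  The vector \<open>ds2(a, w) a - ds2(a, a) w\<close> is orthogonal to \<open>a\<close> everywhere, and its product with \<open>w\<close> is minus
  the Gram determinant, which vanishes on the degenerate locus.
\<close>

lemma null_vector_field_exists:
  fixes h :: "real^2 \<Rightarrow> real^3" and a w :: "real^2"
  assumes h: "vana_at h x" and D: "open D" "x \<in> D" and a: "ds2 h x a a \<noteq> 0" and aw: "a$1 * w$2 - a$2 * w$1 \<noteq> 0"
  obtains \<eta> where "null_vector_field h D x \<eta>" "\<eta> differentiable (at x)"
proof -
  define \<eta> where "\<eta> y = ds2 h y a w *\<^sub>R a - ds2 h y a a *\<^sub>R w" for y
  have ana: "vana_at \<eta> y" if "vana_at h y" for y
    unfolding \<eta>_def[abs_def] by (intro vana_at_diff vana_at_scaleR ana_at_ds2 vana_at_const that)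
  have "(\<lambda>y. ds2 h y a a) differentiable (at x)"
    by (intro ana_at_differentiable ana_at_ds2 h vana_at_const)
  then have "\<forall>\<^sub>F y in nhds x. ds2 h y a a \<noteq> 0"
    by (rule tendsto_differentiable) (rule eventually_nhds_nonzero[OF a])
  with vana_at_near[OF h] eventually_nhds_in_open[OF D]
  have "\<forall>\<^sub>F y in nhds x. vana_at h y \<and> ds2 h y a a \<noteq> 0 \<and> y \<in> D" by eventually_elim auto
  then obtain V where V: "open V" "x \<in> V" "\<And>y. y \<in> V \<Longrightarrow> vana_at h y \<and> ds2 h y a a \<noteq> 0 \<and> y \<in> D"
    by (auto simp: eventually_nhds)
  have null: "null_vector h y (\<eta> y)" if y: "y \<in> LD h D \<inter> V" for y
  proof -
    have hd: "h differentiable (at y)" using V(3)[of y] y vana_at_differentiable by blast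
    have l0: "lam h y = 0" using y degenerate_iff[OF hd] by (simp add: LD_def)
    have 1: "ds2 h y (\<eta> y) a = 0"
      by (simp add: \<eta>_def ds2_linear[OF hd] ds2_commute[of h y w a])
    have "ds2 h y (\<eta> y) w = (ds2 h y a w)\<^sup>2 - ds2 h y a a * ds2 h y w w"
      by (simp add: \<eta>_def ds2_linear[OF hd] power2_eq_square)
    also have "\<dots> = 0" using gram_det[OF hd, of a w] l0 by simp
    finally have 2: "ds2 h y (\<eta> y) w = 0" .
    have "ds2 h y (\<eta> y) v = 0" for v
    proof -
      obtain s t where "v = s *\<^sub>R a + t *\<^sub>R w" using det2_basis[OF aw] by blast
      then show ?thesis using 1 2 by (simp add: ds2_linear[OF hd])
    qed
    moreover have "\<eta> y \<noteq> 0"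
    proof
      assume "\<eta> y = 0"
      then have "ds2 h y a a *\<^sub>R w = ds2 h y a w *\<^sub>R a" by (simp add: \<eta>_def)
      then have "(1 / ds2 h y a a) *\<^sub>R (ds2 h y a a *\<^sub>R w) = (1 / ds2 h y a a) *\<^sub>R (ds2 h y a w *\<^sub>R a)"
        by (simp only:)
      then have "w = (1 / ds2 h y a a * ds2 h y a w) *\<^sub>R a"
        using V(3)[of y] y by simp
      then obtain s where "w = s *\<^sub>R a" by blast
      with aw show False by simp
    qed
    ultimately show ?thesis by (simp add: null_vector_def)
  qed
  show thesis
  proof (rule that[of \<eta>])
    show "\<eta> differentiable (at x)" using ana[OF h] by (rule vana_at_differentiable)
    show "null_vector_field h D x \<eta>"
      unfolding null_vector_field_def smooth_on_def
      by (rule exI[of _ V]) (use V in \<open>auto intro!: null vana_at_imp_Ck_on ana\<close>)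
  qed
qed

lemma Ck_on_subset: "Ck_on k S h \<Longrightarrow> T \<subseteq> S \<Longrightarrow> Ck_on k T h"
  by (induction k arbitrary: h) (auto intro: continuous_on_subset)

lemma smooth_on_subset: "smooth_on S h \<Longrightarrow> T \<subseteq> S \<Longrightarrow> smooth_on T h"
  unfolding smooth_on_def using Ck_on_subset by blast

text \<open>
  A smaller domain requires a shorter curve that still covers the degenerate locus near the point. Let
  \<open>l\<close> be the linear functional with kernel spanned by a direction transversal to the locus. By
  Rolle's theorem the locus meets each fibre of \<open>l\<close> at most once near the point, and \<open>l\<close> is strictly increasing
  along the curve, so by the intermediate value theorem a short piece of the curve is the whole
  locus in a strip.
\<close>

lemma characteristic_curve_restrict:
  fixes h :: "real^2 \<Rightarrow> real^3"
  assumes h: "\<And>y. y \<in> D \<Longrightarrow> vana_at h y" and D: "open D" and cc: "characteristic_curve h D x \<delta> c"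
    and nd: "fd (lam h) x v \<noteq> 0" and W: "open W" "x \<in> W"
  obtains \<delta>' where "characteristic_curve h (D \<inter> W) x \<delta>' c"
proof -
  have rc: "\<delta> > 0" "c 0 = x" "smooth_on {-\<delta><..<\<delta>} c" "c ` {-\<delta><..<\<delta>} \<subseteq> D"
    "\<And>t. t \<in> {-\<delta><..<\<delta>} \<Longrightarrow> velocity c t \<noteq> 0"
    using cc by (auto simp: characteristic_curve_def regular_curve_def)
  have cLD: "c t \<in> LD h D" if "t \<in> {-\<delta><..<\<delta>}" for t
    using cc that unfolding characteristic_curve_def by blast
  have lam_LD: "lam h y = 0" if "y \<in> LD h D" for y
    using that degenerate_iff[OF vana_at_differentiable[OF h]] by (auto simp: LD_def)
  have xD: "x \<in> D" using rc by force
  define a where "a = velocity c 0"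
  have near0: "\<forall>\<^sub>F t in nhds 0. t \<in> {-\<delta><..<\<delta>}" using rc(1) by (intro eventually_nhds_in_open) auto
  have jet: "jet2 c x a (velocity (velocity c) 0)" using jet2_smooth_on[OF rc(3,1)] by (simp add: rc(2) a_def)
  have "lam_jet h x a (velocity (velocity c) 0)"
    by (rule lam_jet_curve[OF h[OF xD] jet])
      (use near0 rc cLD lam_LD in \<open>auto simp: a_def elim!: eventually_mono\<close>)
  then have la: "a \<noteq> 0" "fd (lam h) x a = 0" by (auto simp: lam_jet_def)
  have ll: "linear (fd (lam h) y)" if "y \<in> D" for y
    by (rule linear_fd[OF ana_at_differentiable[OF ana_at_lam[OF h[OF that]]]])
  have dav: "a$1 * v$2 - a$2 * v$1 \<noteq> 0"
  proof
    assume "a$1 * v$2 - a$2 * v$1 = 0"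
    from det2_zero[OF la(1) this] obtain s where "v = s *\<^sub>R a" by blast
    with nd la(2) show False by (simp add: linear_cmul[OF ll[OF xD]])
  qed
  have v0: "v \<noteq> 0" using nd linear_0[OF ll[OF xD]] by auto
  define l where "l y = (y$1 * v$2 - y$2 * v$1) / (a$1 * v$2 - a$2 * v$1)" for y :: "real^2"
  have bl: "bounded_linear l"
  proof -
    have "linear l" by (intro linearI) (simp_all add: l_def algebra_simps add_divide_distrib diff_divide_distrib)
    then show ?thesis by (simp add: linear_conv_bounded_linear)
  qed
  have l_a: "l a = 1" using dav by (simp add: l_def)
  have l_ker: "\<exists>s. y = s *\<^sub>R v" if "l y = 0" for y
    using that dav det2_zero[OF v0, of y] by (simp add: l_def algebra_simps)
  \<comment> \<open>near \<open>x\<close> the degenerate locus meets each line in direction \<open>v\<close> at most once\<close>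
  have "(\<lambda>y. fd (lam h) y v) differentiable (at x)"
    using ana_at_twice_diff[OF ana_at_lam[OF h[OF xD]]] by (simp add: twice_diff_def)
  then have "\<forall>\<^sub>F y in nhds x. fd (lam h) y v \<noteq> 0"
    by (rule tendsto_differentiable) (rule eventually_nhds_nonzero[OF nd])
  with eventually_nhds_in_open[OF D xD] eventually_nhds_in_open[OF W]
  have "\<forall>\<^sub>F y in nhds x. fd (lam h) y v \<noteq> 0 \<and> y \<in> D \<and> y \<in> W" by eventually_elim auto
  then obtain r where r: "r > 0" "\<And>y. dist y x < r \<Longrightarrow> fd (lam h) y v \<noteq> 0 \<and> y \<in> D \<and> y \<in> W"
    by (auto simp: eventually_nhds_metric)
  then have B: "\<And>y. y \<in> ball x r \<Longrightarrow> fd (lam h) y v \<noteq> 0 \<and> y \<in> D \<and> y \<in> W" by (simp add: dist_commute)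
  have uniq: "y = z" if y: "y \<in> ball x r" "z \<in> ball x r" and l0: "lam h y = 0" "lam h z = 0" and ly: "l y = l z" for y z
  proof -
    have "l (z - y) = 0" using ly linear_diff[OF bounded_linear.linear[OF bl]] by simp
    then obtain s where s: "z - y = s *\<^sub>R v" using l_ker by blast
    define \<gamma> where "\<gamma> t = y + t *\<^sub>R (z - y)" for t
    have in_ball: "\<gamma> t \<in> ball x r" if "0 \<le> t" "t \<le> 1" for t
    proof -
      have "\<gamma> t = (1 - t) *\<^sub>R y + t *\<^sub>R z" by (simp add: \<gamma>_def algebra_simps)
      then show ?thesis using convexD[OF convex_ball y, of "1 - t" t] that by simp
    qed
    have der: "((\<lambda>t. lam h (\<gamma> t)) has_vector_derivative fd (lam h) (\<gamma> t) (z - y)) (at t)" if "0 \<le> t" "t \<le> 1" for t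
    proof (rule has_vector_derivative_chain)
      show "(\<gamma> has_vector_derivative z - y) (at t)"
        unfolding \<gamma>_def by (auto intro!: derivative_eq_intros)
      show "lam h differentiable (at (\<gamma> t))"
        using B[OF in_ball[OF that]] by (intro ana_at_differentiable ana_at_lam h) auto
    qed
    have "\<exists>t>0. t < 1 \<and> ((\<lambda>t. lam h (\<gamma> t)) has_real_derivative 0) (at t)"
    proof (rule Rolle)
      show "lam h (\<gamma> 0) = lam h (\<gamma> 1)" using l0 by (simp add: \<gamma>_def)
      show "continuous_on {0..1} (\<lambda>t. lam h (\<gamma> t))"
        using der by (auto intro!: continuous_at_imp_continuous_on has_vector_derivative_continuous)
      show "(\<lambda>t. lam h (\<gamma> t)) differentiable (at t)" if "0 < t" "t < 1" for t
        using der[of t] that by (auto simp: differentiable_def has_vector_derivative_def)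
    qed simp
    then obtain t where t: "0 < t" "t < 1" "((\<lambda>t. lam h (\<gamma> t)) has_real_derivative 0) (at t)" by blast
    have "fd (lam h) (\<gamma> t) (z - y) = 0"
      by (rule vector_derivative_unique_at[OF der t(3)[unfolded has_real_derivative_iff_has_vector_derivative]]) (use t in auto)
    then have "s * fd (lam h) (\<gamma> t) v = 0"
      using B[OF in_ball[of t]] t by (simp add: s linear_cmul[OF ll])
    then show "y = z" using B[OF in_ball[of t]] t s by simp
  qed
  \<comment> \<open>the curve moves strictly across these lines\<close>
  define u where "u t = l (c t)" for t
  have du: "(u has_real_derivative l (velocity c t)) (at t)" if "t \<in> {-\<delta><..<\<delta>}" for t
    unfolding u_def has_real_derivative_iff_has_vector_derivative
    by (rule bounded_linear.has_vector_derivative[OF bl smooth_on_velocity(1)[OF rc(3,1) that]])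
  have "\<forall>\<^sub>F y in nhds a. l y > 0"
  proof -
    have "isCont l a" by (rule bounded_linear.isCont[OF bl continuous_ident])
    then have "(l \<longlongrightarrow> l a) (nhds a)" by (simp add: isCont_def tendsto_nhds_iff)
    then show ?thesis by (rule order_tendstoD) (simp add: l_a)
  qed
  from tendsto_differentiable[OF smooth_on_velocity(2)[OF rc(3,1)], folded a_def, OF this]
  have "\<forall>\<^sub>F t in nhds 0. l (velocity c t) > 0" .
  moreover have "\<forall>\<^sub>F t in nhds 0. c t \<in> ball x r"
    by (rule eventually_along_curve[OF eventually_nhds_in_open[OF open_ball centre_in_ball[THEN iffD2]] jet]) (rule r(1))
  ultimately have "\<forall>\<^sub>F t in nhds 0. t \<in> {-\<delta><..<\<delta>} \<and> c t \<in> ball x r \<and> l (velocity c t) > 0"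
    using near0 by eventually_elim auto
  then obtain \<epsilon> where \<epsilon>: "\<epsilon> > 0" "\<And>t. \<bar>t\<bar> < \<epsilon> \<Longrightarrow> t \<in> {-\<delta><..<\<delta>} \<and> c t \<in> ball x r \<and> l (velocity c t) > 0"
    by (auto simp: eventually_nhds_metric dist_real_def)
  define d where "d = \<epsilon> / 2"
  have d: "d > 0" "\<And>t. t \<in> {-d..d} \<Longrightarrow> t \<in> {-\<delta><..<\<delta>} \<and> c t \<in> ball x r \<and> l (velocity c t) > 0"
    using \<epsilon> by (auto simp: d_def)
  have mono: "u s < u t" if "-d \<le> s" "s < t" "t \<le> d" for s t
  proof (rule DERIV_pos_imp_increasing[OF that(2)])
    fix z assume "s \<le> z" "z \<le> t"
    then have "z \<in> {-d..d}" using that by simp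
    from d(2)[OF this] du show "\<exists>y. (u has_real_derivative y) (at z) \<and> 0 < y" by blast
  qed
  have cont: "continuous_on {-d..d} u"
    by (rule continuous_at_imp_continuous_on) (use du d(2) DERIV_isCont in blast)
  define V where "V = ball x r \<inter> {y. u (-d) < l y \<and> l y < u d}"
  have "continuous_on UNIV l" using bl by (simp add: linear_continuous_on)
  then have oV: "open V"
    unfolding V_def by (intro open_Int open_ball open_Collect_conj open_Collect_less continuous_on_const)
  have im: "c ` {-d<..<d} = LD h (D \<inter> W) \<inter> V"
  proof (intro equalityI subsetI)
    fix y assume "y \<in> c ` {-d<..<d}"
    then obtain t where t: "t \<in> {-d<..<d}" "y = c t" by blast
    then have "y \<in> ball x r" "y \<in> LD h D" using d(2)[of t] cLD by auto
    moreover have "u (-d) < u t" "u t < u d" using t mono by auto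
    ultimately show "y \<in> LD h (D \<inter> W) \<inter> V" using B[of y] t by (auto simp: LD_def V_def u_def)
  next
    fix y assume y: "y \<in> LD h (D \<inter> W) \<inter> V"
    then have "u (-d) \<le> l y" "l y \<le> u d" by (auto simp: V_def)
    then obtain t where t: "-d \<le> t" "t \<le> d" "u t = l y" using IVT'[OF _ _ _ cont] d(1) by auto
    then have "t \<noteq> -d" "t \<noteq> d" using y by (auto simp: V_def)
    moreover have "c t = y"
    proof (rule uniq)
      show "c t \<in> ball x r" using d(2) t by auto
      show "lam h (c t) = 0" using d(2) t cLD lam_LD by auto
      show "y \<in> ball x r" "lam h y = 0" using y lam_LD by (auto simp: V_def LD_def)
      show "l (c t) = l y" using t by (simp add: u_def)
    qed
    ultimately show "y \<in> c ` {-d<..<d}" using t by force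
  qed
  have dd: "{-d<..<d} \<subseteq> {-\<delta><..<\<delta>}" using d(2) by force
  have "x \<in> V"
    using im rc(2) d(1) by force
  have "c ` {-d<..<d} \<subseteq> D \<inter> W" unfolding im by (auto simp: LD_def)
  then have "regular_curve (D \<inter> W) x d c"
    unfolding regular_curve_def using d(1) rc dd smooth_on_subset[OF rc(3) dd] by auto
  with im oV \<open>x \<in> V\<close> show thesis
    by (intro that[of d]) (auto simp: characteristic_curve_def)
qed

section \<open>Charts of a surface\<close>

lemma surface_chart:
  assumes S: "real_analytic_surface X A f" and c: "(D, \<psi>) \<in> A"
  shows "open D" "openin X (\<psi> ` D)" "homeomorphic_map (top_of_set D) (subtopology X (\<psi> ` D)) \<psi>" "inj_on \<psi> D"
    "\<And>y. y \<in> D \<Longrightarrow> vana_at (f \<circ> \<psi>) y" "\<And>y. y \<in> D \<Longrightarrow> inj (fd (f \<circ> \<psi>) y)"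
    "\<And>y. y \<in> D \<Longrightarrow> \<psi> y \<in> topspace X"
proof -
  have M: "analytic_2_manifold X A" and 1: "real_analytic_on D (f \<circ> \<psi>)" "\<forall>x\<in>D. inj (fd (f \<circ> \<psi>) x)"
    using S c unfolding real_analytic_surface_def by auto
  show o: "open D" "openin X (\<psi> ` D)" and h: "homeomorphic_map (top_of_set D) (subtopology X (\<psi> ` D)) \<psi>"
    using M c unfolding analytic_2_manifold_def by auto
  show "inj_on \<psi> D" using homeomorphic_imp_injective_map[OF h] by simp
  show "\<And>y. y \<in> D \<Longrightarrow> vana_at (f \<circ> \<psi>) y" using 1(1) unfolding real_analytic_on_iff by blast
  show "\<And>y. y \<in> D \<Longrightarrow> inj (fd (f \<circ> \<psi>) y)" using 1(2) by blast
  show "\<And>y. y \<in> D \<Longrightarrow> \<psi> y \<in> topspace X" using openin_subset[OF o(2)] by blast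
qed

lemma open_chart_preimage:
  assumes "open D" "homeomorphic_map (top_of_set D) (subtopology X (\<psi> ` D)) \<psi>" "openin X U"
  shows "open (D \<inter> \<psi> -` U)"
proof -
  have "continuous_map (top_of_set D) (subtopology X (\<psi> ` D)) \<psi>"
    using assms(2) by (rule homeomorphic_imp_continuous_map)
  then have "continuous_map (top_of_set D) X \<psi>" by (rule continuous_map_into_fulltopology)
  from openin_continuous_map_preimage[OF this assms(3)]
  have "openin (top_of_set D) (D \<inter> \<psi> -` U)" by (simp add: Int_def vimage_def)
  then show ?thesis using openin_open_eq[OF assms(1)] by blast
qed

lemma chart_transition:
  assumes S: "real_analytic_surface X A f" and c: "(Da, \<psi>1) \<in> A" "(Db, \<psi>2) \<in> A"
    and x: "x1 \<in> Da" "x2 \<in> Db" "\<psi>1 x1 = \<psi>2 x2"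
  obtains \<theta> where "vana_at \<theta> x1" "\<theta> x1 = x2" "\<And>y. \<theta> y = inv_into Db \<psi>2 (\<psi>1 y)"
    "\<forall>\<^sub>F y in nhds x1. y \<in> Da \<and> \<theta> y \<in> Db \<and> \<psi>2 (\<theta> y) = \<psi>1 y \<and> vana_at \<theta> y \<and> inj (fd \<theta> y)"
proof -
  note s1 = surface_chart[OF S c(1)] and s2 = surface_chart[OF S c(2)]
  define \<theta> where "\<theta> = inv_into Db \<psi>2 \<circ> \<psi>1"
  let ?S = "Da \<inter> \<psi>1 -` (\<psi>2 ` Db)"
  have oS: "open ?S" by (rule open_chart_preimage[OF s1(1,3) s2(2)])
  have "real_analytic_on ?S \<theta>"
    using S c unfolding real_analytic_surface_def analytic_2_manifold_def \<theta>_def by fast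
  then have va: "vana_at \<theta> y" if "y \<in> ?S" for y using that unfolding real_analytic_on_iff by blast
  have xS: "x1 \<in> ?S" using x by auto
  have \<theta>S: "\<theta> y \<in> Db \<and> \<psi>2 (\<theta> y) = \<psi>1 y" if "y \<in> ?S" for y
    using that inv_into_into[of "\<psi>1 y" \<psi>2 Db] f_inv_into_f[of "\<psi>1 y" \<psi>2 Db] by (auto simp: \<theta>_def)
  have inj: "inj (fd \<theta> y)" if y: "y \<in> ?S" for y
  proof -
    have "\<forall>\<^sub>F z in nhds y. (f \<circ> \<psi>1) z = (f \<circ> \<psi>2) (\<theta> z)"
      using eventually_nhds_in_open[OF oS y] by (rule eventually_mono) (use \<theta>S in auto)
    then have "fd (f \<circ> \<psi>1) y = fd (\<lambda>z. (f \<circ> \<psi>2) (\<theta> z)) y" by (rule fd_cong)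
    then have "fd (f \<circ> \<psi>1) y v = fd (f \<circ> \<psi>2) (\<theta> y) (fd \<theta> y v)" for v
      using fd_compose[OF vana_at_differentiable[OF s2(5)] vana_at_differentiable[OF va[OF y]]] \<theta>S[OF y] by simp
    then show ?thesis using s1(6)[of y] y by (auto simp: inj_def)
  qed
  show thesis
  proof (rule that[of \<theta>])
    show "vana_at \<theta> x1" by (rule va[OF xS])
    show "\<theta> x1 = x2" using x s2(4) by (simp add: \<theta>_def inv_into_f_f)
    show "\<theta> y = inv_into Db \<psi>2 (\<psi>1 y)" for y by (simp add: \<theta>_def)
    show "\<forall>\<^sub>F y in nhds x1. y \<in> Da \<and> \<theta> y \<in> Db \<and> \<psi>2 (\<theta> y) = \<psi>1 y \<and> vana_at \<theta> y \<and> inj (fd \<theta> y)"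
      using eventually_nhds_in_open[OF oS xS] by (rule eventually_mono) (use \<theta>S inj va in auto)
  qed
qed

lemma null_vector_field_at:
  assumes "null_vector_field h D x \<eta>" "x \<in> LD h D"
  shows "\<eta> differentiable (at x)" "null_vector h x (\<eta> x)"
proof -
  obtain V where V: "x \<in> V" "smooth_on V \<eta>" "\<forall>y\<in>LD h D \<inter> V. null_vector h y (\<eta> y)"
    using assms(1) unfolding null_vector_field_def by blast
  have "Ck_on (Suc 0) V \<eta>" using V(2) unfolding smooth_on_def by blast
  then show "\<eta> differentiable (at x)" using V(1) by simp
  show "null_vector h x (\<eta> x)" using V assms(2) by blast
qed

lemma characteristic_curveD:
  assumes "characteristic_curve h D x \<delta> c"
  shows "\<delta> > 0" "c 0 = x" "x \<in> LD h D" "velocity c 0 \<noteq> 0" "jet2 c x (velocity c 0) (velocity (velocity c) 0)"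
    "\<forall>\<^sub>F t in nhds 0. c t \<in> LD h D"
proof -
  have rc: "\<delta> > 0" "c 0 = x" "smooth_on {-\<delta><..<\<delta>} c" "\<And>t. t \<in> {-\<delta><..<\<delta>} \<Longrightarrow> velocity c t \<noteq> 0"
    using assms by (auto simp: characteristic_curve_def regular_curve_def)
  have cLD: "c t \<in> LD h D" if "t \<in> {-\<delta><..<\<delta>}" for t
    using assms that unfolding characteristic_curve_def by blast
  show "\<delta> > 0" "c 0 = x" "velocity c 0 \<noteq> 0" using rc by auto
  show "x \<in> LD h D" using cLD[of 0] rc by auto
  show "jet2 c x (velocity c 0) (velocity (velocity c) 0)" using jet2_smooth_on[OF rc(3,1)] rc(2) by simp
  have "\<forall>\<^sub>F t in nhds 0. t \<in> {-\<delta><..<\<delta>}" using rc(1) by (intro eventually_nhds_in_open) auto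
  then show "\<forall>\<^sub>F t in nhds 0. c t \<in> LD h D" by (rule eventually_mono) (rule cLD)
qed

lemma characteristic_lam_jet:
  assumes "\<And>y. y \<in> D \<Longrightarrow> vana_at h y" and cc: "characteristic_curve h D x \<delta> c"
  shows "lam_jet h x (velocity c 0) (velocity (velocity c) 0)"
proof (rule lam_jet_curve[OF _ characteristic_curveD(5)[OF cc] characteristic_curveD(4)[OF cc]])
  note d = characteristic_curveD[OF cc]
  show "vana_at h x" using d(3) assms(1) by (auto simp: LD_def)
  have "lam h y = 0" if "y \<in> LD h D" for y
    using that degenerate_iff[OF vana_at_differentiable[OF assms(1)]] by (auto simp: LD_def)
  then show "\<forall>\<^sub>F t in nhds 0. lam h (c t) = 0"
    using d(6) by (rule eventually_mono[rotated])
qed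

text \<open>
  The common value of all the formulas is computed in one chart: data in any other chart are moved to it by the
  transition map, where they differ by the changes of parameter and of null vector under which the jet formulas
  are invariant.
\<close>

lemma kappa_in_chart:
  assumes S: "real_analytic_surface X A f" and ch: "(D, \<psi>) \<in> A" and p: "p = \<psi> x"
    and cc: "characteristic_curve (f \<circ> \<psi>) D x \<delta> c" and nd: "fd (lam (f \<circ> \<psi>)) x v0 \<noteq> 0"
    and a: "ds2 (f \<circ> \<psi>) x (velocity c 0) (velocity c 0) > 0" and nf: "null_vector_field (f \<circ> \<psi>) D x \<eta>"
  shows "kappa_L A f p = jet_kappa_L (f \<circ> \<psi>) x (\<eta> x) (velocity c 0)"
    "kappa_N A f p = jet_kappa_N (f \<circ> \<psi>) x (\<eta> x) (velocity c 0) (velocity (velocity c) 0)"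
proof -
  let ?h = "f \<circ> \<psi>" and ?a = "velocity c 0" and ?b = "velocity (velocity c) 0"
  note s = surface_chart[OF S ch] and d = characteristic_curveD[OF cc]
  have xD: "x \<in> D" using d(3) by (simp add: LD_def)
  note nv = null_vector_field_at[OF nf d(3)]
  have lj: "lam_jet ?h x ?a ?b" by (rule characteristic_lam_jet[OF s(5) cc])
  have main: "kappa_L_formula (f \<circ> \<psi>1) c1 \<eta>1 = jet_kappa_L ?h x (\<eta> x) ?a \<and> kappa_N_formula (f \<circ> \<psi>1) c1 \<eta>1 = jet_kappa_N ?h x (\<eta> x) ?a ?b"
    if c1: "(D1, \<psi>1) \<in> A" "x1 \<in> D1" "\<psi>1 x1 = p" and cc1: "characteristic_curve (f \<circ> \<psi>1) D1 x1 \<delta>1 c1"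
      and nf1: "null_vector_field (f \<circ> \<psi>1) D1 x1 \<eta>1" for D1 \<psi>1 x1 \<delta>1 c1 \<eta>1
  proof -
    let ?h1 = "f \<circ> \<psi>1" and ?a1 = "velocity c1 0" and ?b1 = "velocity (velocity c1) 0"
    note s1 = surface_chart[OF S c1(1)] and d1 = characteristic_curveD[OF cc1]
    note nv1 = null_vector_field_at[OF nf1 d1(3)]
    have "\<psi>1 x1 = \<psi> x" using c1(3) p by simp
    from chart_transition[OF S c1(1) ch c1(2) xD this]
    obtain \<theta> where \<theta>: "vana_at \<theta> x1" "\<theta> x1 = x"
      "\<forall>\<^sub>F y in nhds x1. y \<in> D1 \<and> \<theta> y \<in> D \<and> \<psi> (\<theta> y) = \<psi>1 y \<and> vana_at \<theta> y \<and> inj (fd \<theta> y)"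
      by blast
    have inj\<theta>: "inj (fd \<theta> x1)" using eventually_nhds_x_imp_x[OF \<theta>(3)] by blast
    have h1: "\<forall>\<^sub>F y in nhds x1. ?h1 y = ?h (\<theta> y)" using \<theta>(3) by (rule eventually_mono) simp
    have hx: "vana_at ?h (\<theta> x1)" using s(5)[OF xD] \<theta>(2) by simp
    note tr = jet_kappa_transport[OF hx \<theta>(1) inj\<theta> h1 nv1(2), unfolded \<theta>(2)]
    have "\<forall>\<^sub>F y in nhds x1. y \<in> LD ?h1 D1 \<longrightarrow> lam ?h (\<theta> y) = 0"
      using \<theta>(3) eventually_nhds_nhds[OF h1]
    proof eventually_elim
      case (elim y)
      show ?case
      proof
        assume "y \<in> LD ?h1 D1"
        then obtain w where "null_vector ?h1 y w" by (auto simp: LD_def degenerate_form_def null_vector_def)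
        from jet_kappa_transport(1)[where h = ?h and \<theta> = \<theta>, OF _ _ _ elim(2) this] elim s(5)
        have "null_vector ?h (\<theta> y) (fd \<theta> y w)" by blast
        then have "degenerate_form (ds2 ?h (\<theta> y))" by (auto simp: degenerate_form_def null_vector_def)
        then show "lam ?h (\<theta> y) = 0" using degenerate_iff vana_at_differentiable s(5) elim by blast
      qed
    qed
    from eventually_along_curve[OF this d1(5)] d1(6)
    have "\<forall>\<^sub>F t in nhds 0. lam ?h (\<theta> (c1 t)) = 0" by eventually_elim blast
    moreover have jt: "jet2 (\<lambda>t. \<theta> (c1 t)) x (fd \<theta> x1 ?a1) (D2 \<theta> x1 ?a1 ?a1 + fd \<theta> x1 ?b1)"
      using jet2_compose[OF vana_at_twice_diff[OF \<theta>(1)] d1(5)] \<theta>(2) by simp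
    moreover have "fd \<theta> x1 ?a1 \<noteq> 0"
      using d1(4) inj\<theta> linear_0[OF linear_fd[OF vana_at_differentiable[OF \<theta>(1)]]] by (metis injD)
    ultimately have lj1: "lam_jet ?h x (fd \<theta> x1 ?a1) (D2 \<theta> x1 ?a1 ?a1 + fd \<theta> x1 ?b1)"
      using lam_jet_curve[OF s(5)[OF xD]] by blast
    note inv = jet_kappa_invariant[OF s(5)[OF xD] s(6)[OF xD] nd lj lj1 nv(2) tr(1) a]
    have "ds2 ?h1 x1 ?a1 ?a1 = ds2 ?h x (fd \<theta> x1 ?a1) (fd \<theta> x1 ?a1)"
      unfolding ds2_cong[OF h1] using ds2_compose[of ?h \<theta> x1] vana_at_differentiable[OF hx] vana_at_differentiable[OF \<theta>(1)] \<theta>(2) by simp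
    with inv(1) have "ds2 ?h1 x1 ?a1 ?a1 > 0" by simp
    from kappa_formulas[OF s1(5)[OF c1(2)] s1(6)[OF c1(2)] d1(5) nv1 this]
    show ?thesis unfolding tr inv by simp
  qed
  have base: "kappa_L_formula ?h c \<eta> = jet_kappa_L ?h x (\<eta> x) ?a" "kappa_N_formula ?h c \<eta> = jet_kappa_N ?h x (\<eta> x) ?a ?b"
    using main[OF ch xD p[symmetric] cc nf] by auto
  show "kappa_L A f p = jet_kappa_L ?h x (\<eta> x) ?a"
    unfolding kappa_L_def
  proof (rule the_equality)
    show "at_chart A p (\<lambda>D \<psi> x'. \<exists>\<delta> c \<eta>'. characteristic_curve (f \<circ> \<psi>) D x' \<delta> c \<and> null_vector_field (f \<circ> \<psi>) D x' \<eta>' \<and>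
        jet_kappa_L ?h x (\<eta> x) ?a = kappa_L_formula (f \<circ> \<psi>) c \<eta>')"
      unfolding at_chart_def
      by (rule bexI[OF _ ch], unfold prod.case, rule bexI[OF _ xD], rule conjI[OF p[symmetric]],
          rule exI[of _ \<delta>], rule exI[of _ c], rule exI[of _ \<eta>]) (use cc nf base in simp)
  next
    fix k assume "at_chart A p (\<lambda>D \<psi> x'. \<exists>\<delta> c \<eta>'. characteristic_curve (f \<circ> \<psi>) D x' \<delta> c \<and> null_vector_field (f \<circ> \<psi>) D x' \<eta>' \<and>
        k = kappa_L_formula (f \<circ> \<psi>) c \<eta>')"
    then show "k = jet_kappa_L ?h x (\<eta> x) ?a" unfolding at_chart_def using main by blast
  qed
  show "kappa_N A f p = jet_kappa_N ?h x (\<eta> x) ?a ?b"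
    unfolding kappa_N_def
  proof (rule the_equality)
    show "at_chart A p (\<lambda>D \<psi> x'. \<exists>\<delta> c \<eta>'. characteristic_curve (f \<circ> \<psi>) D x' \<delta> c \<and> null_vector_field (f \<circ> \<psi>) D x' \<eta>' \<and>
        jet_kappa_N ?h x (\<eta> x) ?a ?b = kappa_N_formula (f \<circ> \<psi>) c \<eta>')"
      unfolding at_chart_def
      by (rule bexI[OF _ ch], unfold prod.case, rule bexI[OF _ xD], rule conjI[OF p[symmetric]],
          rule exI[of _ \<delta>], rule exI[of _ c], rule exI[of _ \<eta>]) (use cc nf base in simp)
  next
    fix k assume "at_chart A p (\<lambda>D \<psi> x'. \<exists>\<delta> c \<eta>'. characteristic_curve (f \<circ> \<psi>) D x' \<delta> c \<and> null_vector_field (f \<circ> \<psi>) D x' \<eta>' \<and>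
        k = kappa_N_formula (f \<circ> \<psi>) c \<eta>')"
    then show "k = jet_kappa_N ?h x (\<eta> x) ?a ?b" unfolding at_chart_def using main by blast
  qed
qed

text \<open>
  Under a change of coordinates the determinant of the metric is multiplied by the square of the Jacobian, so at a
  zero its differential vanishes in all charts or in none.
\<close>

lemma nondegenerate_in_chart:
  assumes S: "real_analytic_surface X A f" and ch: "(D, \<psi>) \<in> A" "x \<in> D" "\<psi> x = p" and l0: "lam (f \<circ> \<psi>) x = 0"
    and nd: "nondegenerate_lightlike_point A f p"
  obtains v0 where "fd (lam (f \<circ> \<psi>)) x v0 \<noteq> 0"
proof (rule ccontr)
  assume "\<not> thesis"
  then have z: "fd (lam (f \<circ> \<psi>)) x = (\<lambda>v. 0)" using that by blast
  obtain D1 \<psi>1 x1 where c1: "(D1, \<psi>1) \<in> A" "x1 \<in> D1" "\<psi>1 x1 = p" and n1: "fd (lam (f \<circ> \<psi>1)) x1 \<noteq> (\<lambda>v. 0)"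
    using nd unfolding nondegenerate_lightlike_point_def at_chart_def by blast
  let ?h = "f \<circ> \<psi>" and ?h1 = "f \<circ> \<psi>1"
  note s = surface_chart[OF S ch(1)]
  have "\<psi>1 x1 = \<psi> x" using c1(3) ch(3) by simp
  from chart_transition[OF S c1(1) ch(1) c1(2) ch(2) this]
  obtain \<theta> where \<theta>: "vana_at \<theta> x1" "\<theta> x1 = x"
    "\<forall>\<^sub>F y in nhds x1. y \<in> D1 \<and> \<theta> y \<in> D \<and> \<psi> (\<theta> y) = \<psi>1 y \<and> vana_at \<theta> y \<and> inj (fd \<theta> y)"
    by blast
  \<comment> \<open>the square of the Jacobian of the transition map\<close>
  define d where "d y = (fd \<theta> y e1 $ 1 * fd \<theta> y e2 $ 2 - fd \<theta> y e1 $ 2 * fd \<theta> y e2 $ 1)\<^sup>2" for y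
  have "ana_at (\<lambda>y. fd \<theta> y u $ k) x1" for u k
    using vana_at_fd[OF \<theta>(1) vana_at_const[of u]] by (simp add: vana_at_def)
  then have "ana_at d x1" unfolding d_def[abs_def] by (intro ana_at_power ana_at_diff ana_at_mult)
  then have d: "(d has_derivative fd d x1) (at x1)" by (intro fd_works ana_at_differentiable)
  have e: "\<forall>\<^sub>F y in nhds x1. lam ?h1 y = d y * lam ?h (\<theta> y)"
    using eventually_nhds_nhds[OF \<theta>(3)]
  proof eventually_elim
    case (elim y)
    then have y: "\<theta> y \<in> D" "vana_at \<theta> y" using eventually_nhds_x_imp_x by blast+
    have "\<forall>\<^sub>F z in nhds y. ?h1 z = ?h (\<theta> z)" using elim by (rule eventually_mono) simp
    then have "lam ?h1 y = lam (\<lambda>z. ?h (\<theta> z)) y" by (simp add: lam_eq ds2_cong)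
    also have "\<dots> = d y * lam ?h (\<theta> y)" unfolding d_def
      by (rule lam_compose[OF vana_at_differentiable[OF s(5)[OF y(1)]] vana_at_differentiable[OF y(2)]])
    finally show ?case .
  qed
  have "lam ?h differentiable (at x)" by (intro ana_at_differentiable ana_at_lam s(5) ch)
  then have "(lam ?h has_derivative (\<lambda>v. 0)) (at (\<theta> x1))" using fd_works[of "lam ?h" x] z \<theta>(2) by simp
  from has_derivative_compose[OF fd_works[OF vana_at_differentiable[OF \<theta>(1)]] this]
  have "((\<lambda>y. lam ?h (\<theta> y)) has_derivative (\<lambda>v. 0)) (at x1)" .
  from has_derivative_mult[OF d this] have "((\<lambda>y. d y * lam ?h (\<theta> y)) has_derivative (\<lambda>v. 0)) (at x1)"
    using l0 \<theta>(2) by simp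
  then have "fd (lam ?h1) x1 = (\<lambda>v. 0)" unfolding fd_cong[OF e] by (rule fd_eq)
  with n1 show False by simp
qed

section \<open>Local embeddings and replacement of a surface near a point\<close>

text \<open>
  The derivative depends continuously on the point, so the map is injective near \<open>x\<close>; on a closed ball
  a continuous injection is a homeomorphism onto its image by compactness.
\<close>

lemma immersion_local_embedding:
  fixes G :: "real^2 \<Rightarrow> real^3"
  assumes G: "vana_at G x" and inj: "inj (fd G x)"
  obtains r where "r > 0" "\<And>y. y \<in> ball x r \<Longrightarrow> vana_at G y \<and> inj (fd G y)"
    "\<And>s. 0 < s \<Longrightarrow> s < r \<Longrightarrow> homeomorphic_map (top_of_set (ball x s)) (top_of_set (G ` ball x s)) G"
proof -
  have lin: "linear (fd G x)" by (rule linear_fd[OF vana_at_differentiable[OF G]])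
  obtain L where L: "linear L" "L \<circ> fd G x = id" using linear_injective_left_inverse[OF lin inj] by blast
  have bL: "bounded_linear L" using L(1) by (simp add: linear_conv_bounded_linear)
  have dG: "(\<lambda>y. fd G y v) differentiable (at x)" for v
    by (intro vana_at_differentiable vana_at_fd G vana_at_const)
  define m where "m y = L (fd G y e1) $ 1 * L (fd G y e2) $ 2 - L (fd G y e1) $ 2 * L (fd G y e2) $ 1" for y
  have "L (fd G x v) = v" for v using L(2) by (simp add: fun_eq_iff)
  then have "m x \<noteq> 0" by (simp add: m_def axis_def)
  have dL: "(\<lambda>y. L (fd G y v) $ k) differentiable (at x)" for v k
    using bounded_linear.has_derivative[OF bounded_linear_compose[OF bounded_linear_vec_nth bL] fd_works[OF dG[of v]]]
    unfolding differentiable_def by blast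
  have "m differentiable (at x)" unfolding m_def by (intro differentiable_diff differentiable_mult dL)
  from tendsto_differentiable[OF this eventually_nhds_nonzero[OF \<open>m x \<noteq> 0\<close>]] vana_at_near[OF G]
  have "\<forall>\<^sub>F y in nhds x. m y \<noteq> 0 \<and> vana_at G y" by eventually_elim simp
  then obtain r1 where r1: "r1 > 0" "\<And>y. dist y x < r1 \<Longrightarrow> m y \<noteq> 0 \<and> vana_at G y"
    unfolding eventually_nhds_metric by blast
  have inj': "inj (fd G y)" if y: "m y \<noteq> 0" "vana_at G y" for y
  proof -
    have ly: "linear (fd G y)" by (rule linear_fd[OF vana_at_differentiable[OF y(2)]])
    show ?thesis
      unfolding linear_injective_0[OF ly]
    proof (intro allI impI)
      fix v assume "fd G y v = 0"
      then have "v$1 *\<^sub>R fd G y e1 + v$2 *\<^sub>R fd G y e2 = 0" using linear_expand_2[OF ly, of v] by simp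
      then have "L (v$1 *\<^sub>R fd G y e1 + v$2 *\<^sub>R fd G y e2) = 0" by (simp only: linear_0[OF L(1)])
      then have "v$1 *\<^sub>R L (fd G y e1) + v$2 *\<^sub>R L (fd G y e2) = 0" by (simp add: linear_add[OF L(1)] linear_cmul[OF L(1)])
      then have "v$1 * L (fd G y e1) $ 1 + v$2 * L (fd G y e2) $ 1 = 0" "v$1 * L (fd G y e1) $ 2 + v$2 * L (fd G y e2) $ 2 = 0"
        by (simp_all add: vec_eq_iff)
      then have "v$1 * m y = 0" "v$2 * m y = 0" unfolding m_def by algebra+
      then show "v = 0" using y(1) by (simp add: vec_eq_iff forall_2)
    qed
  qed
  have on: "\<exists>d>0. \<forall>y. dist x y < d \<longrightarrow> onorm (\<lambda>v. fd G y v - fd G x v) < e" if e: "e > 0" for e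
  proof -
    have "e / 3 > 0" using e by simp
    then have "\<forall>\<^sub>F y in nhds z. dist y z < e / 3" for z :: "real^3"
      unfolding eventually_nhds_metric by blast
    from tendsto_differentiable[OF dG this]
    have "\<forall>\<^sub>F y in nhds x. dist (fd G y v) (fd G x v) < e / 3" for v .
    from this[of e1] this[of e2] vana_at_near[OF G]
    have "\<forall>\<^sub>F y in nhds x. onorm (\<lambda>v. fd G y v - fd G x v) < e"
    proof eventually_elim
      case (elim y)
      have ly: "linear (fd G y)" by (rule linear_fd[OF vana_at_differentiable[OF elim(3)]])
      have "norm (fd G y v - fd G x v) \<le> (2 * (e / 3)) * norm v" for v
      proof -
        have "fd G y v - fd G x v = v$1 *\<^sub>R (fd G y e1 - fd G x e1) + v$2 *\<^sub>R (fd G y e2 - fd G x e2)"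
          using linear_expand_2[OF ly, of v] linear_expand_2[OF lin, of v] by (simp add: algebra_simps)
        also have "norm \<dots> \<le> \<bar>v$1\<bar> * norm (fd G y e1 - fd G x e1) + \<bar>v$2\<bar> * norm (fd G y e2 - fd G x e2)"
          by (rule order_trans[OF norm_triangle_ineq]) simp
        also have "\<dots> \<le> norm v * (e / 3) + norm v * (e / 3)"
          using elim(1,2) component_le_norm_cart[of v] by (intro add_mono mult_mono) (auto simp: dist_norm)
        finally show ?thesis by (simp add: algebra_simps)
      qed
      from onorm_bound[OF _ this] show ?case using e by simp
    qed
    then show ?thesis unfolding eventually_nhds_metric by (simp add: dist_commute)
  qed
  have "(G has_derivative fd G y) (at y)" if "y \<in> ball x r1" for y
    using r1(2)[of y] that by (intro fd_works vana_at_differentiable) (simp add: dist_commute)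
  from has_derivative_locally_injective[OF centre_in_ball[THEN iffD2, OF r1(1)] open_ball bL L(2) this on]
  obtain r where r: "r > 0" "ball x r \<subseteq> ball x r1" "inj_on G (ball x r)" by blast
  have va: "vana_at G y \<and> inj (fd G y)" if "y \<in> ball x r" for y
    using r1(2)[of y] inj' that r(2) by (force simp: dist_commute)
  have "homeomorphic_map (top_of_set (ball x s)) (top_of_set (G ` ball x s)) G" if s: "0 < s" "s < r" for s
  proof -
    have sub: "cball x s \<subseteq> ball x r" using s by auto
    have "continuous_on (cball x s) G"
      by (rule continuous_at_imp_continuous_on) (use va sub vana_at_differentiable differentiable_imp_continuous_within in blast)
    from homeomorphism_compact[OF compact_cball this refl inj_on_subset[OF r(3) sub]]
    obtain K where K: "homeomorphism (cball x s) (G ` cball x s) G K" by blast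
    have "homeomorphic_map (top_of_set (cball x s)) (top_of_set (G ` cball x s)) G"
      using K unfolding homeomorphic_map_maps homeomorphic_maps_def homeomorphism_def
      by (intro exI[of _ K]) auto
    from homeomorphic_map_subtopologies[OF this, of "ball x s" "G ` ball x s"]
    have "homeomorphic_map (subtopology (top_of_set (cball x s)) (ball x s)) (subtopology (top_of_set (G ` cball x s)) (G ` ball x s)) G"
      using ball_subset_cball[of x s] by (auto simp: Int_absorb1 image_mono)
    then show ?thesis
      using ball_subset_cball[of x s] by (simp add: subtopology_subtopology Int_absorb1 image_mono)
  qed
  with r(1) va show thesis by (intro that[of r]) auto
qed

lemma restrict_atlas_iff: "(E, \<phi>) \<in> restrict_atlas U A \<longleftrightarrow> (\<exists>D. (D, \<phi>) \<in> A \<and> E = D \<inter> \<phi> -` U)"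
  by (auto simp: restrict_atlas_def)

lemma homeomorphic_chart_restrict:
  assumes "homeomorphic_map (top_of_set D) (subtopology X (\<psi> ` D)) \<psi>" "openin X (\<psi> ` D)" "W \<subseteq> D"
  shows "homeomorphic_map (top_of_set W) (subtopology X (\<psi> ` W)) \<psi>"
proof -
  have "homeomorphic_map (subtopology (top_of_set D) W) (subtopology (subtopology X (\<psi> ` D)) (\<psi> ` W)) \<psi>"
    by (rule homeomorphic_map_subtopologies[OF assms(1)]) (use assms(3) openin_subset[OF assms(2)] in auto)
  then show ?thesis
    using assms(3) by (simp add: subtopology_subtopology Int_absorb1 image_mono)
qed

lemma analytic_2_manifold_restrict:
  assumes S: "real_analytic_surface X A f" and U: "openin X U"
  shows "analytic_2_manifold (subtopology X U) (restrict_atlas U A)"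
proof -
  have M: "analytic_2_manifold X A" using S by (simp add: real_analytic_surface_def)
  have top: "topspace X = (\<Union>(D, \<psi>)\<in>A. \<psi> ` D)" "Hausdorff_space X" "second_countable X"
    using M by (auto simp: analytic_2_manifold_def)
  have im: "\<psi> ` (D \<inter> \<psi> -` U) = \<psi> ` D \<inter> U" for \<psi> :: "real^2 \<Rightarrow> 'a" and D by auto
  have chart: "open E \<and> openin (subtopology X U) (\<phi> ` E) \<and> homeomorphic_map (top_of_set E) (subtopology (subtopology X U) (\<phi> ` E)) \<phi>"
    if E: "(E, \<phi>) \<in> restrict_atlas U A" for E \<phi>
  proof -
    obtain D where D: "(D, \<phi>) \<in> A" "E = D \<inter> \<phi> -` U" using E by (auto simp: restrict_atlas_iff)
    note s = surface_chart[OF S D(1)]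
    have "open E" unfolding D(2) by (rule open_chart_preimage[OF s(1,3) U])
    moreover have "openin (subtopology X U) (\<phi> ` E)"
      unfolding D(2) im using s(2) U by (auto simp: openin_subtopology)
    moreover have "homeomorphic_map (top_of_set E) (subtopology X (\<phi> ` E)) \<phi>"
      by (rule homeomorphic_chart_restrict[OF s(3,2)]) (auto simp: D(2))
    moreover have "U \<inter> \<phi> ` E = \<phi> ` E" unfolding D(2) im by auto
    ultimately show ?thesis by (simp add: subtopology_subtopology)
  qed
  have trans: "real_analytic_on (E1 \<inter> \<phi>1 -` (\<phi>2 ` E2)) (inv_into E2 \<phi>2 \<circ> \<phi>1)"
    if E: "(E1, \<phi>1) \<in> restrict_atlas U A" "(E2, \<phi>2) \<in> restrict_atlas U A" for E1 \<phi>1 E2 \<phi>2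
    unfolding real_analytic_on_iff
  proof
    fix y assume y: "y \<in> E1 \<inter> \<phi>1 -` (\<phi>2 ` E2)"
    obtain D1 D2' where D: "(D1, \<phi>1) \<in> A" "E1 = D1 \<inter> \<phi>1 -` U" "(D2', \<phi>2) \<in> A" "E2 = D2' \<inter> \<phi>2 -` U"
      using E by (auto simp: restrict_atlas_iff)
    obtain z where z: "z \<in> E2" "\<phi>1 y = \<phi>2 z" using y by auto
    have yz: "y \<in> D1" "z \<in> D2'" using y z D by auto
    note s2 = surface_chart[OF S D(3)]
    from chart_transition[OF S D(1,3) yz z(2)] obtain \<theta> where \<theta>: "vana_at \<theta> y"
      "\<forall>\<^sub>F w in nhds y. w \<in> D1 \<and> \<theta> w \<in> D2' \<and> \<phi>2 (\<theta> w) = \<phi>1 w \<and> vana_at \<theta> w \<and> inj (fd \<theta> w)"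
      by blast
    have "y \<in> E1" using y by simp
    show "vana_at (inv_into E2 \<phi>2 \<circ> \<phi>1) y"
    proof (rule vana_at_cong[OF \<theta>(1)])
      show "\<forall>\<^sub>F w in nhds y. \<theta> w = (inv_into E2 \<phi>2 \<circ> \<phi>1) w"
        using \<theta>(2) eventually_nhds_in_open[OF chart[OF E(1), THEN conjunct1] \<open>y \<in> E1\<close>]
      proof eventually_elim
        case (elim w)
        then have "\<theta> w \<in> E2" using D by auto
        moreover have "inj_on \<phi>2 E2" using s2(4) D(4) by (auto intro: inj_on_subset)
        ultimately have "inv_into E2 \<phi>2 (\<phi>2 (\<theta> w)) = \<theta> w" by (intro inv_into_f_f)
        then show ?case using elim by simp
      qed
    qed
  qed
  have "topspace (subtopology X U) = (\<Union>(E, \<phi>)\<in>restrict_atlas U A. \<phi> ` E)"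
  proof -
    have "(\<Union>(E, \<phi>)\<in>restrict_atlas U A. \<phi> ` E) = (\<Union>a\<in>A. snd a ` (fst a \<inter> snd a -` U))"
      by (simp add: restrict_atlas_def split_beta)
    also have "\<dots> = (\<Union>a\<in>A. snd a ` fst a) \<inter> U" by blast
    finally show ?thesis by (simp add: top(1) split_beta)
  qed
  with Hausdorff_space_subtopology[OF top(2), of U] second_countable_subtopology[OF top(3), of U] show ?thesis
    unfolding analytic_2_manifold_def
    by (intro conjI ballI, simp_all only: split_paired_all prod.case)
      ((rule chart, assumption)+, intro ballI, simp only: split_paired_all prod.case, rule trans)
qed

text \<open>
  An isometric map \<open>G\<close> on part of a chart defines a surface over the corresponding open part of the manifold. The
  required properties in the other charts follow through the transition maps.
\<close>

lemma surface_replace: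
  fixes G :: "real^2 \<Rightarrow> real^3"
  assumes S: "real_analytic_surface X A f" and ch: "(D, \<psi>) \<in> A" and W: "W \<subseteq> D" "open W" "connected W"
    and GW: "\<forall>y\<in>W. vana_at G y \<and> inj (fd G y) \<and> ds2 G y = ds2 (f \<circ> \<psi>) y"
    and hom: "homeomorphic_map (top_of_set W) (top_of_set (G ` W)) G"
  defines "U \<equiv> \<psi> ` W" and "g \<equiv> G \<circ> inv_into D \<psi>"
  shows "openin X U" "(W, \<psi>) \<in> restrict_atlas U A" "\<And>y. y \<in> W \<Longrightarrow> (g \<circ> \<psi>) y = G y"
    "real_analytic_surface (subtopology X U) (restrict_atlas U A) g"
    "same_first_fundamental_form (restrict_atlas U A) f g"
proof -
  have G: "vana_at G y" "inj (fd G y)" and iso: "ds2 G y = ds2 (f \<circ> \<psi>) y" if "y \<in> W" for y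
    using GW that by auto
  note s = surface_chart[OF S ch]
  have inv: "inv_into D \<psi> (\<psi> y) = y" if "y \<in> D" for y using s(4) that by (rule inv_into_f_f)
  show gG: "(g \<circ> \<psi>) y = G y" if "y \<in> W" for y using that W(1) inv by (auto simp: g_def)
  have "openin (top_of_set D) W" using W by (simp add: openin_open_eq[OF s(1)])
  then have "openin (subtopology X (\<psi> ` D)) U" unfolding U_def using homeomorphic_map_openness_eq[OF s(3)] by blast
  then show oU: "openin X U" using s(2) by (rule openin_trans_full)
  have "D \<inter> \<psi> -` U = W" unfolding U_def using W(1) s(4) by (auto dest: inj_onD)
  then show "(W, \<psi>) \<in> restrict_atlas U A" using ch by (auto simp: restrict_atlas_iff)
  have UX: "U \<subseteq> topspace X" by (rule openin_subset[OF oU])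
  have chart: "vana_at (g \<circ> \<phi>) y \<and> inj (fd (g \<circ> \<phi>) y) \<and> ds2 (f \<circ> \<phi>) y = ds2 (g \<circ> \<phi>) y"
    if E: "(E, \<phi>) \<in> A" "y \<in> E" "\<phi> y \<in> U" for E \<phi> y
  proof -
    obtain z where z: "z \<in> W" "\<phi> y = \<psi> z" using E(3) by (auto simp: U_def)
    have zD: "z \<in> D" using z W by auto
    from chart_transition[OF S E(1) ch E(2) zD z(2)] obtain \<theta> where \<theta>: "vana_at \<theta> y" "\<theta> y = z" "\<And>w. \<theta> w = inv_into D \<psi> (\<phi> w)"
      "\<forall>\<^sub>F w in nhds y. w \<in> E \<and> \<theta> w \<in> D \<and> \<psi> (\<theta> w) = \<phi> w \<and> vana_at \<theta> w \<and> inj (fd \<theta> w)"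
      by blast
    have g\<phi>: "g \<circ> \<phi> = (\<lambda>w. G (\<theta> w))" by (simp add: fun_eq_iff g_def \<theta>(3))
    have Gz: "vana_at G (\<theta> y)" "inj (fd G (\<theta> y))" using G z \<theta>(2) by auto
    have dG: "G differentiable (at (\<theta> y))" "\<theta> differentiable (at y)" "(f \<circ> \<psi>) differentiable (at (\<theta> y))"
      using Gz(1) \<theta>(1,2) s(5)[OF zD] by (auto intro!: vana_at_differentiable)
    have 1: "vana_at (g \<circ> \<phi>) y" unfolding g\<phi> by (rule vana_at_compose[OF Gz(1) \<theta>(1)])
    have "fd (g \<circ> \<phi>) y v = fd G (\<theta> y) (fd \<theta> y v)" for v unfolding g\<phi> by (rule fd_compose[OF dG(1,2)])
    then have 2: "inj (fd (g \<circ> \<phi>) y)"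
      using Gz(2) eventually_nhds_x_imp_x[OF \<theta>(4)] by (auto simp: inj_def)
    have "\<forall>\<^sub>F w in nhds y. (f \<circ> \<phi>) w = (f \<circ> \<psi>) (\<theta> w)" using \<theta>(4) by (rule eventually_mono) simp
    from ds2_cong[OF this] have "ds2 (f \<circ> \<phi>) y u v = ds2 (f \<circ> \<psi>) (\<theta> y) (fd \<theta> y u) (fd \<theta> y v)" for u v
      by (simp only: ds2_compose[OF dG(3,2)])
    then have "ds2 (f \<circ> \<phi>) y = ds2 (g \<circ> \<phi>) y"
      unfolding g\<phi> using ds2_compose[OF dG(1,2)] iso[OF z(1)] \<theta>(2) by (simp add: fun_eq_iff)
    with 1 2 show ?thesis by blast
  qed
  show "same_first_fundamental_form (restrict_atlas U A) f g"
    unfolding same_first_fundamental_form_def by (auto simp: restrict_atlas_iff chart)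
  have hW: "homeomorphic_map (top_of_set W) (subtopology X U) \<psi>"
    unfolding U_def by (rule homeomorphic_chart_restrict[OF s(3,2) W(1)])
  have "connectedin (top_of_set W) W" using W(3) by (simp add: connectedin_subtopology)
  from connectedin_continuous_map_image[OF homeomorphic_imp_continuous_map[OF hW] this]
  have conn: "connected_space (subtopology X U)" by (simp add: U_def connectedin_subtopology connectedin_def subtopology_subtopology)
  obtain \<kappa> where \<kappa>: "homeomorphic_maps (top_of_set W) (subtopology X U) \<psi> \<kappa>"
    using hW unfolding homeomorphic_map_maps by blast
  then have "homeomorphic_map (subtopology X U) (top_of_set W) \<kappa>" by (simp add: homeomorphic_maps_map)
  from homeomorphic_map_compose[OF this hom]
  have "homeomorphic_map (subtopology X U) (top_of_set (G ` W)) g"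
  proof (rule homeomorphic_map_eq)
    fix q assume "q \<in> topspace (subtopology X U)"
    then obtain y where y: "y \<in> W" "q = \<psi> y" using UX by (auto simp: U_def)
    moreover have "\<kappa> (\<psi> y) = y" using \<kappa> y(1) by (simp add: homeomorphic_maps_map)
    ultimately show "(G \<circ> \<kappa>) q = g q" using gG[OF y(1)] by simp
  qed
  moreover have "g ` topspace (subtopology X U) = G ` W"
    using UX gG unfolding U_def by (force simp: image_image)
  ultimately have emb: "embedding_map (subtopology X U) euclidean g" by (simp add: embedding_map_def)
  show "real_analytic_surface (subtopology X U) (restrict_atlas U A) g"
    unfolding real_analytic_surface_def real_analytic_on_iff
    using analytic_2_manifold_restrict[OF S oU] conn emb chart by (auto simp: restrict_atlas_iff)
qed

section \<open>The lightlike normal curvature is extrinsic\<close>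

text \<open>
  The constant extension of \<open>w\<close> is an admissible null vector field at the single point, which shows that the cubic
  depends only on the first fundamental form.
\<close>

lemma cubic_intrinsic:
  assumes "vana_at h x" "null_vector h x w"
  shows "cubic h x w = fd (\<lambda>y. ds2 h y w w) x w"
  using beta_eq_cubic[OF assms(1), of "\<lambda>y. w" "\<lambda>t. x"] assms(2) by (simp add: beta_def)

text \<open>
  Differentiating the Gram determinant of \<open>a\<close> and \<open>w\<close> at a point where \<open>w\<close> is null shows that the cubic is a
  non-zero multiple of the derivative of the determinant of the metric along \<open>w\<close>. That derivative is non-zero, since
  the determinant is already stationary in direction \<open>a\<close>.
\<close>

lemma cubic_nonzero:
  assumes h: "vana_at h x" and w: "null_vector h x w" and a: "ds2 h x a a \<noteq> 0" "a \<noteq> 0" "fd (lam h) x a = 0"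
    and nd: "fd (lam h) x v0 \<noteq> 0"
  shows "cubic h x w \<noteq> 0"
proof
  assume c0: "cubic h x w = 0"
  have hd: "h differentiable (at x)" by (rule vana_at_differentiable[OF h])
  define k where "k = (a$1 * w$2 - a$2 * w$1)\<^sup>2"
  have d: "a$1 * w$2 - a$2 * w$1 \<noteq> 0" by (rule null_vector_scale(1)[OF hd w w a(1)])
  have lin: "linear (fd (lam h) x)" by (rule linear_fd[OF ana_at_differentiable[OF ana_at_lam[OF h]]])
  have der: "((\<lambda>y. ds2 h y u v) has_derivative fd (\<lambda>y. ds2 h y u v) x) (at x)" for u v
    by (intro fd_works ana_at_differentiable ana_at_ds2 h vana_at_const)
  have z: "ds2 h x w w = 0" "ds2 h x a w = 0" using w ds2_commute[of h x a w] by (simp_all add: null_vector_def)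
  have "((\<lambda>y. ds2 h y a a * ds2 h y w w - ds2 h y a w * ds2 h y a w) has_derivative
      (\<lambda>v. ds2 h x a a * fd (\<lambda>y. ds2 h y w w) x v)) (at x)"
    using has_derivative_diff[OF has_derivative_mult[OF der[of a a] der[of w w]] has_derivative_mult[OF der[of a w] der[of a w]]]
    by (simp add: z)
  moreover have "\<forall>\<^sub>F y in nhds x. ds2 h y a a * ds2 h y w w - ds2 h y a w * ds2 h y a w = k * lam h y"
    using vana_at_near[OF h]
    by (rule eventually_mono)
      (simp only: k_def gram_det[unfolded power2_eq_square] vana_at_differentiable power2_eq_square)
  ultimately have "((\<lambda>y. k * lam h y) has_derivative (\<lambda>v. ds2 h x a a * fd (\<lambda>y. ds2 h y w w) x v)) (at x)"
    by (simp only: has_derivative_cong_nhds)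
  moreover have "((\<lambda>y. k * lam h y) has_derivative (\<lambda>v. k * fd (lam h) x v)) (at x)"
    by (intro has_derivative_mult_right fd_works ana_at_differentiable ana_at_lam h)
  ultimately have "(\<lambda>v. ds2 h x a a * fd (\<lambda>y. ds2 h y w w) x v) = (\<lambda>v. k * fd (lam h) x v)"
    by (rule has_derivative_unique)
  from fun_cong[OF this, of w] have "k * fd (lam h) x w = 0"
    using c0 cubic_intrinsic[OF h w] by simp
  then have lw: "fd (lam h) x w = 0" using d by (simp add: k_def)
  obtain s t where "v0 = s *\<^sub>R a + t *\<^sub>R w" using det2_basis[OF d] by blast
  then have "fd (lam h) x v0 = 0" using a(3) lw by (simp add: linear_add[OF lin] linear_cmul[OF lin])
  with nd show False by simp
qed

text \<open>
  With one spacelike direction, the sign of the determinant decides the type of the form.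
\<close>

lemma causal_type:
  fixes a u :: "real^2"
  assumes hd: "h differentiable (at y)" and a: "ds2 h y a a > 0" and aw: "a$1 * u$2 - a$2 * u$1 \<noteq> 0"
  shows "lam h y > 0 \<Longrightarrow> positive_definite_form (ds2 h y)" "lam h y < 0 \<Longrightarrow> indefinite_form (ds2 h y)"
proof -
  have a0: "a \<noteq> 0" using aw by auto
  show "positive_definite_form (ds2 h y)" if l: "lam h y > 0"
    unfolding positive_definite_form_def
  proof (intro allI impI)
    fix v :: "real^2" assume v: "v \<noteq> 0"
    show "ds2 h y v v > 0"
    proof (cases "a$1 * v$2 - a$2 * v$1 = 0")
      case True
      then obtain s where s: "v = s *\<^sub>R a" using det2_zero[OF a0] by blast
      then have "s \<noteq> 0" using v by auto
      then have "s * s > 0" using not_real_square_gt_zero by blast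
      then show ?thesis using a by (simp add: s ds2_linear[OF hd] flip: mult.assoc)
    next
      case False
      then have "(a$1 * v$2 - a$2 * v$1)\<^sup>2 * lam h y > 0" using l by simp
      then have "ds2 h y a a * ds2 h y v v > 0"
        using gram_det[OF hd, of a v] zero_le_power2[of "ds2 h y a v"] by linarith
      then show ?thesis using a by (simp add: zero_less_mult_iff)
    qed
  qed
  show "indefinite_form (ds2 h y)" if l: "lam h y < 0"
  proof -
    \<comment> \<open>the orthogonal projection of \<open>u\<close> off \<open>a\<close>, scaled to avoid a division\<close>
    define v where "v = ds2 h y a a *\<^sub>R u - ds2 h y a u *\<^sub>R a"
    have "ds2 h y v v = ds2 h y a a * (ds2 h y a a * ds2 h y u u - (ds2 h y a u)\<^sup>2)"
      by (simp add: v_def ds2_linear[OF hd] ds2_commute[of h y u a] power2_eq_square algebra_simps)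
    also have "\<dots> = ds2 h y a a * ((a$1 * u$2 - a$2 * u$1)\<^sup>2 * lam h y)"
      by (simp only: gram_det[OF hd])
    also have "\<dots> < 0" using a aw l by (simp add: mult_less_0_iff)
    finally have "ds2 h y v v < 0" .
    moreover have "\<not> degenerate_form (ds2 h y)" using l degenerate_iff[OF hd] by simp
    ultimately show ?thesis unfolding indefinite_form_def using a by blast
  qed
qed

lemma changes_sign:
  fixes \<phi> :: "real^2 \<Rightarrow> real"
  assumes "\<phi> differentiable (at x)" "\<phi> x = 0" "fd \<phi> x v \<noteq> 0" "s > 0"
  shows "\<exists>y\<in>ball x s. \<phi> y > 0" "\<exists>y\<in>ball x s. \<phi> y < 0"
proof -
  have pos: "\<exists>y\<in>ball x s. q * \<phi> y > 0" if q: "q * fd \<phi> x v \<noteq> 0" for q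
  proof -
    define u where "u = (q * fd \<phi> x v) *\<^sub>R v"
    have "q * fd \<phi> x u = (q * fd \<phi> x v) * (q * fd \<phi> x v)"
      by (simp add: u_def linear_cmul[OF linear_fd[OF assms(1)]])
    then have qu: "q * fd \<phi> x u > 0" using q by (metis not_square_less_zero linorder_neqE_linordered_idom mult_eq_0_iff)
    have "((\<lambda>t. x + t *\<^sub>R u) has_vector_derivative u) (at 0)" by (auto intro!: derivative_eq_intros)
    from has_vector_derivative_chain[OF this, of \<phi>] assms(1)
    have "((\<lambda>t. q * \<phi> (x + t *\<^sub>R u)) has_real_derivative q * fd \<phi> x u) (at 0)"
      by (intro DERIV_cmult) (simp add: has_real_derivative_iff_has_vector_derivative)
    from DERIV_pos_inc_right[OF this qu] obtain d where d: "d > 0" "\<And>t. 0 < t \<Longrightarrow> t < d \<Longrightarrow> q * \<phi> (x + t *\<^sub>R u) > 0"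
      using assms(2) by auto
    define t where "t = min (d / 2) (s / (norm u + 1) / 2)"
    have t: "0 < t" "t < d" using d(1) assms(4) by (auto simp: t_def min_def divide_simps add_nonneg_pos)
    have "t * norm u < s"
    proof -
      have "t * norm u \<le> s / (norm u + 1) / 2 * norm u" by (intro mult_right_mono) (auto simp: t_def)
      also have "\<dots> = s * (norm u / (norm u + 1)) / 2" by simp
      also have "\<dots> \<le> s * 1 / 2"
        using assms(4) by (intro divide_right_mono mult_left_mono) (auto simp: divide_simps add_nonneg_pos)
      also have "\<dots> < s" using assms(4) by simp
      finally show ?thesis .
    qed
    then have "x + t *\<^sub>R u \<in> ball x s" using t by (simp add: dist_norm)
    with d(2)[OF t] show ?thesis by blast
  qed
  show "\<exists>y\<in>ball x s. \<phi> y > 0" "\<exists>y\<in>ball x s. \<phi> y < 0"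
    using pos[of 1] pos[of "-1"] assms(3) by auto
qed

theorem corollary3:
  fixes X :: "'a topology" and A :: "'a chart set" and f :: "'a \<Rightarrow> real^3" and p :: 'a
  assumes "real_analytic_surface X A f"
    and "mixed_type A f"
    and "generic_surface A f"
    and "first_kind A f p"
  shows "\<exists>U g. openin X U \<and> p \<in> U \<and>
           real_analytic_surface (subtopology X U) (restrict_atlas U A) g \<and>
           mixed_type (restrict_atlas U A) g \<and>
           same_first_fundamental_form (restrict_atlas U A) f g \<and>
           \<not> (\<forall>q\<in>U. first_kind A f q \<longrightarrow> kappa_N (restrict_atlas U A) g q = kappa_N A f q)"
proof -
  note S = assms(1)
  obtain D \<psi> x \<delta> c where ch: "(D, \<psi>) \<in> A" and xD: "x \<in> D" and px: "\<psi> x = p"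
    and cc: "characteristic_curve (f \<circ> \<psi>) D x \<delta> c" and sl: "spacelike (velocity (f \<circ> \<psi> \<circ> c) 0)"
    using assms(4) unfolding first_kind_def at_chart_def by blast
  have nd: "nondegenerate_lightlike_point A f p" using assms(4) by (simp add: first_kind_def)
  define h where "h = f \<circ> \<psi>"
  note s = surface_chart[OF S ch, folded h_def]
  note cc = cc[folded h_def]
  note d = characteristic_curveD[OF cc]
  define a b where "a = velocity c 0" and "b = velocity (velocity c) 0"
  have hx: "vana_at h x" by (rule s(5)[OF xD])
  have hd: "h differentiable (at x)" by (rule vana_at_differentiable[OF hx])
  have "velocity (h \<circ> c) 0 = fd h x a"
    using jet2_velocity(2)[OF jet2_compose[OF vana_at_twice_diff[OF hx] d(5)]] by (simp add: o_def a_def)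
  then have aa: "ds2 h x a a > 0" using sl by (simp add: h_def[symmetric] spacelike_def ds2_def)
  have l0: "lam h x = 0" using d(3) degenerate_iff[OF hd] by (simp add: LD_def)
  obtain v0 where v0: "fd (lam h) x v0 \<noteq> 0"
    using nondegenerate_in_chart[OF S ch xD px l0[unfolded h_def] nd] unfolding h_def by blast
  have lj: "lam_jet h x a b" unfolding a_def b_def by (rule characteristic_lam_jet[OF s(5) cc])
  have ll: "linear (fd (lam h) x)" by (rule linear_fd[OF ana_at_differentiable[OF ana_at_lam[OF hx]]])
  have av: "a$1 * v0$2 - a$2 * v0$1 \<noteq> 0"
  proof
    assume "a$1 * v0$2 - a$2 * v0$1 = 0"
    then obtain t where "v0 = t *\<^sub>R a" using det2_zero lj unfolding lam_jet_def by blast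
    with v0 lj show False by (simp add: linear_cmul[OF ll] lam_jet_def)
  qed
  obtain \<eta> where \<eta>: "null_vector_field h D x \<eta>"
    using null_vector_field_exists[OF hx s(1) xD _ av] aa by auto
  define w where "w = \<eta> x"
  have w: "null_vector h x w" unfolding w_def by (rule null_vector_field_at(2)[OF \<eta> d(3)])
  note kf = kappa_in_chart[OF S ch px[symmetric] cc[unfolded h_def] v0[unfolded h_def] aa[unfolded h_def a_def] \<eta>[unfolded h_def],
      folded h_def a_def b_def w_def]
  have "lightlike_point A f p"
    using nd unfolding lightlike_point_def nondegenerate_lightlike_point_def at_chart_def LD_def by blast
  then have "kappa_L A f p \<noteq> 0"
    using assms(3,4) unfolding generic_surface_def generic_point_def by blast
  then have m: "lprod (D2 h x a a) (fd h x w) \<noteq> 0" unfolding kf jet_kappa_L_def by auto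
  have aw: "a$1 * w$2 - a$2 * w$1 \<noteq> 0" by (rule null_vector_scale(1)[OF hd w w]) (use aa in simp)
  have wz: "ds2 h x a w = 0" "ds2 h x w w = 0" using w ds2_commute[of h x a w] by (simp_all add: null_vector_def)
  obtain G :: "real^2 \<Rightarrow> real^3" where G: "vana_at G x" "\<forall>\<^sub>F y in nhds x. ds2 G y = ds2 h y" "fd G x = fd h x"
      "D2 G x a a = D2 h x a a - ds2 h x a a *\<^sub>R fd h x w"
    using isometric_deformation_local[OF hx aw _ wz m] aa by auto
  have "inj (fd G x)" unfolding G(3) by (rule s(6)[OF xD])
  from immersion_local_embedding[OF G(1) this] obtain r where r: "r > 0"
    "\<And>y. y \<in> ball x r \<Longrightarrow> vana_at G y \<and> inj (fd G y)"
    "\<And>t. 0 < t \<Longrightarrow> t < r \<Longrightarrow> homeomorphic_map (top_of_set (ball x t)) (top_of_set (G ` ball x t)) G"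
    by blast
  have "(\<lambda>y. ds2 h y a a) differentiable (at x)"
    by (intro ana_at_differentiable ana_at_ds2 hx vana_at_const)
  from tendsto_differentiable[OF this eventually_nhds_in_open[OF open_greaterThan[of 0]]] aa
  have "\<forall>\<^sub>F y in nhds x. ds2 h y a a > 0" by simp
  with G(2) eventually_nhds_in_open[OF s(1) xD]
  have "\<forall>\<^sub>F y in nhds x. ds2 G y = ds2 h y \<and> y \<in> D \<and> ds2 h y a a > 0" by eventually_elim simp
  then obtain r2 where r2: "r2 > 0" "\<And>y. dist y x < r2 \<Longrightarrow> ds2 G y = ds2 h y \<and> y \<in> D \<and> ds2 h y a a > 0"
    unfolding eventually_nhds_metric by blast
  define t where "t = min r r2 / 2"
  have t: "0 < t" "t < r" "t < r2" using r(1) r2(1) by (auto simp: t_def)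
  define W where "W = ball x t"
  have W: "W \<subseteq> D" "open W" "connected W" "x \<in> W"
    using r2(2) t by (auto simp: W_def dist_commute)
  have GW: "vana_at G y" "inj (fd G y)" "ds2 G y = ds2 h y" "ds2 h y a a > 0" if "y \<in> W" for y
    using that r(2)[of y] r2(2)[of y] t by (auto simp: W_def dist_commute)
  define U g where "U = \<psi> ` W" and "g = G \<circ> inv_into D \<psi>"
  have "\<forall>y\<in>W. vana_at G y \<and> inj (fd G y) \<and> ds2 G y = ds2 (f \<circ> \<psi>) y" using GW(1-3) by (simp add: h_def)
  note sr = surface_replace[OF S ch W(1-3) this r(3)[OF t(1,2), folded W_def],
      folded U_def g_def]
  define k where "k = g \<circ> \<psi>"
  note sk = surface_chart[OF sr(4,2), folded k_def]
  have kG: "\<forall>\<^sub>F y in nhds z. k y = G y" if "z \<in> W" for z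
    using eventually_nhds_in_open[OF W(2) that] by (rule eventually_mono) (use sr(3) in \<open>simp add: k_def\<close>)
  have kds: "ds2 k y = ds2 h y" if "y \<in> W" for y
    using ds2_cong[OF kG[OF that]] GW(3)[OF that] by simp
  have klam: "lam k y = lam h y" if "y \<in> W" for y
    by (simp add: lam_eq kds[OF that])
  have klamfd: "fd (lam k) x = fd (lam h) x" "D2 (lam k) x = D2 (lam h) x"
  proof -
    have e: "\<forall>\<^sub>F y in nhds x. lam k y = lam h y"
      using eventually_nhds_in_open[OF W(2,4)] by (rule eventually_mono) (rule klam)
    then show "fd (lam k) x = fd (lam h) x" by (rule fd_cong)
    have "\<forall>\<^sub>F y in nhds x. fd (lam k) y v = fd (lam h) y v" for v
      using eventually_nhds_nhds[OF e] by (rule eventually_mono) (simp add: fd_cong)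
    from fd_cong[OF this] show "D2 (lam k) x = D2 (lam h) x" unfolding D2_def by (simp add: fun_eq_iff)
  qed
  have kd: "k differentiable (at y)" if "y \<in> W" for y by (rule vana_at_differentiable[OF sk(5)[OF that]])
  have mixed: "mixed_type (restrict_atlas U A) g"
  proof -
    have ty: "at_chart (restrict_atlas U A) (\<psi> y) (\<lambda>D \<psi> x. Q (ds2 (g \<circ> \<psi>) x))" if "y \<in> W" "Q (ds2 k y)" for y Q
      unfolding at_chart_def
      by (rule bexI[OF _ sr(2)], unfold prod.case, rule bexI[OF _ that(1)]) (use that(2) in \<open>simp add: k_def\<close>)
    have ld: "lam h differentiable (at x)" by (rule ana_at_differentiable[OF ana_at_lam[OF hx]])
    obtain y1 y2 where y: "y1 \<in> W" "lam h y1 > 0" "y2 \<in> W" "lam h y2 < 0"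
      using changes_sign[OF ld l0 v0 t(1)] unfolding W_def by blast
    have "positive_definite_form (ds2 k y1)"
      by (rule causal_type(1)[OF kd[OF y(1)] _ aw]) (simp_all add: kds klam GW(4) y)
    from ty[OF y(1), of positive_definite_form, OF this]
    have "spacelike_point (restrict_atlas U A) g (\<psi> y1)" unfolding spacelike_point_def .
    moreover have "indefinite_form (ds2 k y2)"
      by (rule causal_type(2)[OF kd[OF y(3)] _ aw]) (simp_all add: kds klam GW(4) y)
    from ty[OF y(3), of indefinite_form, OF this]
    have "timelike_point (restrict_atlas U A) g (\<psi> y2)" unfolding timelike_point_def .
    moreover have "degenerate_form (ds2 k x)" using degenerate_iff[OF kd[OF W(4)]] klam[OF W(4)] l0 by simp
    from ty[OF W(4), of degenerate_form, OF this] have "lightlike_point (restrict_atlas U A) g (\<psi> x)" unfolding lightlike_point_def .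
    ultimately show ?thesis unfolding mixed_type_def by blast
  qed
  \<comment> \<open>the degenerate locus depends on the metric only, so the characteristic curve of \<open>f\<close>, shortened, serves \<open>g\<close>\<close>
  obtain \<delta>' where cc': "characteristic_curve h (D \<inter> W) x \<delta>' c"
    using characteristic_curve_restrict[OF s(5,1) cc v0 W(2,4)] by blast
  have "LD k W = LD h (D \<inter> W)" using W(1) kds by (auto simp: LD_def)
  then have cck: "characteristic_curve k W x \<delta>' c"
    using cc' W(1) unfolding characteristic_curve_def by (simp add: Int_absorb1)
  have kx: "vana_at k x" by (rule sk(5)[OF W(4)])
  have kaa: "ds2 k x a a > 0" using aa kds[OF W(4)] by simp
  obtain \<eta>' where \<eta>': "null_vector_field k W x \<eta>'"
    using null_vector_field_exists[OF kx W(2,4) _ aw] kaa by auto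
  have kw: "null_vector k x w" "null_vector k x (\<eta>' x)"
    using w null_vector_field_at(2)[OF \<eta>' characteristic_curveD(3)[OF cck]] kds[OF W(4)] by (auto simp: null_vector_def)
  have kv0: "fd (lam k) x v0 \<noteq> 0" using v0 klamfd by simp
  have klj: "lam_jet k x a b" using lj klamfd by (simp add: lam_jet_def)
  have "kappa_N (restrict_atlas U A) g p = jet_kappa_N k x (\<eta>' x) a b"
    using kappa_in_chart(2)[OF sr(4,2) px[symmetric] cck[unfolded k_def] kv0[unfolded k_def] kaa[unfolded k_def a_def] \<eta>'[unfolded k_def]]
    by (simp add: k_def a_def b_def)
  also have "\<dots> = jet_kappa_N k x w a b"
    by (rule jet_kappa_invariant(3)[OF kx sk(6)[OF W(4)] kv0 klj klj kw kaa])
  finally have kg: "kappa_N (restrict_atlas U A) g p = jet_kappa_N k x w a b" .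
  have kfd: "fd k x = fd h x" using fd_cong[OF kG[OF W(4)]] G(3) by simp
  have kD2: "D2 k x a a = D2 h x a a - ds2 h x a a *\<^sub>R fd h x w"
  proof -
    have "\<forall>\<^sub>F y in nhds x. fd k y a = fd G y a"
      using eventually_nhds_nhds[OF kG[OF W(4)]] by (rule eventually_mono) (simp add: fd_cong)
    from fd_cong[OF this] have "D2 k x a a = D2 G x a a" unfolding D2_def by simp
    with G(4) show ?thesis by simp
  qed
  have cub: "cubic k x w = cubic h x w"
  proof -
    have "\<forall>\<^sub>F y in nhds x. ds2 k y w w = ds2 h y w w"
      using eventually_nhds_in_open[OF W(2,4)] by (rule eventually_mono) (simp add: kds)
    then show ?thesis unfolding cubic_intrinsic[OF kx kw(1)] cubic_intrinsic[OF hx w] by (simp add: fd_cong)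
  qed
  have c0: "cubic h x w \<noteq> 0"
    using cubic_nonzero[OF hx w _ _ _ v0, of a] aa lj by (auto simp: lam_jet_def)
  have nl: "lprod (fd h x w) (normal_null (fd h x a) (fd h x w)) = 1"
  proof -
    have "fd h x w \<noteq> 0" using s(6)[OF xD] linear_0[OF linear_fd[OF hd]] w by (metis injD null_vector_def)
    then have "lprod (normal_null (fd h x a) (fd h x w)) (fd h x w) = 1"
      by (intro normal_null(3)) (use aa wz in \<open>simp_all add: ds2_def\<close>)
    then show ?thesis by (simp add: lprod_commute)
  qed
  \<comment> \<open>\<open>D2\<close> changed by \<open>- ds2 h x a a\<close> times a vector whose product with the null normal is 1\<close>
  have "jet_kappa_N k x w a b = jet_kappa_N h x w a b - root 3 (cubic h x w)"
    unfolding jet_kappa_N_def cub kfd kD2 kds[OF W(4)] using aa nl by (simp add: lprod_linear field_simps)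
  then have "kappa_N (restrict_atlas U A) g p \<noteq> kappa_N A f p"
    unfolding kg kf using c0 by simp
  moreover have "p \<in> U" using W(4) px by (auto simp: U_def)
  ultimately show ?thesis using sr(1,4,5) mixed assms(4) by blast
qed

end
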